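(* Let $(A,\Delta)$ be an algebraic quantum group and $(X,\alpha)$ a right $A$-Galois object, with associated map $\beta(a)=a^{[1]}\otimes a^{[2]}$ and automorphism $\theta_X$. For all $x,y\in X$ and $a\in A$: (xiii) $S(a)^{[1]}\otimes S(a)^{[2]}=\theta_X(a^{[2]})\otimes a^{[1]}$; (xiv) $x_{(1)}{}^{[1]}\theta_X(x_{(0)})y\otimes x_{(1)}{}^{[2]}=y\otimes x$; (xv) $\theta_X(a^{[2]})a^{[1]}y=\varepsilon(a)y$; (xvi) $S^2(a)^{[1]}\otimes S^2(a)^{[2]}=\theta_X(a^{[1]})\otimes\theta_X(a^{[2]})$.
   Context: Conventions: $k$ is a field; all algebras are $k$-algebras, non-zero, possibly without unit, and non-degenerate ($ab=0$ for all $b$ implies $a=0$, and $ab=0$ for all $a$ implies $b=0$). $M(X)$ is the multiplier algebra of $X$, with $X\subseteq M(X)$ and $k=k\cdot 1\subseteq M(X)$; $\otimes$ is over $k$; $\iota$ is the identity map. Automorphisms are extended to multiplier algebras without change of notation. A regular multiplier Hopf algebra is a pair $(A,\Delta)$ with $A$ an algebra and $\Delta:A\to M(A\otimes A)$ a coassociative homomorphism which is non-degenerate ($\Delta(A)(A\otimes A)=A\otimes A=(A\otimes A)\Delta(A)$) and such that the maps sending $a\otimes b$ to $\Delta(a)(1\otimes b)$, $(a\otimes 1)\Delta(b)$, $\Delta(a)(b\otimes 1)$, $(1\otimes a)\Delta(b)$ are all bijections of $A\otimes A$ onto $A\otimes A$; it has a unique counit $\varepsilon$ and antipode $S$. An algebraic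 quantum group is a regular multiplier Hopf algebra with a non-zero functional $\varphi$ (left invariant functional, faithful and unique up to scalar; a choice is fixed) such that $(\iota\otimes\varphi)(\Delta(a)(b\otimes 1))=\varphi(a)b$. The modular automorphism $\sigma$ of $A$ satisfies $\varphi(ab)=\varphi(b\sigma(a))$. A right coaction of $A$ on an algebra $X$ is an injective homomorphism $\alpha:X\to M(X\otimes A)$ with $\alpha(X)(1\otimes A)\subseteq X\otimes A$, $(1\otimes A)\alpha(X)\subseteq X\otimes A$ and $(\alpha\otimes\iota)\alpha=(\iota\otimes\Delta)\alpha$; it extends canonically to $M(X)\to M(X\otimes A)$. It is reduced if also $(X\otimes 1)\alpha(X)\subseteq X\otimes A$ (then also $\alpha(X)(X\otimes 1)\subseteq X\otimes A$). $(X,\alpha)$ is a right $A$-Galois object if $\alpha$ is a reduced right coaction, the only $f\in M(X)$ with $\alpha(f)=f\otimes 1$ are the scalars, and $V:X\otimes X\to X\otimes A$, $x\otimes y\mapsto (x\otimes 1)\alpha(y)$, is bijective; then $W:X\otimes X\to X\otimes A$, $x\otimes y\mapsto\alpha(x)(y\otimes 1)$, is also bijective. Formal Sweedler notation: $\alpha(x)=x_{(0)}\otimes x_{(1)}$. For $a\in A$, $\beta(a)=a^{[1]}\otimes a^{[2]}\in M(X\otimes X)$ is the multiplier determined by $(x\otimes 1)\beta(a)=V^{-1}(x\otimes a)$ and $\beta(a)(1\otimes y)=W^{-1}(y\otimes S(a))$; products of $\beta(a)$ with $x\otimes1$ or $1\otimes x$, on either side, lie in $X\otimes X$. $\varphi_X$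 is the (faithful) functional on $X$ with $(\iota\otimes\varphi)(\alpha(x))=\varphi_X(x)1$; $\sigma_X$ is the automorphism of $X$ with $\varphi_X(y\sigma_X(x))=\varphi_X(xy)$. $\theta_X:X\to X$ is the automorphism $\theta_X(x)=\sigma_X(\hat\delta\cdot x)$, where $\hat\delta$ is the modular element of the dual $\hat A$, which as a functional on $A$ equals $\varepsilon\circ\sigma^{-1}$; so $\theta_X(x)=\sigma_X\big((\iota\otimes\varepsilon\sigma^{-1})\alpha(x)\big)$. Expressions are to be read as multipliers or, where covered by elements of $X$, as elements of the tensor products. *)

theory Defs
  imports Complex_Main "HOL-Library.Poly_Mapping"
begin

section \<open>Algebras and multiplier algebras\<close>

text \<open>
  The multiplication of an algebra comes from the type class \<open>ring\<close> (no unit), the scalar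
  multiplication is an explicit parameter.
\<close>

locale nondegenerate_algebra = vector_space scale
  for scale :: "'k::field \<Rightarrow> 'a::ring \<Rightarrow> 'a" +
  assumes scale_mult_left: "scale c a * b = scale c (a * b)"
    and scale_mult_right: "a * scale c b = scale c (a * b)"
    and nonzero: "\<exists>a::'a. a \<noteq> 0"
    and nondegenerate_left: "(\<And>b. a * b = 0) \<Longrightarrow> a = 0"
    and nondegenerate_right: "(\<And>a. a * b = 0) \<Longrightarrow> b = 0"

text \<open>
  A multiplier \<open>m\<close> is the pair of the maps \<open>x \<mapsto> m x\<close> and \<open>x \<mapsto> x m\<close>. For a non-degenerate
  algebra both maps are automatically linear over the base field, so that the base field need
  not be mentioned here.
\<close>

typedef (overloaded) 'a multiplier =
  "{(L :: 'a::ring \<Rightarrow> 'a, R :: 'a \<Rightarrow> 'a).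
      additive L \<and> additive R \<and>
      (\<forall>x y. L (x * y) = L x * y) \<and> (\<forall>x y. R (x * y) = x * R y) \<and>
      (\<forall>x y. x * L y = R x * y)}"
  by (rule exI[of _ "(\<lambda>x. x, \<lambda>x. x)"]) (simp add: additive_def)

definition lact :: "'a::ring multiplier \<Rightarrow> 'a \<Rightarrow> 'a"  \<comment> \<open>\<open>m x\<close>\<close>
  where "lact m = fst (Rep_multiplier m)"

definition ract :: "'a::ring \<Rightarrow> 'a multiplier \<Rightarrow> 'a"  \<comment> \<open>\<open>x m\<close>\<close>
  where "ract x m = snd (Rep_multiplier m) x"

definition make_multiplier :: "('a::ring \<Rightarrow> 'a) \<Rightarrow> ('a \<Rightarrow> 'a) \<Rightarrow> 'a multiplier"
  where "make_multiplier L R = Abs_multiplier (L, R)"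

lemma multiplier_eqI:
  assumes "\<And>x. lact m x = lact n x" and "\<And>x. ract x m = ract x n"
  shows "m = n"
proof -
  have "Rep_multiplier m = Rep_multiplier n"
    using assms by (intro prod_eqI ext) (simp_all add: lact_def ract_def)
  then show ?thesis by (simp add: Rep_multiplier_inject)
qed

lemma lact_add: "lact m (x + y) = lact m x + lact m y"
  and ract_add: "ract (x + y) m = ract x m + ract y m"
  and lact_mult: "lact m (x * y) = lact m x * y"
  and ract_mult: "ract (x * y) m = x * ract y m"
  and mult_lact: "x * lact m y = ract x m * y"
  using Rep_multiplier[of m] by (auto simp: lact_def ract_def additive_def)

lemma make_multiplier:
  assumes "\<And>x y. L (x + y) = L x + L y" and "\<And>x y. R (x + y) = R x + R y"
    and "\<And>x y. L (x * y) = L x * y" and "\<And>x y. R (x * y) = x * R y"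
    and "\<And>x y. x * L y = R x * y"
  shows "lact (make_multiplier L R) x = L x" and "ract x (make_multiplier L R) = R x"
proof -
  have "Rep_multiplier (make_multiplier L R) = (L, R)"
    unfolding make_multiplier_def
    by (rule Abs_multiplier_inverse) (simp add: assms additive_def)
  then show "lact (make_multiplier L R) x = L x" "ract x (make_multiplier L R) = R x"
    by (simp_all add: lact_def ract_def)
qed

instantiation multiplier :: (ring) "{ring, monoid_mult}"
begin

definition zero_multiplier :: "'a multiplier"
  where "0 = make_multiplier (\<lambda>x. 0) (\<lambda>x. 0)"

definition one_multiplier :: "'a multiplier"
  where "1 = make_multiplier (\<lambda>x. x) (\<lambda>x. x)"

definition plus_multiplier :: "'a multiplier \<Rightarrow> 'a multiplier \<Rightarrow> 'a multiplier"
  where "m + n = make_multiplier (\<lambda>x. lact m x + lact n x) (\<lambda>x. ract x m + ract x n)"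

definition uminus_multiplier :: "'a multiplier \<Rightarrow> 'a multiplier"
  where "- m = make_multiplier (\<lambda>x. - lact m x) (\<lambda>x. - ract x m)"

definition minus_multiplier :: "'a multiplier \<Rightarrow> 'a multiplier \<Rightarrow> 'a multiplier"
  where "m - n = make_multiplier (\<lambda>x. lact m x - lact n x) (\<lambda>x. ract x m - ract x n)"

definition times_multiplier :: "'a multiplier \<Rightarrow> 'a multiplier \<Rightarrow> 'a multiplier"
  where "m * n = make_multiplier (\<lambda>x. lact m (lact n x)) (\<lambda>x. ract (ract x m) n)"

lemma multiplier_acts:
  fixes m n :: "'a multiplier"
  shows "lact (0::'a multiplier) x = 0" "ract x (0::'a multiplier) = 0"
    "lact (1::'a multiplier) x = x" "ract x (1::'a multiplier) = x"
    "lact (m + n) x = lact m x + lact n x" "ract x (m + n) = ract x m + ract x n"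
    "lact (- m) x = - lact m x" "ract x (- m) = - ract x m"
    "lact (m - n) x = lact m x - lact n x" "ract x (m - n) = ract x m - ract x n"
    "lact (m * n) x = lact m (lact n x)" "ract x (m * n) = ract (ract x m) n"
  unfolding zero_multiplier_def one_multiplier_def plus_multiplier_def uminus_multiplier_def
    minus_multiplier_def times_multiplier_def
  by (subst make_multiplier; simp add: lact_add ract_add lact_mult ract_mult mult_lact
      algebra_simps)+

instance
  by standard (rule multiplier_eqI;
      simp add: multiplier_acts lact_add ract_add algebra_simps)+

end

definition mult_of :: "'a::ring \<Rightarrow> 'a multiplier"  \<comment> \<open>the inclusion of \<open>X\<close> into \<open>M(X)\<close>\<close>
  where "mult_of a = make_multiplier (\<lambda>x. a * x) (\<lambda>x. x * a)"

definition elem :: "'a::ring multiplier \<Rightarrow> 'a"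
    \<comment> \<open>the inverse of \<^const>\<open>mult_of\<close>, to be used on \<open>range mult_of\<close> only\<close>
  where "elem m = (THE a. mult_of a = m)"

definition mult_scalar :: "('k \<Rightarrow> 'a \<Rightarrow> 'a) \<Rightarrow> 'k::field \<Rightarrow> 'a::ring multiplier"
    \<comment> \<open>the inclusion of the base field into \<open>M(X)\<close>\<close>
  where "mult_scalar scale c = make_multiplier (scale c) (scale c)"

definition mult_scale :: "('k \<Rightarrow> 'a \<Rightarrow> 'a) \<Rightarrow> 'k::field \<Rightarrow> 'a::ring multiplier \<Rightarrow> 'a multiplier"
  where "mult_scale scale c m = mult_scalar scale c * m"

text \<open>
  The canonical extension \<open>M(B) \<rightarrow> M(C)\<close> of a homomorphism \<open>f : B \<rightarrow> M(C)\<close>; it is unique, for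
  instance, if \<open>f\<close> is non-degenerate.
\<close>

definition mult_extend ::
    "('b::ring \<Rightarrow> 'c::ring multiplier) \<Rightarrow> 'b multiplier \<Rightarrow> 'c multiplier"
  where "mult_extend f m = (THE n. \<forall>b. n * f b = f (lact m b) \<and> f b * n = f (ract b m))"

definition algebra_hom ::
    "('k::field \<Rightarrow> 'b::ring \<Rightarrow> 'b) \<Rightarrow> ('k \<Rightarrow> 'c::ring \<Rightarrow> 'c) \<Rightarrow> ('b \<Rightarrow> 'c) \<Rightarrow> bool"
  where "algebra_hom sB sC f \<longleftrightarrow>
    Vector_Spaces.linear sB sC f \<and> (\<forall>x y. f (x * y) = f x * f y)"

definition algebra_automorphism ::
    "('k::field \<Rightarrow> 'b::ring \<Rightarrow> 'b) \<Rightarrow> ('b \<Rightarrow> 'b) \<Rightarrow> bool"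
  where "algebra_automorphism sB f \<longleftrightarrow> algebra_hom sB sB f \<and> bij f"

abbreviation linear_functional ::
    "('k::field \<Rightarrow> 'b::ab_group_add \<Rightarrow> 'b) \<Rightarrow> ('b \<Rightarrow> 'k) \<Rightarrow> bool"
  where "linear_functional sB \<equiv> Vector_Spaces.linear sB (*)"


section \<open>Tensor products\<close>

text \<open>
  The type of \<open>X \<otimes> Y\<close> cannot be constructed from the types of \<open>X\<close> and \<open>Y\<close> alone, because the
  scalar multiplications are not part of the types. A tensor product is therefore a vector space
  \<open>T\<close> with a map \<open>(x, y) \<mapsto> x \<otimes> y\<close> which exhibits \<open>T\<close> as the quotient of the free vector space
  on \<open>X \<times> Y\<close> by the subspace generated by the bilinearity relations.
\<close>

definition free_scale :: "'k::field \<Rightarrow> ('i \<Rightarrow>\<^sub>0 'k) \<Rightarrow> ('i \<Rightarrow>\<^sub>0 'k)"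
  where "free_scale c = Poly_Mapping.map ((*) c)"

definition free_extend ::
    "('k::field \<Rightarrow> 't::ab_group_add \<Rightarrow> 't) \<Rightarrow> ('i \<Rightarrow> 't) \<Rightarrow> ('i \<Rightarrow>\<^sub>0 'k) \<Rightarrow> 't"
  where "free_extend sT g f = (\<Sum>i\<in>Poly_Mapping.keys f. sT (Poly_Mapping.lookup f i) (g i))"

definition bilinearity_relations ::
    "('k::field \<Rightarrow> 'x::ab_group_add \<Rightarrow> 'x) \<Rightarrow> ('k \<Rightarrow> 'y::ab_group_add \<Rightarrow> 'y)
      \<Rightarrow> (('x \<times> 'y) \<Rightarrow>\<^sub>0 'k) set"
  where "bilinearity_relations sX sY =
    (let e = (\<lambda>x y. Poly_Mapping.single (x, y) 1) in
       {e (x + x') y - e x y - e x' y | x x' y. True} \<union>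
       {e x (y + y') - e x y - e x y' | x y y'. True} \<union>
       {e (sX c x) y - free_scale c (e x y) | c x y. True} \<union>
       {e x (sY c y) - free_scale c (e x y) | c x y. True})"

locale tensor_product = X: vector_space sX + Y: vector_space sY + T: vector_space sT
  for sX :: "'k::field \<Rightarrow> 'x::ab_group_add \<Rightarrow> 'x"
    and sY :: "'k \<Rightarrow> 'y::ab_group_add \<Rightarrow> 'y"
    and sT :: "'k \<Rightarrow> 't::ab_group_add \<Rightarrow> 't"
    and tensor :: "'x \<Rightarrow> 'y \<Rightarrow> 't" (infixl "\<otimes>" 75) +
  assumes surj: "surj (free_extend sT (\<lambda>(x, y). x \<otimes> y))"
    and kernel: "{f. free_extend sT (\<lambda>(x, y). x \<otimes> y) f = 0} =
      module.span free_scale (bilinearity_relations sX sY)"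

locale tensor_algebra = tensor_product sX sY sT tensor
  for sX :: "'k::field \<Rightarrow> 'x::ring \<Rightarrow> 'x"
    and sY :: "'k \<Rightarrow> 'y::ring \<Rightarrow> 'y"
    and sT :: "'k \<Rightarrow> 't::ring \<Rightarrow> 't"
    and tensor :: "'x \<Rightarrow> 'y \<Rightarrow> 't" (infixl "\<otimes>" 75) +
  assumes tensor_mult: "(x \<otimes> y) * (x' \<otimes> y') = (x * x') \<otimes> (y * y')"

text \<open>The linear map \<open>X \<otimes> Y \<rightarrow> Z\<close> sending \<open>x \<otimes> y\<close> to \<open>f x y\<close>, for bilinear \<open>f\<close>.\<close>

definition tensor_lift ::
    "('k::field \<Rightarrow> 't::ab_group_add \<Rightarrow> 't) \<Rightarrow> ('x \<Rightarrow> 'y \<Rightarrow> 't)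
      \<Rightarrow> ('k \<Rightarrow> 'z::ab_group_add \<Rightarrow> 'z) \<Rightarrow> ('x \<Rightarrow> 'y \<Rightarrow> 'z) \<Rightarrow> 't \<Rightarrow> 'z"
  where "tensor_lift sT tensor sZ f =
    (THE g. Vector_Spaces.linear sT sZ g \<and> (\<forall>x y. g (tensor x y) = f x y))"

text \<open>The multiplier \<open>m \<otimes> n\<close> of \<open>X \<otimes> Y\<close>, for \<open>m \<in> M(X)\<close> and \<open>n \<in> M(Y)\<close>.\<close>

definition mult_tensor ::
    "('x::ring \<Rightarrow> 'y::ring \<Rightarrow> 't::ring) \<Rightarrow> 'x multiplier \<Rightarrow> 'y multiplier \<Rightarrow> 't multiplier"
  where "mult_tensor tensor m n = (THE p. \<forall>x y.
    lact p (tensor x y) = tensor (lact m x) (lact n y) \<and>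
    ract (tensor x y) p = tensor (ract x m) (ract y n))"

text \<open>
  The slice map \<open>\<iota> \<otimes> \<omega> : X \<otimes> Y \<rightarrow> X\<close>, and the multiplier \<open>(\<iota> \<otimes> \<omega>)(m) \<in> M(X)\<close> for a multiplier
  \<open>m\<close> of \<open>X \<otimes> Y\<close> such that \<open>m (x \<otimes> 1)\<close> and \<open>(x \<otimes> 1) m\<close> lie in \<open>X \<otimes> Y\<close> for all \<open>x\<close>.
\<close>

definition slice ::
    "('k::field \<Rightarrow> 'x::ring \<Rightarrow> 'x) \<Rightarrow> ('k \<Rightarrow> 't::ring \<Rightarrow> 't) \<Rightarrow> ('x \<Rightarrow> 'y::ring \<Rightarrow> 't)
      \<Rightarrow> ('y \<Rightarrow> 'k) \<Rightarrow> 't \<Rightarrow> 'x"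
  where "slice sX sT tensor \<omega> = tensor_lift sT tensor sX (\<lambda>x y. sX (\<omega> y) x)"

definition mult_slice ::
    "('k::field \<Rightarrow> 'x::ring \<Rightarrow> 'x) \<Rightarrow> ('k \<Rightarrow> 't::ring \<Rightarrow> 't) \<Rightarrow> ('x \<Rightarrow> 'y::ring \<Rightarrow> 't)
      \<Rightarrow> ('y \<Rightarrow> 'k) \<Rightarrow> 't multiplier \<Rightarrow> 'x multiplier"
  where "mult_slice sX sT tensor \<omega> m = (THE n. \<forall>x.
    lact n x = slice sX sT tensor \<omega> (elem (m * mult_tensor tensor (mult_of x) 1)) \<and>
    ract x n = slice sX sT tensor \<omega> (elem (mult_tensor tensor (mult_of x) 1 * m)))"


section \<open>Algebraic quantum groups\<close>

text \<open>
  \<open>A \<otimes> A \<otimes> A\<close> is one algebra which is a tensor product both of \<open>A \<otimes> A\<close> and \<open>A\<close> and of \<open>A\<close> and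
  \<open>A \<otimes> A\<close>; its elementary tensors are \<open>(a \<otimes> b) \<otimes>\<^sub>r c = a \<otimes>\<^sub>l (b \<otimes> c)\<close>.
\<close>

locale regular_multiplier_hopf_algebra =
  A: nondegenerate_algebra sA +
  AA: tensor_algebra sA sA sAA tAA +
  AA_A: tensor_algebra sAA sA sAAA tAA_A +
  A_AA: tensor_algebra sA sAA sAAA tA_AA
  for sA :: "'k::field \<Rightarrow> 'a::ring \<Rightarrow> 'a"
    and sAA :: "'k \<Rightarrow> 'aa::ring \<Rightarrow> 'aa"
    and tAA :: "'a \<Rightarrow> 'a \<Rightarrow> 'aa" (infixl "\<otimes>" 75)
    and sAAA :: "'k \<Rightarrow> 'aaa::ring \<Rightarrow> 'aaa"
    and tAA_A :: "'aa \<Rightarrow> 'a \<Rightarrow> 'aaa" (infixl "\<otimes>\<^sub>r" 75)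
    and tA_AA :: "'a \<Rightarrow> 'aa \<Rightarrow> 'aaa" (infixl "\<otimes>\<^sub>l" 75) +
  fixes \<Delta> :: "'a \<Rightarrow> 'aa multiplier"
  assumes tensor_assoc: "(a \<otimes> b) \<otimes>\<^sub>r c = a \<otimes>\<^sub>l (b \<otimes> c)"
    and comult_hom: "algebra_hom sA (mult_scale sAA) \<Delta>"
    and comult_nondegenerate_left:
      "module.span sAA {lact (\<Delta> a) z | a z. True} = UNIV"
    and comult_nondegenerate_right:
      "module.span sAA {ract z (\<Delta> a) | a z. True} = UNIV"
    and comult_coassoc:
      "mult_extend
         (tensor_lift sAA (\<otimes>) (mult_scale sAAA) (\<lambda>b c. mult_tensor (\<otimes>\<^sub>r) (\<Delta> b) (mult_of c)))
         (\<Delta> a) =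
       mult_extend
         (tensor_lift sAA (\<otimes>) (mult_scale sAAA) (\<lambda>b c. mult_tensor (\<otimes>\<^sub>l) (mult_of b) (\<Delta> c)))
         (\<Delta> a)"
    and comult_bij1:
      "bij_betw (tensor_lift sAA (\<otimes>) (mult_scale sAA)
         (\<lambda>a b. \<Delta> a * mult_tensor (\<otimes>) 1 (mult_of b))) UNIV (range mult_of)"
    and comult_bij2:
      "bij_betw (tensor_lift sAA (\<otimes>) (mult_scale sAA)
         (\<lambda>a b. mult_tensor (\<otimes>) (mult_of a) 1 * \<Delta> b)) UNIV (range mult_of)"
    and comult_bij3:
      "bij_betw (tensor_lift sAA (\<otimes>) (mult_scale sAA)
         (\<lambda>a b. \<Delta> a * mult_tensor (\<otimes>) (mult_of b) 1)) UNIV (range mult_of)"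
    and comult_bij4:
      "bij_betw (tensor_lift sAA (\<otimes>) (mult_scale sAA)
         (\<lambda>a b. mult_tensor (\<otimes>) 1 (mult_of a) * \<Delta> b)) UNIV (range mult_of)"

text \<open>
  The counit is the homomorphism with \<open>(\<epsilon> \<otimes> \<iota>)(\<Delta>(a)(1 \<otimes> b)) = ab = (\<iota> \<otimes> \<epsilon>)((a \<otimes> 1)\<Delta>(b))\<close>.
\<close>

definition is_counit ::
    "('k::field \<Rightarrow> 'a::ring \<Rightarrow> 'a) \<Rightarrow> ('k \<Rightarrow> 'aa::ring \<Rightarrow> 'aa) \<Rightarrow> ('a \<Rightarrow> 'a \<Rightarrow> 'aa)
      \<Rightarrow> ('a \<Rightarrow> 'aa multiplier) \<Rightarrow> ('a \<Rightarrow> 'k) \<Rightarrow> bool"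
  where "is_counit sA sAA tAA \<Delta> \<epsilon> \<longleftrightarrow>
    algebra_hom sA (*) \<epsilon> \<and>
    (\<forall>a b. tensor_lift sAA tAA sA (\<lambda>p q. sA (\<epsilon> p) q)
             (elem (\<Delta> a * mult_tensor tAA 1 (mult_of b))) = a * b) \<and>
    (\<forall>a b. tensor_lift sAA tAA sA (\<lambda>p q. sA (\<epsilon> q) p)
             (elem (mult_tensor tAA (mult_of a) 1 * \<Delta> b)) = a * b)"

text \<open>
  With \<open>m\<close> the multiplication, the antipode is the anti-automorphism such that
  \<open>m(S \<otimes> \<iota>)(\<Delta>(a)(1 \<otimes> b)) = \<epsilon>(a)b\<close> and \<open>m(\<iota> \<otimes> S)((a \<otimes> 1)\<Delta>(b)) = \<epsilon>(b)a\<close>.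
\<close>

definition is_antipode ::
    "('k::field \<Rightarrow> 'a::ring \<Rightarrow> 'a) \<Rightarrow> ('k \<Rightarrow> 'aa::ring \<Rightarrow> 'aa) \<Rightarrow> ('a \<Rightarrow> 'a \<Rightarrow> 'aa)
      \<Rightarrow> ('a \<Rightarrow> 'aa multiplier) \<Rightarrow> ('a \<Rightarrow> 'k) \<Rightarrow> ('a \<Rightarrow> 'a) \<Rightarrow> bool"
  where "is_antipode sA sAA tAA \<Delta> \<epsilon> S \<longleftrightarrow>
    Vector_Spaces.linear sA sA S \<and> bij S \<and> (\<forall>a b. S (a * b) = S b * S a) \<and>
    (\<forall>a b. tensor_lift sAA tAA sA (\<lambda>p q. S p * q)
             (elem (\<Delta> a * mult_tensor tAA 1 (mult_of b))) = sA (\<epsilon> a) b) \<and>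
    (\<forall>a b. tensor_lift sAA tAA sA (\<lambda>p q. p * S q)
             (elem (mult_tensor tAA (mult_of a) 1 * \<Delta> b)) = sA (\<epsilon> b) a)"

locale algebraic_quantum_group =
  regular_multiplier_hopf_algebra sA sAA tAA sAAA tAA_A tA_AA \<Delta>
  for sA :: "'k::field \<Rightarrow> 'a::ring \<Rightarrow> 'a"
    and sAA :: "'k \<Rightarrow> 'aa::ring \<Rightarrow> 'aa"
    and tAA :: "'a \<Rightarrow> 'a \<Rightarrow> 'aa" (infixl "\<otimes>" 75)
    and sAAA :: "'k \<Rightarrow> 'aaa::ring \<Rightarrow> 'aaa"
    and tAA_A :: "'aa \<Rightarrow> 'a \<Rightarrow> 'aaa" (infixl "\<otimes>\<^sub>r" 75)
    and tA_AA :: "'a \<Rightarrow> 'aa \<Rightarrow> 'aaa" (infixl "\<otimes>\<^sub>l" 75)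
    and \<Delta> :: "'a \<Rightarrow> 'aa multiplier" +
  fixes \<phi> :: "'a \<Rightarrow> 'k"
  assumes integral_linear: "linear_functional sA \<phi>"
    and integral_nonzero: "\<exists>a. \<phi> a \<noteq> 0"
    and integral_left_invariant:
      "slice sA sAA (\<otimes>) \<phi> (elem (\<Delta> a * mult_tensor (\<otimes>) (mult_of b) 1)) = sA (\<phi> a) b"

definition is_modular_automorphism ::
    "('k::field \<Rightarrow> 'a::ring \<Rightarrow> 'a) \<Rightarrow> ('a \<Rightarrow> 'k) \<Rightarrow> ('a \<Rightarrow> 'a) \<Rightarrow> bool"
  where "is_modular_automorphism sA \<phi> \<sigma> \<longleftrightarrow>
    algebra_automorphism sA \<sigma> \<and> (\<forall>a b. \<phi> (a * b) = \<phi> (b * \<sigma> a))"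


section \<open>Galois objects\<close>

text \<open>
  \<open>X \<otimes> A \<otimes> A\<close> is treated like \<open>A \<otimes> A \<otimes> A\<close> above. Coassociativity \<open>(\<alpha> \<otimes> \<iota>)\<alpha> = (\<iota> \<otimes> \<Delta>)\<alpha>\<close> is
  stated after multiplication by \<open>1 \<otimes> 1 \<otimes> a\<close> from the right, because \<open>(\<alpha> \<otimes> \<iota>)(\<alpha>(x))\<close> is
  defined through \<open>(\<alpha> \<otimes> \<iota>)(\<alpha>(x)) (1 \<otimes> 1 \<otimes> a) = (\<alpha> \<otimes> \<iota>)(\<alpha>(x)(1 \<otimes> a))\<close>.
\<close>

locale right_coaction =
  regular_multiplier_hopf_algebra sA sAA tAA sAAA tAA_A tA_AA \<Delta> +
  X: nondegenerate_algebra sX +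
  XA: tensor_algebra sX sA sXA tXA +
  XA_A: tensor_algebra sXA sA sXAA tXA_A +
  X_AA: tensor_algebra sX sAA sXAA tX_AA
  for sA :: "'k::field \<Rightarrow> 'a::ring \<Rightarrow> 'a"
    and sAA :: "'k \<Rightarrow> 'aa::ring \<Rightarrow> 'aa"
    and tAA :: "'a \<Rightarrow> 'a \<Rightarrow> 'aa"
    and sAAA :: "'k \<Rightarrow> 'aaa::ring \<Rightarrow> 'aaa"
    and tAA_A :: "'aa \<Rightarrow> 'a \<Rightarrow> 'aaa"
    and tA_AA :: "'a \<Rightarrow> 'aa \<Rightarrow> 'aaa"
    and \<Delta> :: "'a \<Rightarrow> 'aa multiplier"
    and sX :: "'k \<Rightarrow> 'x::ring \<Rightarrow> 'x"
    and sXA :: "'k \<Rightarrow> 'xa::ring \<Rightarrow> 'xa"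
    and tXA :: "'x \<Rightarrow> 'a \<Rightarrow> 'xa" (infixl "\<otimes>" 75)
    and sXAA :: "'k \<Rightarrow> 'xaa::ring \<Rightarrow> 'xaa"
    and tXA_A :: "'xa \<Rightarrow> 'a \<Rightarrow> 'xaa" (infixl "\<otimes>\<^sub>r" 75)
    and tX_AA :: "'x \<Rightarrow> 'aa \<Rightarrow> 'xaa" (infixl "\<otimes>\<^sub>l" 75) +
  fixes \<alpha> :: "'x \<Rightarrow> 'xa multiplier"
  assumes tensor_assoc_X: "(x \<otimes> a) \<otimes>\<^sub>r b = x \<otimes>\<^sub>l (tAA a b)"
    and coact_hom: "algebra_hom sX (mult_scale sXA) \<alpha>"
    and coact_inj: "inj \<alpha>"
    and coact_covered_right: "\<alpha> x * mult_tensor (\<otimes>) 1 (mult_of a) \<in> range mult_of"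
    and coact_covered_left: "mult_tensor (\<otimes>) 1 (mult_of a) * \<alpha> x \<in> range mult_of"
    and coact_coassoc:
      "tensor_lift sXA (\<otimes>) (mult_scale sXAA) (\<lambda>y b. mult_tensor (\<otimes>\<^sub>r) (\<alpha> y) (mult_of b))
         (elem (\<alpha> x * mult_tensor (\<otimes>) 1 (mult_of a))) =
       mult_extend
         (tensor_lift sXA (\<otimes>) (mult_scale sXAA) (\<lambda>y b. mult_tensor (\<otimes>\<^sub>l) (mult_of y) (\<Delta> b)))
         (\<alpha> x) * mult_tensor (\<otimes>\<^sub>r) 1 (mult_of a)"

locale reduced_right_coaction =
  right_coaction sA sAA tAA sAAA tAA_A tA_AA \<Delta> sX sXA tXA sXAA tXA_A tX_AA \<alpha>
  for sA :: "'k::field \<Rightarrow> 'a::ring \<Rightarrow> 'a"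
    and sAA :: "'k \<Rightarrow> 'aa::ring \<Rightarrow> 'aa"
    and tAA :: "'a \<Rightarrow> 'a \<Rightarrow> 'aa"
    and sAAA :: "'k \<Rightarrow> 'aaa::ring \<Rightarrow> 'aaa"
    and tAA_A :: "'aa \<Rightarrow> 'a \<Rightarrow> 'aaa"
    and tA_AA :: "'a \<Rightarrow> 'aa \<Rightarrow> 'aaa"
    and \<Delta> :: "'a \<Rightarrow> 'aa multiplier"
    and sX :: "'k \<Rightarrow> 'x::ring \<Rightarrow> 'x"
    and sXA :: "'k \<Rightarrow> 'xa::ring \<Rightarrow> 'xa"
    and tXA :: "'x \<Rightarrow> 'a \<Rightarrow> 'xa" (infixl "\<otimes>" 75)
    and sXAA :: "'k \<Rightarrow> 'xaa::ring \<Rightarrow> 'xaa"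
    and tXA_A :: "'xa \<Rightarrow> 'a \<Rightarrow> 'xaa" (infixl "\<otimes>\<^sub>r" 75)
    and tX_AA :: "'x \<Rightarrow> 'aa \<Rightarrow> 'xaa" (infixl "\<otimes>\<^sub>l" 75)
    and \<alpha> :: "'x \<Rightarrow> 'xa multiplier" +
  assumes coact_reduced: "mult_tensor (\<otimes>) (mult_of x) 1 * \<alpha> y \<in> range mult_of"

text \<open>
  The maps \<open>V, W : X \<otimes> X \<rightarrow> X \<otimes> A\<close>, with \<open>X \<otimes> A\<close> regarded as a subset of \<open>M(X \<otimes> A)\<close>.
\<close>

definition galois_V ::
    "('k::field \<Rightarrow> 'xa::ring \<Rightarrow> 'xa) \<Rightarrow> ('x::ring \<Rightarrow> 'a::ring \<Rightarrow> 'xa)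
      \<Rightarrow> ('k \<Rightarrow> 'xx::ring \<Rightarrow> 'xx) \<Rightarrow> ('x \<Rightarrow> 'x \<Rightarrow> 'xx) \<Rightarrow> ('x \<Rightarrow> 'xa multiplier)
      \<Rightarrow> 'xx \<Rightarrow> 'xa multiplier"
  where "galois_V sXA tXA sXX tXX \<alpha> =
    tensor_lift sXX tXX (mult_scale sXA) (\<lambda>x y. mult_tensor tXA (mult_of x) 1 * \<alpha> y)"

definition galois_W ::
    "('k::field \<Rightarrow> 'xa::ring \<Rightarrow> 'xa) \<Rightarrow> ('x::ring \<Rightarrow> 'a::ring \<Rightarrow> 'xa)
      \<Rightarrow> ('k \<Rightarrow> 'xx::ring \<Rightarrow> 'xx) \<Rightarrow> ('x \<Rightarrow> 'x \<Rightarrow> 'xx) \<Rightarrow> ('x \<Rightarrow> 'xa multiplier)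
      \<Rightarrow> 'xx \<Rightarrow> 'xa multiplier"
  where "galois_W sXA tXA sXX tXX \<alpha> =
    tensor_lift sXX tXX (mult_scale sXA) (\<lambda>x y. \<alpha> x * mult_tensor tXA (mult_of y) 1)"

locale galois_object =
  reduced_right_coaction sA sAA tAA sAAA tAA_A tA_AA \<Delta> sX sXA tXA sXAA tXA_A tX_AA \<alpha> +
  XX: tensor_algebra sX sX sXX tXX
  for sA :: "'k::field \<Rightarrow> 'a::ring \<Rightarrow> 'a"
    and sAA :: "'k \<Rightarrow> 'aa::ring \<Rightarrow> 'aa"
    and tAA :: "'a \<Rightarrow> 'a \<Rightarrow> 'aa"
    and sAAA :: "'k \<Rightarrow> 'aaa::ring \<Rightarrow> 'aaa"
    and tAA_A :: "'aa \<Rightarrow> 'a \<Rightarrow> 'aaa"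
    and tA_AA :: "'a \<Rightarrow> 'aa \<Rightarrow> 'aaa"
    and \<Delta> :: "'a \<Rightarrow> 'aa multiplier"
    and sX :: "'k \<Rightarrow> 'x::ring \<Rightarrow> 'x"
    and sXA :: "'k \<Rightarrow> 'xa::ring \<Rightarrow> 'xa"
    and tXA :: "'x \<Rightarrow> 'a \<Rightarrow> 'xa" (infixl "\<otimes>" 75)
    and sXAA :: "'k \<Rightarrow> 'xaa::ring \<Rightarrow> 'xaa"
    and tXA_A :: "'xa \<Rightarrow> 'a \<Rightarrow> 'xaa" (infixl "\<otimes>\<^sub>r" 75)
    and tX_AA :: "'x \<Rightarrow> 'aa \<Rightarrow> 'xaa" (infixl "\<otimes>\<^sub>l" 75)
    and \<alpha> :: "'x \<Rightarrow> 'xa multiplier"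
    and sXX :: "'k \<Rightarrow> 'xx::ring \<Rightarrow> 'xx"
    and tXX :: "'x \<Rightarrow> 'x \<Rightarrow> 'xx" +
  assumes coinvariants_scalar:
      "mult_extend \<alpha> f = mult_tensor (\<otimes>) f 1 \<Longrightarrow> f \<in> range (mult_scalar sX)"
    and galois_bij: "bij_betw (galois_V sXA (\<otimes>) sXX tXX \<alpha>) UNIV (range mult_of)"

text \<open>
  \<open>(x \<otimes> 1)\<beta>(a) = V\<inverse>(x \<otimes> a)\<close> and \<open>\<beta>(a)(1 \<otimes> y) = W\<inverse>(y \<otimes> S(a))\<close>, where the left-hand sides lie
  in \<open>X \<otimes> X\<close>.
\<close>

definition is_beta ::
    "('k::field \<Rightarrow> 'xa::ring \<Rightarrow> 'xa) \<Rightarrow> ('x::ring \<Rightarrow> 'a::ring \<Rightarrow> 'xa)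
      \<Rightarrow> ('k \<Rightarrow> 'xx::ring \<Rightarrow> 'xx) \<Rightarrow> ('x \<Rightarrow> 'x \<Rightarrow> 'xx)
      \<Rightarrow> ('x \<Rightarrow> 'xa multiplier) \<Rightarrow> ('a \<Rightarrow> 'a) \<Rightarrow> ('a \<Rightarrow> 'xx multiplier) \<Rightarrow> bool"
  where "is_beta sXA tXA sXX tXX \<alpha> S \<beta> \<longleftrightarrow>
    (\<forall>x a. \<exists>z. mult_tensor tXX (mult_of x) 1 * \<beta> a = mult_of z \<and>
               galois_V sXA tXA sXX tXX \<alpha> z = mult_of (tXA x a)) \<and>
    (\<forall>y a. \<exists>z. \<beta> a * mult_tensor tXX 1 (mult_of y) = mult_of z \<and>
               galois_W sXA tXA sXX tXX \<alpha> z = mult_of (tXA y (S a)))"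

definition is_phi_X ::
    "('k::field \<Rightarrow> 'x::ring \<Rightarrow> 'x) \<Rightarrow> ('k \<Rightarrow> 'xa::ring \<Rightarrow> 'xa) \<Rightarrow> ('x \<Rightarrow> 'a::ring \<Rightarrow> 'xa)
      \<Rightarrow> ('x \<Rightarrow> 'xa multiplier) \<Rightarrow> ('a \<Rightarrow> 'k) \<Rightarrow> ('x \<Rightarrow> 'k) \<Rightarrow> bool"
  where "is_phi_X sX sXA tXA \<alpha> \<phi> \<phi>X \<longleftrightarrow>
    linear_functional sX \<phi>X \<and>
    (\<forall>x. mult_slice sX sXA tXA \<phi> (\<alpha> x) = mult_scalar sX (\<phi>X x))"

definition is_sigma_X ::
    "('k::field \<Rightarrow> 'x::ring \<Rightarrow> 'x) \<Rightarrow> ('x \<Rightarrow> 'k) \<Rightarrow> ('x \<Rightarrow> 'x) \<Rightarrow> bool"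
  where "is_sigma_X sX \<phi>X \<sigma>X \<longleftrightarrow>
    algebra_automorphism sX \<sigma>X \<and> (\<forall>x y. \<phi>X (y * \<sigma>X x) = \<phi>X (x * y))"

text \<open>\<open>\<theta>\<^sub>X(x) = \<sigma>\<^sub>X((\<iota> \<otimes> \<epsilon>\<sigma>\<inverse>)\<alpha>(x))\<close>; the argument of \<open>\<sigma>\<^sub>X\<close> is a multiplier lying in \<open>X\<close>.\<close>

definition theta_X ::
    "('k::field \<Rightarrow> 'x::ring \<Rightarrow> 'x) \<Rightarrow> ('k \<Rightarrow> 'xa::ring \<Rightarrow> 'xa) \<Rightarrow> ('x \<Rightarrow> 'a::ring \<Rightarrow> 'xa)
      \<Rightarrow> ('x \<Rightarrow> 'xa multiplier) \<Rightarrow> ('a \<Rightarrow> 'k) \<Rightarrow> ('a \<Rightarrow> 'a) \<Rightarrow> ('x \<Rightarrow> 'x) \<Rightarrow> 'x \<Rightarrow> 'x"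
  where "theta_X sX sXA tXA \<alpha> \<epsilon> \<sigma> \<sigma>X x =
    \<sigma>X (elem (mult_slice sX sXA tXA (\<epsilon> \<circ> inv \<sigma>) (\<alpha> x)))"

end

theory Submission
  imports Defs
begin

text \<open>
  Write \<open>x\<^sub>0 \<otimes> x\<^sub>1\<close> for \<open>\<alpha>(x)\<close> and \<open>a\<^sup>1 \<otimes> a\<^sup>2\<close> for \<open>\<beta>(a)\<close>, let \<open>\<chi> = \<epsilon> \<sigma>\<inverse>\<close>, which is a character of \<open>A\<close>, and
  let \<open>\<tau>(x) = x\<^sub>0 \<chi>(x\<^sub>1)\<close>, so that \<open>\<theta> = \<sigma>\<^sub>X \<tau>\<close>. The heart of the matter is the second identity,
  \<open>x\<^sub>1\<^sup>1 \<theta>(x\<^sub>0) y \<otimes> x\<^sub>1\<^sup>2 = y \<otimes> x\<close>, with \<open>y = \<theta>(y')\<close>. As \<open>\<phi>\<^sub>X\<close> is faithful, it may be tested by multiplying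
  with \<open>w \<otimes> 1\<close> from the left and applying \<open>\<phi>\<^sub>X\<close> to the first leg. The modular property of \<open>\<sigma>\<^sub>X\<close> moves
  \<open>\<theta>(r) = \<sigma>\<^sub>X(\<tau>(r))\<close> to the front as \<open>\<tau>(r)\<close>. The map \<open>W V\<inverse>\<close> is \<open>q \<otimes> a \<mapsto> \<alpha>(q)(1 \<otimes> S(a))\<close> (\<open>W_eq_G_V\<close>), and
  \<open>(\<iota> \<otimes> \<phi>) W = \<phi>\<^sub>X \<otimes> \<iota>\<close>, so the left-hand side becomes \<open>(\<iota> \<otimes> \<phi>)(\<alpha>(\<tau>(r) w)(1 \<otimes> S(a)))\<close>, summed over
  \<open>r \<otimes> a = \<alpha>(x)(y' \<otimes> 1)\<close>. Now \<open>\<alpha>(\<tau>(r)) = r\<^sub>0 \<otimes> \<kappa>(r\<^sub>1)\<close> with \<open>\<kappa>(a) = a\<^sub>1 \<chi>(a\<^sub>2)\<close>, and the one fact about \<open>A\<close>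
  that enters is \<open>\<sigma> \<kappa> = S\<^sup>2\<close> (\<open>sigma_RA_chi\<close>): moving \<open>\<kappa>(r\<^sub>1)\<close> around \<open>\<phi>\<close> produces \<open>S(a) S\<^sup>2(r\<^sub>1) = S(S(r\<^sub>1) a)\<close>,
  where the antipode cancels (\<open>KR_P\<close>), and what remains is \<open>\<phi>\<^sub>X(\<tau>(y') w) x\<close> (\<open>KR_W\<close>).

  The fact about \<open>A\<close> comes from \<open>\<Delta> \<sigma> = (S\<^sup>2 \<otimes> \<sigma>) \<Delta>\<close> (\<open>Delta_sigma\<close>), which is strong left invariance
  \<open>S(a\<^sub>1) \<phi>(a\<^sub>2 b) = b\<^sub>1 \<phi>(a b\<^sub>2)\<close> used twice, together with faithfulness of \<open>\<phi>\<close>. Applying \<open>\<chi>\<close> to the second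
  leg gives \<open>\<kappa> \<sigma> = S\<^sup>2\<close>, and \<open>\<sigma>\<close> and \<open>\<kappa>\<close> commute because characters of \<open>A\<close> are invariant under \<open>S\<^sup>2\<close>.

  The second identity says that \<open>p \<otimes> a \<mapsto> \<beta>(a)(p \<otimes> 1)\<close> inverts \<open>W\<close> up to \<open>\<theta>\<close> and the flip. As
  \<open>W(\<beta>(b)(1 \<otimes> y)) = y \<otimes> S(b)\<close>, this compares \<open>\<beta>(S(b))\<close> with \<open>\<beta>(b)\<close> and is the first identity
  (\<open>beta_S\<close>). The fourth is the first one used twice, and the third follows by applying \<open>\<epsilon>\<close> to the second
  leg of \<open>y \<otimes> S(b)\<close>.

  Sweedler calculations are carried out on covered elements. Coassociativity of \<open>\<alpha>\<close> is brought into the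
  forms \<open>coassoc_P\<close> and \<open>coassoc_Q\<close>, equations in \<open>X \<otimes> A \<otimes> A\<close>, and the other identities are obtained by
  applying a bilinear map to the last two legs. The coproduct is itself such a coaction, so that the
  results on \<open>X\<close> can be used for \<open>A\<close> as well.
\<close>

section \<open>Linear and bilinear maps\<close>

abbreviation lin where "lin \<equiv> Vector_Spaces.linear"

lemma lin_simps:
  assumes "lin s1 s2 f"
  shows "f (x + y) = f x + f y" "f (s1 c x) = s2 c (f x)" "f 0 = 0"
    "f (- x) = - f x" "f (x - y) = f x - f y" "f (sum h I) = (\<Sum>i\<in>I. f (h i))"
proof -
  interpret Vector_Spaces.linear s1 s2 f by fact
  show "f (x + y) = f x + f y" "f (s1 c x) = s2 c (f x)" "f 0 = 0"
    "f (- x) = - f x" "f (x - y) = f x - f y" "f (sum h I) = (\<Sum>i\<in>I. f (h i))"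
    by (simp_all add: add scale neg diff sum)
qed

lemma linI:
  assumes "vector_space s1" "vector_space s2" "\<And>x y. f (x + y) = f x + f y"
    "\<And>c x. f (s1 c x) = s2 c (f x)"
  shows "lin s1 s2 f"
  using assms by (simp add: Vector_Spaces.linear_iff)

lemma lin_space: assumes "lin s1 s2 f" shows "vector_space s1" "vector_space s2"
  using assms by (simp_all add: Vector_Spaces.linear_iff)

lemma lin_comp: "lin s1 s2 f \<Longrightarrow> lin s2 s3 g \<Longrightarrow> lin s1 s3 (\<lambda>x. g (f x))"
  by (simp add: Vector_Spaces.linear_iff)

lemma lin_id: "vector_space s \<Longrightarrow> lin s s (\<lambda>x. x)"
  by (simp add: Vector_Spaces.linear_iff)

lemma lin_inv:
  assumes f: "lin s1 s2 f" and "bij f"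
  shows "lin s2 s1 (inv f)"
proof (rule linI)
  have f_inv: "f (inv f y) = y" for y using \<open>bij f\<close> by (simp add: bij_is_surj surj_f_inv_f)
  have inv_f: "inv f (f x) = x" for x using \<open>bij f\<close> by (simp add: bij_is_inj)
  fix x y c
  have "inv f (f (inv f x) + f (inv f y)) = inv f x + inv f y"
    using inv_f[of "inv f x + inv f y"] by (simp only: lin_simps(1)[OF f])
  then show "inv f (x + y) = inv f x + inv f y" by (simp only: f_inv)
  have "inv f (s2 c (f (inv f x))) = s1 c (inv f x)"
    using inv_f[of "s1 c (inv f x)"] by (simp only: lin_simps(2)[OF f])
  then show "inv f (s2 c x) = s1 c (inv f x)" by (simp only: f_inv)
qed (fact lin_space[OF f])+

definition bilin ::
    "('k::field \<Rightarrow> 'x::ab_group_add \<Rightarrow> 'x) \<Rightarrow> ('k \<Rightarrow> 'y::ab_group_add \<Rightarrow> 'y)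
      \<Rightarrow> ('k \<Rightarrow> 'z::ab_group_add \<Rightarrow> 'z) \<Rightarrow> ('x \<Rightarrow> 'y \<Rightarrow> 'z) \<Rightarrow> bool"
  where "bilin sX sY sZ f \<longleftrightarrow> (\<forall>x. lin sY sZ (f x)) \<and> (\<forall>y. lin sX sZ (\<lambda>x. f x y))"

lemma bilinI: "(\<And>x. lin sY sZ (f x)) \<Longrightarrow> (\<And>y. lin sX sZ (\<lambda>x. f x y)) \<Longrightarrow> bilin sX sY sZ f"
  by (simp add: bilin_def)

lemma bilin_right: "bilin sX sY sZ f \<Longrightarrow> lin sY sZ (f x)"
  and bilin_left: "bilin sX sY sZ f \<Longrightarrow> lin sX sZ (\<lambda>x. f x y)"
  by (simp_all add: bilin_def)

lemma bilin_comp: "bilin sX sY sZ f \<Longrightarrow> lin sZ sU g \<Longrightarrow> bilin sX sY sU (\<lambda>x y. g (f x y))"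
  by (auto simp: bilin_def intro: lin_comp)

lemma bilin_comp2:
  "bilin sX sY sZ f \<Longrightarrow> lin sU sX g \<Longrightarrow> lin sV sY h \<Longrightarrow> bilin sU sV sZ (\<lambda>x y. f (g x) (h y))"
  by (auto simp: bilin_def intro: lin_comp[of _ _ g] lin_comp[of _ _ h])

lemma bilin_swap: "bilin sX sY sZ f \<Longrightarrow> bilin sY sX sZ (\<lambda>y x. f x y)"
  by (simp add: bilin_def)

section \<open>Tensor products\<close>

lemma free_extend_superset:
  assumes "vector_space s" "finite K" "Poly_Mapping.keys f \<subseteq> K"
  shows "free_extend s g f = (\<Sum>i\<in>K. s (Poly_Mapping.lookup f i) (g i))"
proof -
  interpret vector_space s by fact
  show ?thesis unfolding free_extend_def
    by (rule sum.mono_neutral_left) (use assms in \<open>auto simp: in_keys_iff\<close>)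
qed

lemma lookup_free_scale: "Poly_Mapping.lookup (free_scale c f) i = c * Poly_Mapping.lookup f i"
  by (simp add: free_scale_def Poly_Mapping.map.rep_eq when_def)

lemma vector_space_free: "vector_space free_scale"
  by unfold_locales
    (rule poly_mapping_eqI, simp add: lookup_free_scale lookup_add algebra_simps)+

lemma lin_free_extend:
  assumes s: "vector_space s"
  shows "lin free_scale s (free_extend s g)"
proof (rule linI)
  interpret vector_space s by fact
  fix f h :: "'c \<Rightarrow>\<^sub>0 'a" and c
  have K: "finite (Poly_Mapping.keys f \<union> Poly_Mapping.keys h)" by simp
  show "free_extend s g (f + h) = free_extend s g f + free_extend s g h"
    by (simp add: free_extend_superset[OF s K] keys_add lookup_add scale_left_distrib sum.distrib)
  show "free_extend s g (free_scale c f) = s c (free_extend s g f)"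
    by (subst (1 2) free_extend_superset[OF s finite_keys[of f]])
      (auto simp: lookup_free_scale scale_sum_right in_keys_iff)
qed (fact vector_space_free s)+

lemma free_extend_single:
  assumes s: "vector_space s"
  shows "free_extend s g (Poly_Mapping.single i 1) = g i"
proof -
  interpret vector_space s by fact
  show ?thesis by (subst free_extend_superset[OF s, of "{i}"]) auto
qed

context tensor_product
begin

abbreviation (input) "fe \<equiv> free_extend sT (\<lambda>(x, y). x \<otimes> y)"

lemma relation_zero:
  assumes "r \<in> bilinearity_relations sX sY"
  shows "fe r = 0"
proof -
  interpret free: vector_space "free_scale :: 'k \<Rightarrow> ('x \<times> 'y \<Rightarrow>\<^sub>0 'k) \<Rightarrow> _"
    by (fact vector_space_free)
  have "r \<in> free.span (bilinearity_relations sX sY)" using assms by (rule free.span_base)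
  then show ?thesis using kernel by auto
qed

lemma bilin_tensor: "bilin sX sY sT (\<otimes>)"
proof -
  note [simp] = lin_simps[OF lin_free_extend[OF T.vector_space_axioms]]
    free_extend_single[OF T.vector_space_axioms]
  have r: "fe r = 0" if "r \<in> bilinearity_relations sX sY" for r
    using that by (rule relation_zero)
  let ?e = "\<lambda>x y. Poly_Mapping.single (x, y) (1 :: 'k)"
  have "fe (?e (x + x') y - ?e x y - ?e x' y) = 0" for x x' y
    by (rule r) (unfold bilinearity_relations_def Let_def, blast)
  then have "(x + x') \<otimes> y = x \<otimes> y + x' \<otimes> y" for x x' y
    by (simp add: diff_diff_eq)
  moreover have "fe (?e x (y + y') - ?e x y - ?e x y') = 0" for x y y'
    by (rule r) (unfold bilinearity_relations_def Let_def, blast)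
  then have "x \<otimes> (y + y') = x \<otimes> y + x \<otimes> y'" for x y y'
    by (simp add: diff_diff_eq)
  moreover have "fe (?e (sX c x) y - free_scale c (?e x y)) = 0" for c x y
    by (rule r) (unfold bilinearity_relations_def Let_def, blast)
  then have "sX c x \<otimes> y = sT c (x \<otimes> y)" for c x y
    by simp
  moreover have "fe (?e x (sY c y) - free_scale c (?e x y)) = 0" for c x y
    by (rule r) (unfold bilinearity_relations_def Let_def, blast)
  then have "x \<otimes> sY c y = sT c (x \<otimes> y)" for c x y
    by simp
  ultimately show ?thesis
    by (intro bilinI linI X.vector_space_axioms Y.vector_space_axioms T.vector_space_axioms)
qed

lemmas tensor_right = lin_simps[OF bilin_right[OF bilin_tensor]]
lemmas tensor_left = lin_simps[OF bilin_left[OF bilin_tensor]]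

lemma tensor_induct [case_names tensor add]:
  assumes "\<And>x y. P (x \<otimes> y)" and "\<And>s t. P s \<Longrightarrow> P t \<Longrightarrow> P (s + t)"
  shows "P t"
proof -
  obtain f where f: "fe f = t" using surj by (metis surjD)
  have zero: "P 0" using assms(1)[of 0 0] by (simp add: tensor_left(3))
  have "P (\<Sum>i\<in>K. sT (Poly_Mapping.lookup f i) (case i of (x, y) \<Rightarrow> x \<otimes> y))" if "finite K" for K
    using that
  proof (induction K)
    case (insert i K)
    obtain x y where "i = (x, y)" by fastforce
    then have "P (sT (Poly_Mapping.lookup f i) (case i of (x, y) \<Rightarrow> x \<otimes> y))"
      using assms(1) by (simp flip: tensor_left(2))
    then show ?case using insert assms(2) by simp
  qed (use zero in simp)
  from this[OF finite_keys, of f] show ?thesis using f by (simp add: free_extend_def)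
qed

lemma additive_eq:
  assumes "\<And>s t. F (s + t) = F s + F t" "\<And>s t. G (s + t) = G s + G t"
    and "\<And>x y. F (x \<otimes> y) = G (x \<otimes> y)"
  shows "F t = (G t :: 'z::ab_group_add)"
  by (induction t rule: tensor_induct) (simp_all add: assms)

lemma lift_exists:
  assumes f: "bilin sX sY sZ f"
  shows "\<exists>g. lin sT sZ g \<and> (\<forall>x y. g (x \<otimes> y) = f x y)"
proof -
  have sZ: "vector_space sZ" using lin_space bilin_right[OF f] by blast
  interpret Z: vector_space sZ by (fact sZ)
  interpret free: vector_space "free_scale :: 'k \<Rightarrow> ('x \<times> 'y \<Rightarrow>\<^sub>0 'k) \<Rightarrow> _"
    by (fact vector_space_free)
  let ?F = "free_extend sZ (\<lambda>(x, y). f x y)"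
  note F = lin_simps[OF lin_free_extend[OF sZ]] free_extend_single[OF sZ]
  note fe = lin_simps[OF lin_free_extend[OF T.vector_space_axioms]]
    free_extend_single[OF T.vector_space_axioms]
  have "free.subspace {r. ?F r = 0}"
    by (rule free.subspaceI) (simp_all add: F)
  moreover have "bilinearity_relations sX sY \<subseteq> {r. ?F r = 0}"
    by (auto simp: bilinearity_relations_def F lin_simps[OF bilin_right[OF f]]
        lin_simps[OF bilin_left[OF f]])
  ultimately have "free.span (bilinearity_relations sX sY) \<subseteq> {r. ?F r = 0}"
    by (rule free.span_minimal[rotated])
  then have zero: "?F r = 0" if "fe r = 0" for r using that kernel by auto
  define g where "g = (\<lambda>t. ?F (SOME r. fe r = t))"
  have g: "g (fe r) = ?F r" for r
  proof -
    have "fe (SOME r'. fe r' = fe r) = fe r" by (rule someI) (rule refl)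
    then have "?F ((SOME r'. fe r' = fe r) - r) = 0" by (intro zero) (simp add: fe)
    then show ?thesis by (simp add: g_def F)
  qed
  have "lin sT sZ g"
  proof (rule linI[OF T.vector_space_axioms sZ])
    fix s t c
    obtain p q where pq: "s = fe p" "t = fe q" using surj by (metis surjD)
    have "g (fe (p + q)) = g (fe p) + g (fe q)" unfolding g by (simp add: F)
    then show "g (s + t) = g s + g t" by (simp add: fe pq)
    have "g (fe (free_scale c p)) = sZ c (g (fe p))" unfolding g by (simp add: F)
    then show "g (sT c s) = sZ c (g s)" by (simp add: fe pq)
  qed
  moreover have "g (x \<otimes> y) = f x y" for x y
    using g[of "Poly_Mapping.single (x, y) 1"] by (simp add: fe F)
  ultimately show ?thesis by blast
qed

lemma
  assumes f: "bilin sX sY sZ f"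
  shows lin_lift: "lin sT sZ (tensor_lift sT (\<otimes>) sZ f)"
    and lift_tensor: "tensor_lift sT (\<otimes>) sZ f (x \<otimes> y) = f x y"
proof -
  have "\<exists>!g. lin sT sZ g \<and> (\<forall>x y. g (x \<otimes> y) = f x y)"
  proof (rule ex_ex1I[OF lift_exists[OF f]])
    fix g h
    assume g: "lin sT sZ g \<and> (\<forall>x y. g (x \<otimes> y) = f x y)"
      and h: "lin sT sZ h \<and> (\<forall>x y. h (x \<otimes> y) = f x y)"
    show "g = h"
      by (rule ext, rule additive_eq[of g h])
        (simp_all add: g h lin_simps(1)[OF conjunct1[OF g]] lin_simps(1)[OF conjunct1[OF h]])
  qed
  from theI'[OF this] show "lin sT sZ (tensor_lift sT (\<otimes>) sZ f)"
    "tensor_lift sT (\<otimes>) sZ f (x \<otimes> y) = f x y"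
    by (auto simp: tensor_lift_def)
qed

lemmas lift_simps = lin_simps[OF lin_lift] lift_tensor

lemma lift_unique:
  assumes "lin sT sZ g" "\<And>x y. g (x \<otimes> y) = f x y"
  shows "tensor_lift sT (\<otimes>) sZ f = g"
proof -
  have "bilin sX sY sZ (\<lambda>x y. g (x \<otimes> y))" by (rule bilin_comp[OF bilin_tensor assms(1)])
  then have f: "bilin sX sY sZ f" by (simp add: assms(2))
  show ?thesis
    by (rule ext, rule additive_eq[of _ g])
      (simp_all add: lift_simps[OF f] lin_simps(1)[OF assms(1)] assms(2))
qed

lemma lift_comp:
  assumes "bilin sX sY sZ h" "lin sZ sU f"
  shows "f (tensor_lift sT (\<otimes>) sZ h z) = tensor_lift sT (\<otimes>) sU (\<lambda>x y. f (h x y)) z"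
  using lift_unique[OF lin_comp[OF lin_lift[OF assms(1)] assms(2)]]
  by (simp add: lift_tensor[OF assms(1)])

lemma lift_in_span:
  assumes h: "bilin sX sY sZ h"
  shows "tensor_lift sT (\<otimes>) sZ h z \<in> module.span sZ {h x y | x y. True}"
proof -
  interpret Z: vector_space sZ using lin_space bilin_right[OF h] by blast
  show ?thesis
  proof (induction z rule: tensor_induct)
    case (tensor x y)
    show ?case by (rule Z.span_base) (auto simp: lift_simps[OF h])
  next
    case (add s t)
    then show ?case by (simp only: lift_simps(1)[OF h] Z.span_add)
  qed
qed

lemma span_tensor:
  assumes "module.span sX U = UNIV" "module.span sY U' = UNIV"
    "\<And>u u'. u \<in> U \<Longrightarrow> u' \<in> U' \<Longrightarrow> u \<otimes> u' \<in> Z"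
  shows "module.span sT Z = UNIV"
proof -
  have 1: "u \<otimes> w \<in> T.span Z" if u: "u \<in> U" for u w
  proof -
    have "w \<in> Y.span U'" using assms(2) by simp
    then show ?thesis
    proof (induction rule: Y.span_induct_alt)
      case (step c x y)
      then show ?case
        using T.span_base[OF assms(3)[OF u step(1)]]
        by (simp add: tensor_right T.span_add T.span_scale)
    qed (simp add: tensor_right T.span_zero)
  qed
  have 2: "x \<otimes> w \<in> T.span Z" for x w
  proof -
    have "x \<in> X.span U" using assms(1) by simp
    then show ?thesis
    proof (induction rule: X.span_induct_alt)
      case (step c x y)
      then show ?case by (simp add: tensor_left T.span_add T.span_scale 1)
    qed (simp add: tensor_left T.span_zero)
  qed
  have "t \<in> T.span Z" for t
    by (induction t rule: tensor_induct) (simp_all add: 2 T.span_add)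
  then show ?thesis by blast
qed

text \<open>
  The slice \<open>f \<otimes> \<iota>\<close> by a functional on the left factor; together with a basis of that factor the
  slices by the coordinate functionals recover a tensor.
\<close>

definition lslice :: "('x \<Rightarrow> 'k) \<Rightarrow> 't \<Rightarrow> 'y"
  where "lslice f = tensor_lift sT (\<otimes>) sY (\<lambda>x y. sY (f x) y)"

lemma bilin_lslice:
  assumes "lin sX (*) f" shows "bilin sX sY sY (\<lambda>x y. sY (f x) y)"
  by (intro bilinI linI X.vector_space_axioms Y.vector_space_axioms)
    (simp_all add: lin_simps[OF assms] Y.scale_right_distrib Y.scale_left_distrib mult.commute)

lemmas lin_lslice = lin_lift[OF bilin_lslice, folded lslice_def]
lemmas lslice_tensor = lift_tensor[OF bilin_lslice, folded lslice_def]
lemmas lslice_simps = lin_simps[OF lin_lslice] lslice_tensor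

text \<open>
  This is the form in which linear independence is used: every tensor is a finite sum of
  elementary tensors whose right factors are slices of the tensor itself.
\<close>

lemma tensor_slice_expansion:
  obtains F :: "'x set" and f where "finite F" "\<And>b. b \<in> F \<Longrightarrow> lin sX (*) (f b)"
    "t = (\<Sum>b\<in>F. b \<otimes> lslice (f b) t)"
proof -
  define B where "B = X.extend_basis {}"
  have B: "X.independent B" and span: "X.span B = UNIV"
    by (simp_all add: B_def X.independent_extend_basis X.independent_empty)
  define f where "f = (\<lambda>b x. X.representation B x b)"
  have f: "lin sX (*) (f b)" for b
    unfolding f_def by (rule X.linear_representation[OF B span])
  have "\<exists>F. finite F \<and> F \<subseteq> B \<and> (\<forall>F'. finite F' \<and> F \<subseteq> F' \<and> F' \<subseteq> B \<longrightarrow> t = (\<Sum>b\<in>F'. b \<otimes> lslice (f b) t))"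
  proof (induction t rule: tensor_induct)
    case (tensor x y)
    let ?F = "{b. f b x \<noteq> 0}"
    have "finite ?F" "?F \<subseteq> B"
      unfolding f_def using X.finite_representation X.representation_ne_zero by blast+
    moreover have "x \<otimes> y = (\<Sum>b\<in>F'. b \<otimes> lslice (f b) (x \<otimes> y))"
      if F': "finite F'" "?F \<subseteq> F'" "F' \<subseteq> B" for F'
    proof -
      have "x = (\<Sum>b\<in>?F. sX (f b x) b)"
        unfolding f_def using X.sum_nonzero_representation_eq[OF B] span by simp
      also have "\<dots> = (\<Sum>b\<in>F'. sX (f b x) b)"
        by (rule sum.mono_neutral_left) (use F' in auto)
      finally have "x \<otimes> y = (\<Sum>b\<in>F'. sX (f b x) b) \<otimes> y" by simp
      also have "\<dots> = (\<Sum>b\<in>F'. b \<otimes> lslice (f b) (x \<otimes> y))"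
        by (simp add: lslice_simps[OF f] tensor_left tensor_right)
      finally show ?thesis .
    qed
    ultimately show ?case by blast
  next
    case (add s t)
    let ?P = "\<lambda>t F F'. finite F' \<and> F \<subseteq> F' \<and> F' \<subseteq> B \<longrightarrow> t = (\<Sum>b\<in>F'. b \<otimes> lslice (f b) t)"
    obtain F where F: "finite F" "F \<subseteq> B" "\<And>F'. ?P s F F'" using add(1) by blast
    obtain G where G: "finite G" "G \<subseteq> B" "\<And>F'. ?P t G F'" using add(2) by blast
    have "?P (s + t) (F \<union> G) F'" for F'
    proof
      assume F': "finite F' \<and> F \<union> G \<subseteq> F' \<and> F' \<subseteq> B"
      then have "s = (\<Sum>b\<in>F'. b \<otimes> lslice (f b) s)" "t = (\<Sum>b\<in>F'. b \<otimes> lslice (f b) t)"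
        using F(3)[of F'] G(3)[of F'] by simp_all
      then show "s + t = (\<Sum>b\<in>F'. b \<otimes> lslice (f b) (s + t))"
        by (simp only: lslice_simps(1)[OF f] tensor_right(1) sum.distrib)
    qed
    then show ?case using F(1,2) G(1,2) by (intro exI[of _ "F \<union> G"]) simp
  qed
  then show ?thesis using that f by blast
qed

lemma lslice_separates:
  assumes "\<And>f. lin sX (*) f \<Longrightarrow> lslice f t = 0"
  shows "t = 0"
proof -
  obtain F f where F: "\<And>b. b \<in> F \<Longrightarrow> lin sX (*) (f b)" "t = (\<Sum>b\<in>F. b \<otimes> lslice (f b) t)"
    using tensor_slice_expansion[of t] by metis
  show ?thesis
    by (subst F(2), rule sum.neutral) (simp add: F(1) assms tensor_right)
qed

end

lemma (in vector_space) functionals_separate: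
  assumes "\<And>f. lin scale (*) f \<Longrightarrow> f x = 0"
  shows "x = 0"
proof -
  define B where "B = extend_basis {}"
  have B: "independent B" and span: "span B = UNIV"
    by (simp_all add: B_def independent_extend_basis independent_empty)
  have "representation B x b = 0" for b
    by (rule assms[OF linear_representation[OF B span]])
  then show ?thesis using sum_nonzero_representation_eq[OF B, of x] span by simp
qed


section \<open>Multipliers of non-degenerate algebras\<close>

lemma lact_mult_of [simp]: "lact (mult_of a) x = a * x"
  and ract_mult_of [simp]: "ract x (mult_of a) = x * a"
  unfolding mult_of_def by (subst make_multiplier; simp add: algebra_simps)+

lemma lact_linear [simp]: "lact m 0 = 0" "lact m (- x) = - lact m x" "lact m (x - y) = lact m x - lact m y"
  and ract_linear [simp]: "ract 0 m = 0" "ract (- x) m = - ract x m" "ract (x - y) m = ract x m - ract y m"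
proof -
  interpret l: additive "lact m" by (simp add: additive_def lact_add)
  interpret r: additive "\<lambda>x. ract x m" by (simp add: additive_def ract_add)
  show "lact m 0 = 0" "lact m (- x) = - lact m x" "lact m (x - y) = lact m x - lact m y"
    "ract 0 m = 0" "ract (- x) m = - ract x m" "ract (x - y) m = ract x m - ract y m"
    by (fact l.zero l.minus l.diff r.zero r.minus r.diff)+
qed

lemma mult_mult_of: "m * mult_of a = mult_of (lact m a)"
  and mult_of_mult: "mult_of a * m = mult_of (ract a m)"
  by (rule multiplier_eqI; simp add: multiplier_acts lact_mult ract_mult mult_lact)+

lemma mult_of_times: "mult_of (a * b) = mult_of a * mult_of b"
  by (simp add: mult_mult_of)

context nondegenerate_algebra
begin

lemma eq_left: fixes a a' :: 'a shows "(\<And>b. a * b = a' * b) \<Longrightarrow> a = a'"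
  using nondegenerate_left[of "a - a'"] by (simp add: left_diff_distrib)

lemma eq_right: fixes a a' :: 'a shows "(\<And>b. b * a = b * a') \<Longrightarrow> a = a'"
  using nondegenerate_right[of "a - a'"] by (simp add: right_diff_distrib)

lemma bilin_mult: "bilin scale scale scale (*)"
  by (intro bilinI linI vector_space_axioms)
    (simp_all add: scale_mult_left scale_mult_right algebra_simps)

lemma mult_of_inj: "mult_of a = mult_of b \<Longrightarrow> a = (b :: 'a)"
  by (rule eq_left) (metis lact_mult_of)

lemma mult_of_eq_iff [simp]: "mult_of a = mult_of b \<longleftrightarrow> a = (b :: 'a)"
  using mult_of_inj by blast

lemma elem_mult_of [simp]: "elem (mult_of a) = (a :: 'a)"
  unfolding elem_def by (rule the_equality) (simp_all add: mult_of_inj)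

lemma mult_of_elem: "m \<in> range mult_of \<Longrightarrow> mult_of (elem m) = (m :: 'a multiplier)"
  by auto

lemma lact_scale: "lact m (scale c x) = scale c (lact m x)"
  by (rule eq_right) (simp add: mult_lact scale_mult_right)

lemma ract_scale: "ract (scale c x) m = scale c (ract x m)"
  by (rule eq_left) (simp flip: mult_lact add: scale_mult_left)

lemma lin_lact: "lin scale scale (lact m)"
  and lin_ract: "lin scale scale (\<lambda>x. ract x m)"
  by (intro linI vector_space_axioms; simp add: lact_add ract_add lact_scale ract_scale)+

text \<open>The identity \<open>x (m y) = (x m) y\<close> lets non-degeneracy recover the right action from the left one.\<close>

lemma multiplier_eq_lact: "(\<And>x. lact m x = lact n x) \<Longrightarrow> m = (n :: 'a multiplier)"
  by (rule multiplier_eqI) (simp_all add: eq_left flip: mult_lact)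

lemma ract_lact: "ract (lact m x) n = lact m (ract (x :: 'a) n)"
  by (rule mult_of_inj) (simp add: mult.assoc flip: mult_mult_of mult_of_mult)

text \<open>
  Non-degeneracy turns the compatibility of the two actions into additivity and into the module
  properties, so that a multiplier can be constructed from this one identity.
\<close>

lemma multiplier_of_pair:
  fixes L R :: "'a \<Rightarrow> 'a"
  assumes "\<And>x y. x * L y = R x * y"
  shows "lact (make_multiplier L R) x = L x" "ract x (make_multiplier L R) = R x"
proof -
  have "L (x + y) = L x + L y" for x y by (rule eq_right) (simp add: assms algebra_simps)
  moreover have "R (x + y) = R x + R y" for x y
    by (rule eq_left) (simp flip: assms add: algebra_simps)
  moreover have "L (x * y) = L x * y" for x y
    by (rule eq_right) (simp add: assms flip: mult.assoc)
  moreover have "R (x * y) = x * R y" for x y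
    by (rule eq_left) (simp flip: assms add: mult.assoc)
  ultimately show "lact (make_multiplier L R) x = L x" "ract x (make_multiplier L R) = R x"
    using assms by (auto intro!: make_multiplier)
qed

lemma lact_mult_scalar [simp]: "lact (mult_scalar scale c) x = scale c x"
  and ract_mult_scalar [simp]: "ract x (mult_scalar scale c) = scale c x"
  unfolding mult_scalar_def
  by (rule multiplier_of_pair; simp add: scale_mult_left scale_mult_right)+

lemma lact_mult_scale [simp]: "lact (mult_scale scale c m) x = scale c (lact m x)"
  and ract_mult_scale [simp]: "ract x (mult_scale scale c m) = scale c (ract x m)"
  by (simp_all add: mult_scale_def multiplier_acts ract_scale)

lemma vector_space_multiplier: "vector_space (mult_scale scale)"
  by unfold_locales
    (rule multiplier_eq_lact, simp add: multiplier_acts scale_right_distrib scale_left_distrib)+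

lemma mult_scale_times: "mult_scale scale c m * n = mult_scale scale c (m * n)"
  and times_mult_scale: "m * mult_scale scale c n = mult_scale scale c (m * n)"
  by (rule multiplier_eq_lact; simp add: multiplier_acts lact_scale)+

lemma bilin_times: "bilin (mult_scale scale) (mult_scale scale) (mult_scale scale) (*)"
  by (intro bilinI linI vector_space_multiplier)
    (simp_all add: mult_scale_times times_mult_scale algebra_simps)

lemma lin_mult_of: "lin scale (mult_scale scale) mult_of"
  by (intro linI vector_space_axioms vector_space_multiplier; rule multiplier_eq_lact)
    (simp_all add: multiplier_acts scale_mult_left algebra_simps)

lemma bilin_ract: "bilin scale (mult_scale scale) scale ract"
  by (intro bilinI lin_ract linI vector_space_axioms vector_space_multiplier)
    (simp_all add: multiplier_acts)

lemmas mult_of_linear = lin_simps[OF lin_mult_of]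

lemma mult_extend_automorphism:
  fixes h :: "'a \<Rightarrow> 'a"
  assumes "bij h" "\<And>a b. h (a * b) = h a * h b"
  shows "lact (mult_extend (\<lambda>z. mult_of (h z)) m) x = h (lact m (inv h x))"
    and "ract x (mult_extend (\<lambda>z. mult_of (h z)) m) = h (ract (inv h x) m)"
proof -
  have h_inv: "h (inv h y) = y" for y using \<open>bij h\<close> by (simp add: bij_is_surj surj_f_inv_f)
  have inv_h: "inv h (h y) = y" for y using \<open>bij h\<close> by (simp add: bij_is_inj)
  define n where "n = make_multiplier (\<lambda>x. h (lact m (inv h x))) (\<lambda>x. h (ract (inv h x) m))"
  have "y * h (lact m (inv h x)) = h (ract (inv h y) m) * x" for x y
  proof -
    have "y * h (lact m (inv h x)) = h (inv h y * lact m (inv h x))" by (simp only: assms(2) h_inv)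
    also have "\<dots> = h (ract (inv h y) m) * x" by (simp only: mult_lact assms(2) h_inv)
    finally show ?thesis .
  qed
  note pair = multiplier_of_pair[of "\<lambda>x. h (lact m (inv h x))" "\<lambda>x. h (ract (inv h x) m)", OF this]
  have n: "lact n x = h (lact m (inv h x))" "ract x n = h (ract (inv h x) m)" for x
    unfolding n_def by (fact pair)+
  have "mult_extend (\<lambda>z. mult_of (h z)) m = n"
    unfolding mult_extend_def
  proof (rule the_equality)
    fix n' assume n': "\<forall>b. n' * mult_of (h b) = mult_of (h (lact m b))
      \<and> mult_of (h b) * n' = mult_of (h (ract b m))"
    show "n' = n"
    proof (rule multiplier_eq_lact)
      fix x
      have "n' * mult_of (h (inv h x)) = mult_of (h (lact m (inv h x)))" using n' by blast
      then show "lact n' x = lact n x" by (simp add: n mult_mult_of h_inv)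
    qed
  qed (simp add: n mult_mult_of mult_of_mult inv_h)
  then show "lact (mult_extend (\<lambda>z. mult_of (h z)) m) x = h (lact m (inv h x))"
    "ract x (mult_extend (\<lambda>z. mult_of (h z)) m) = h (ract (inv h x) m)"
    by (simp_all add: n)
qed

text \<open>
  A homomorphism \<open>f : B \<rightarrow> M(C)\<close> with \<open>f(B) C = C = C f(B)\<close> extends to \<open>M(B)\<close>: the identity
  \<open>(e f(b')) (f(m b) c) = (e f(b' m)) (f(b) c)\<close> shows that \<open>f(b) c \<mapsto> f(m b) c\<close> is well defined.
\<close>

lemma mult_extend_nondegenerate:
  fixes f :: "'b::ring \<Rightarrow> 'a multiplier"
  assumes f_mult: "\<And>a b. f (a * b) = f a * f b"
    and left: "span {lact (f b) c | b c. True} = UNIV"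
    and right: "span {ract c (f b) | b c. True} = UNIV"
  shows "mult_extend f m * f b = f (lact m b)" "f b * mult_extend f m = f (ract b m)"
proof -
  define P where "P c d \<longleftrightarrow> (\<forall>e b. ract e (f b) * d = ract e (f (ract b m)) * c)" for c d
  define Q where "Q e d \<longleftrightarrow> (\<forall>c b. d * lact (f b) c = e * lact (f (lact m b)) c)" for e d
  have "f b * f (lact m b') = f (ract b m) * f b'" for b b'
    by (simp add: mult_lact flip: f_mult)
  then have move: "lact (f b) (lact (f (lact m b')) c) = lact (f (ract b m)) (lact (f b') c)" for b b' c
    by (metis multiplier_acts(11))
  have gen_P: "P (lact (f b) c) (lact (f (lact m b)) c)" for b c
    unfolding P_def by (simp add: move flip: mult_lact)
  have gen_Q: "Q (ract e (f b)) (ract e (f (ract b m)))" for e b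
    unfolding Q_def by (simp add: move flip: mult_lact)
  have P_ex: "\<exists>d. P c d" for c
  proof -
    have "c \<in> span {lact (f b) c | b c. True}" using left by simp
    then show ?thesis
    proof (induction rule: span_induct_alt)
      case base show ?case by (rule exI[of _ 0]) (simp add: P_def)
    next
      case (step k x y)
      then obtain b c d where "x = lact (f b) c" "P y d" by blast
      with gen_P have "P (scale k x + y) (scale k (lact (f (lact m b)) c) + d)"
        by (simp add: P_def distrib_left scale_mult_right)
      then show ?case by blast
    qed
  qed
  have Q_ex: "\<exists>d. Q e d" for e
  proof -
    have "e \<in> span {ract c (f b) | b c. True}" using right by simp
    then show ?thesis
    proof (induction rule: span_induct_alt)
      case base show ?case by (rule exI[of _ 0]) (simp add: Q_def)
    next
      case (step k x y)
      then obtain b c d where "x = ract c (f b)" "Q y d" by blast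
      with gen_Q have "Q (scale k x + y) (scale k (ract c (f (ract b m))) + d)"
        by (simp add: Q_def distrib_right scale_mult_left)
      then show ?case by blast
    qed
  qed
  obtain L R where L: "\<And>c. P c (L c)" and R: "\<And>e. Q e (R e)" using P_ex Q_ex by metis
  have right_ind: "x * y = 0" if "\<And>e b. ract e (f b) * y = 0" for x y
  proof -
    have "x \<in> span {ract c (f b) | b c. True}" using right by simp
    then show ?thesis
      by (induction rule: span_induct_alt) (use that in \<open>auto simp: distrib_right scale_mult_left\<close>)
  qed
  have L_unique: "d = L c" if "P c d" for c d
    by (rule eq_right, subst right_minus_eq[symmetric], unfold right_diff_distrib[symmetric],
        rule right_ind) (use that L[of c] in \<open>simp add: P_def right_diff_distrib\<close>)
  have L_gen: "L (lact (f b) c) = lact (f (lact m b)) c" for b c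
    using L_unique gen_P by metis
  have L_add: "L (scale k x + y) = scale k (L x) + L y" for k x y
    by (rule L_unique[symmetric])
      (use L[of x] L[of y] in \<open>simp add: P_def distrib_left scale_mult_right\<close>)
  have L_zero: "L 0 = 0" by (rule L_unique[symmetric]) (simp add: P_def)
  have pair: "e * L c = R e * c" for e c
  proof -
    have "c \<in> span {lact (f b) c | b c. True}" using left by simp
    then show ?thesis
    proof (induction rule: span_induct_alt)
      case (step k x y)
      then obtain b c where x: "x = lact (f b) c" by blast
      have "e * L x = R e * x" using R[of e] by (simp add: Q_def x L_gen)
      then show ?case using step by (simp add: L_add distrib_left scale_mult_right)
    qed (simp add: L_zero)
  qed
  define n where "n = make_multiplier L R"
  have lact_n: "lact n x = L x" and ract_n: "ract x n = R x" for x
    unfolding n_def using multiplier_of_pair[OF pair] by blast+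
  have n_f: "n * f b = f (lact m b)" for b
    by (rule multiplier_eq_lact) (simp add: multiplier_acts lact_n L_gen)
  have f_n: "f b * n = f (ract b m)" for b
    by (rule multiplier_eq_lact)
      (rule eq_right, use L in \<open>simp add: multiplier_acts lact_n P_def mult_lact\<close>)
  have "mult_extend f m = n"
    unfolding mult_extend_def
  proof (rule the_equality)
    fix n' assume n': "\<forall>b. n' * f b = f (lact m b) \<and> f b * n' = f (ract b m)"
    show "n' = n"
    proof (rule multiplier_eq_lact)
      fix x
      have "x \<in> span {lact (f b) c | b c. True}" using left by simp
      then show "lact n' x = lact n x"
      proof (induction rule: span_induct_alt)
        case (step k x y)
        then obtain b c where x: "x = lact (f b) c" by blast
        have "lact n' x = lact (n' * f b) c" "lact n x = lact (n * f b) c"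
          by (simp_all add: x multiplier_acts)
        then have "lact n' x = lact n x" using n' n_f by simp
        then show ?case using step by (simp add: lact_add lact_scale)
      qed simp
    qed
  qed (simp add: n_f f_n)
  then show "mult_extend f m * f b = f (lact m b)" "f b * mult_extend f m = f (ract b m)"
    by (simp_all add: n_f f_n)
qed

text \<open>As \<open>f(B) C = C\<close>, a multiplier is determined by its products with \<open>f(B)\<close>.\<close>

lemma nondegenerate_cancel_right:
  fixes f :: "'b \<Rightarrow> 'a multiplier"
  assumes left: "span {lact (f b) c | b c. True} = UNIV" and eq: "\<And>b. m * f b = n * f b"
  shows "m = n"
proof (rule multiplier_eq_lact)
  fix x
  have "x \<in> span {lact (f b) c | b c. True}" using left by simp
  then show "lact m x = lact n x"
  proof (induction rule: span_induct_alt)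
    case (step k x y)
    then obtain b c where x: "x = lact (f b) c" by blast
    have "lact (m * f b) c = lact (n * f b) c" using eq by simp
    then show ?case using step by (simp add: lact_add lact_scale x multiplier_acts)
  qed simp
qed

end

section \<open>Tensor products of non-degenerate algebras\<close>

context tensor_algebra
begin

lemma bilin_slice:
  assumes "lin sY (*) g" shows "bilin sX sY sX (\<lambda>x y. sX (g y) x)"
  by (intro bilinI linI X.vector_space_axioms Y.vector_space_axioms)
    (simp_all add: lin_simps[OF assms] X.scale_right_distrib X.scale_left_distrib mult.commute)

abbreviation rslice where "rslice g \<equiv> slice sX sT (\<otimes>) g"

lemmas lin_rslice = lin_lift[OF bilin_slice, folded slice_def]
lemmas rslice_tensor = lift_tensor[OF bilin_slice, folded slice_def]
lemmas rslice_simps = lin_simps[OF lin_rslice] rslice_tensor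

lemma functional_rslice:
  assumes f: "lin sX (*) f" and g: "lin sY (*) g"
  shows "f (rslice g t) = g (lslice f t)"
  by (rule additive_eq) (simp_all add: lslice_simps[OF f] rslice_simps[OF g] lin_simps[OF f]
      lin_simps[OF g] mult.commute)

end

locale nd_tensor = tensor_algebra sX sY sT tensor +
  X: nondegenerate_algebra sX + Y: nondegenerate_algebra sY
  for sX :: "'k::field \<Rightarrow> 'x::ring \<Rightarrow> 'x"
    and sY :: "'k \<Rightarrow> 'y::ring \<Rightarrow> 'y"
    and sT :: "'k \<Rightarrow> 't::ring \<Rightarrow> 't"
    and tensor :: "'x \<Rightarrow> 'y \<Rightarrow> 't" (infixl "\<otimes>" 75)
begin

lemma scale_mult: "sT c s * t = sT c (s * t)" "s * sT c t = sT c (s * t)"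
proof -
  have 1: "sT c (x \<otimes> y) * t = sT c ((x \<otimes> y) * t)" for x y
    by (rule additive_eq) (simp_all add: distrib_left T.scale_right_distrib tensor_mult
        X.scale_mult_left flip: tensor_left(2))
  show "sT c s * t = sT c (s * t)"
    by (rule additive_eq[of _ _ s]) (simp_all add: distrib_right T.scale_right_distrib 1)
  have 2: "s * sT c (x \<otimes> y) = sT c (s * (x \<otimes> y))" for x y
    by (rule additive_eq[of _ _ s]) (simp_all add: distrib_right T.scale_right_distrib tensor_mult
        X.scale_mult_right flip: tensor_left(2))
  show "s * sT c t = sT c (s * t)"
    by (rule additive_eq[of _ _ t]) (simp_all add: distrib_left T.scale_right_distrib 2)
qed

lemma rslice_separates:
  assumes "\<And>g. lin sY (*) g \<Longrightarrow> rslice g t = 0"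
  shows "t = 0"
proof (rule lslice_separates[of t])
  fix f assume f: "lin sX (*) f"
  show "lslice f t = 0"
    by (rule Y.functionals_separate) (simp add: assms lin_simps[OF f] flip: functional_rslice[OF f])
qed

lemma lslice_eqI: "(\<And>f. lin sX (*) f \<Longrightarrow> lslice f s = lslice f t) \<Longrightarrow> s = t"
  using lslice_separates[of "s - t"] by (simp add: lslice_simps)

text \<open>
  If \<open>t s = 0\<close> for all \<open>s\<close>, then non-degeneracy of \<open>Y\<close>, applied to the slices of \<open>t (x \<otimes> y)\<close> by
  functionals \<open>f\<close> on \<open>X\<close>, and of \<open>X\<close>, applied to the slices of \<open>t\<close> by functionals on \<open>Y\<close>, give \<open>t = 0\<close>.
\<close>

lemma nondegenerate_algebra: "nondegenerate_algebra sT"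
proof
  obtain x :: 'x and y :: 'y where "x \<noteq> 0" "y \<noteq> 0" using X.nonzero Y.nonzero by blast
  then obtain f where "lin sX (*) f" "f x \<noteq> 0" using X.functionals_separate by blast
  then have "lslice f (x \<otimes> y) \<noteq> 0" using \<open>y \<noteq> 0\<close> by (simp add: lslice_tensor)
  then show "\<exists>t :: 't. t \<noteq> 0" using \<open>lin sX (*) f\<close> lslice_simps(3) by metis
next
  fix t :: 't assume t: "\<And>s. t * s = 0"
  show "t = 0"
  proof (rule rslice_separates)
    fix g assume g: "lin sY (*) g"
    show "rslice g t = 0"
    proof (rule X.nondegenerate_left, rule X.functionals_separate)
      fix x f assume f: "lin sX (*) f"
      let ?f = "\<lambda>x'. f (x' * x)"
      have f': "lin sX (*) ?f" by (rule lin_comp[OF bilin_left[OF X.bilin_mult] f])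
      have "lslice ?f s * y = lslice f (s * (x \<otimes> y))" for y s
        by (rule additive_eq[of _ _ s]) (simp_all add: lslice_simps[OF f] lslice_simps[OF f']
            tensor_mult distrib_right Y.scale_mult_left)
      then have "lslice ?f t = 0"
        by (intro Y.nondegenerate_left[of "lslice ?f t"]) (simp add: t lslice_simps[OF f])
      then show "f (rslice g t * x) = 0"
        using functional_rslice[OF f' g, of t] by (simp add: lin_simps[OF g])
    qed
  qed
next
  fix t :: 't assume t: "\<And>s. s * t = 0"
  show "t = 0"
  proof (rule rslice_separates)
    fix g assume g: "lin sY (*) g"
    show "rslice g t = 0"
    proof (rule X.nondegenerate_right, rule X.functionals_separate)
      fix x f assume f: "lin sX (*) f"
      let ?f = "\<lambda>x'. f (x * x')"
      have f': "lin sX (*) ?f" by (rule lin_comp[OF bilin_right[OF X.bilin_mult] f])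
      have "y * lslice ?f s = lslice f ((x \<otimes> y) * s)" for y s
        by (rule additive_eq[of _ _ s]) (simp_all add: lslice_simps[OF f] lslice_simps[OF f']
            tensor_mult distrib_left Y.scale_mult_right)
      then have "lslice ?f t = 0"
        by (intro Y.nondegenerate_right[of "lslice ?f t"]) (simp add: t lslice_simps[OF f])
      then show "f (x * rslice g t) = 0"
        using functional_rslice[OF f' g, of t] by (simp add: lin_simps[OF g])
    qed
  qed
qed (rule scale_mult)+

sublocale T: nondegenerate_algebra sT by (rule nondegenerate_algebra)

lemma multiplier_eq_tensor:
  fixes p q :: "'t multiplier" shows "(\<And>x y. lact p (x \<otimes> y) = lact q (x \<otimes> y)) \<Longrightarrow> p = q"
  by (rule T.multiplier_eq_lact) (rule additive_eq, simp_all add: lact_add)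

abbreviation mten where "mten \<equiv> mult_tensor (\<otimes>)"

lemma mten_acts:
  "lact (mten m n) (x \<otimes> y) = lact m x \<otimes> lact n y" "ract (x \<otimes> y) (mten m n) = ract x m \<otimes> ract y n"
proof -
  let ?L = "tensor_lift sT (\<otimes>) sT (\<lambda>x y. lact m x \<otimes> lact n y)"
  let ?R = "tensor_lift sT (\<otimes>) sT (\<lambda>x y. ract x m \<otimes> ract y n)"
  note L = lift_simps[OF bilin_comp2[OF bilin_tensor X.lin_lact Y.lin_lact], of m n]
  note R = lift_simps[OF bilin_comp2[OF bilin_tensor X.lin_ract Y.lin_ract], of m n]
  have 1: "(x \<otimes> y) * ?L t = ?R (x \<otimes> y) * t" for x y t
    by (rule additive_eq[of _ _ t])
      (simp_all add: L R tensor_mult mult_lact distrib_left)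
  have "s * ?L t = ?R s * t" for s t
    by (rule additive_eq[of _ _ s]) (simp_all add: 1 R(1) distrib_right)
  note 2 = T.multiplier_of_pair[OF this]
  have "\<exists>!p. \<forall>x y. lact p (x \<otimes> y) = lact m x \<otimes> lact n y \<and> ract (x \<otimes> y) p = ract x m \<otimes> ract y n"
    (is "\<exists>!p. ?P p")
  proof (rule ex_ex1I)
    show "\<exists>p. ?P p" by (intro exI[of _ "make_multiplier ?L ?R"]) (simp add: 2 L R)
    show "p = q" if "?P p" "?P q" for p q
      by (rule multiplier_eq_tensor) (use that in simp)
  qed
  from theI'[OF this] show "lact (mten m n) (x \<otimes> y) = lact m x \<otimes> lact n y"
    "ract (x \<otimes> y) (mten m n) = ract x m \<otimes> ract y n"
    by (simp_all add: mult_tensor_def)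
qed

lemma mten_times: "mten m n * mten m' n' = mten (m * m') (n * n')"
  and mten_mult_of: "mten (mult_of x) (mult_of y) = mult_of (x \<otimes> y)"
  by (rule multiplier_eq_tensor; simp add: multiplier_acts mten_acts tensor_mult)+

lemma bilin_mten: "bilin (mult_scale sX) (mult_scale sY) (mult_scale sT) mten"
  by (intro bilinI linI X.vector_space_multiplier Y.vector_space_multiplier
      T.vector_space_multiplier; rule multiplier_eq_tensor)
    (simp_all add: multiplier_acts mten_acts tensor_left tensor_right)


text \<open>The multipliers \<open>x \<otimes> 1\<close> and \<open>1 \<otimes> y\<close>.\<close>

abbreviation ml where "ml x \<equiv> mten (mult_of x) 1"
abbreviation mr where "mr y \<equiv> mten 1 (mult_of y)"

lemma ml_mr: "ml x * mr y = mult_of (x \<otimes> y)" "mr y * ml x = mult_of (x \<otimes> y)"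
  by (simp_all add: mten_times mten_mult_of)

lemma ml_times: "ml x * ml x' = ml (x * x')" and mr_times: "mr y * mr y' = mr (y * y')"
  by (simp_all add: mten_times mult_of_times)

lemma mr_ml: "mr y * ml x = ml x * mr y"
  by (simp add: ml_mr)

lemma lin_ml: "lin sX (mult_scale sT) ml"
  by (rule lin_comp[OF X.lin_mult_of bilin_left[OF bilin_mten]])

lemma lin_mr: "lin sY (mult_scale sT) mr"
  by (rule lin_comp[OF Y.lin_mult_of bilin_right[OF bilin_mten]])

lemma ml_cancel:
  fixes p q :: "'t multiplier"
  assumes "\<And>x. ml x * p = ml x * q" shows "p = q"
proof (rule T.multiplier_eq_lact, rule T.eq_right)
  fix t s
  have "ract (x \<otimes> y) p = ract (x \<otimes> y) q" for x y
    using arg_cong[OF assms[of x], of "\<lambda>m. mr y * m"]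
    by (simp add: ml_mr mult_of_mult flip: mult.assoc)
  then have "ract s p = ract s q" for s
    by (intro additive_eq[of "\<lambda>s. ract s p" "\<lambda>s. ract s q" s]) (simp_all add: ract_add)
  then show "s * lact p t = s * lact q t" by (simp add: mult_lact)
qed

lemma ml_cancel_right:
  fixes p q :: "'t multiplier"
  assumes "\<And>x. p * ml x = q * ml x" shows "p = q"
proof (rule multiplier_eq_tensor)
  fix x y
  show "lact p (x \<otimes> y) = lact q (x \<otimes> y)"
    using arg_cong[OF assms[of x], of "\<lambda>m. m * mr y"]
    by (simp add: ml_mr mult_mult_of mult.assoc)
qed

lemma mr_cancel_right:
  fixes p q :: "'t multiplier"
  assumes "\<And>y. p * mr y = q * mr y" shows "p = q"
proof (rule multiplier_eq_tensor)
  fix x y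
  show "lact p (x \<otimes> y) = lact q (x \<otimes> y)"
    using arg_cong[OF assms[of y], of "\<lambda>m. m * ml x"]
    by (simp add: ml_mr mult_mult_of mult.assoc)
qed

lemma rslice_ml:
  assumes g: "lin sY (*) g"
  shows "rslice g (lact (ml x) t) = x * rslice g t" "rslice g (ract t (ml x)) = rslice g t * x"
  by (rule additive_eq[of _ _ t]; simp add: rslice_simps[OF g] lact_add ract_add mten_acts
      multiplier_acts distrib_left distrib_right X.scale_mult_left X.scale_mult_right)+

lemma rslice_mr:
  assumes g: "lin sY (*) g"
  shows "rslice g (lact (mr y) t) = rslice (\<lambda>b. g (y * b)) t"
    "rslice g (ract t (mr y)) = rslice (\<lambda>b. g (b * y)) t"
proof -
  note l = rslice_simps[OF lin_comp[OF bilin_right[OF Y.bilin_mult] g]]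
  note r = rslice_simps[OF lin_comp[OF bilin_left[OF Y.bilin_mult] g]]
  show "rslice g (lact (mr y) t) = rslice (\<lambda>b. g (y * b)) t"
    "rslice g (ract t (mr y)) = rslice (\<lambda>b. g (b * y)) t"
    by (rule additive_eq[of _ _ t]; simp add: rslice_simps[OF g] lact_add ract_add mten_acts
        multiplier_acts l r)+
qed

end


section \<open>Covered coproducts and coactions\<close>

text \<open>
  For a coaction \<open>\<alpha>\<close> these four definitions are the elements \<open>(x \<otimes> 1)\<alpha>(y)\<close>, \<open>\<alpha>(y)(x \<otimes> 1)\<close>, \<open>\<alpha>(y)(1 \<otimes> b)\<close> and
  \<open>(1 \<otimes> b)\<alpha>(y)\<close> of the tensor product. They are functions of the tensor map and of \<open>\<alpha>\<close> only, so
  that they can be used both for a coaction and for the coproduct.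
\<close>

definition cov_l1 :: "('x::ring \<Rightarrow> 'a::ring \<Rightarrow> 't::ring) \<Rightarrow> ('x \<Rightarrow> 't multiplier) \<Rightarrow> 'x \<Rightarrow> 'x \<Rightarrow> 't"
  where "cov_l1 t \<alpha> x y = elem (mult_tensor t (mult_of x) 1 * \<alpha> y)"

definition cov_r1 :: "('x::ring \<Rightarrow> 'a::ring \<Rightarrow> 't::ring) \<Rightarrow> ('x \<Rightarrow> 't multiplier) \<Rightarrow> 'x \<Rightarrow> 'x \<Rightarrow> 't"
  where "cov_r1 t \<alpha> y x = elem (\<alpha> y * mult_tensor t (mult_of x) 1)"

definition cov_r2 :: "('x::ring \<Rightarrow> 'a::ring \<Rightarrow> 't::ring) \<Rightarrow> ('x \<Rightarrow> 't multiplier) \<Rightarrow> 'x \<Rightarrow> 'a \<Rightarrow> 't"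
  where "cov_r2 t \<alpha> y b = elem (\<alpha> y * mult_tensor t 1 (mult_of b))"

definition cov_l2 :: "('x::ring \<Rightarrow> 'a::ring \<Rightarrow> 't::ring) \<Rightarrow> ('x \<Rightarrow> 't multiplier) \<Rightarrow> 'a \<Rightarrow> 'x \<Rightarrow> 't"
  where "cov_l2 t \<alpha> b y = elem (mult_tensor t 1 (mult_of b) * \<alpha> y)"

text \<open>
  A non-zero multiplicative functional \<open>g\<close> can be applied to the second leg of \<open>\<alpha>(y)\<close> without
  covering it, because \<open>g\<close> of a covering element can be divided out; the result is
  \<open>(\<iota> \<otimes> g)\<alpha>(y)\<close>.
\<close>

definition character :: "('k::field \<Rightarrow> 'a::ring \<Rightarrow> 'a) \<Rightarrow> ('a \<Rightarrow> 'k) \<Rightarrow> bool"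
  where "character sA g \<longleftrightarrow> lin sA (*) g \<and> (\<forall>a b. g (a * b) = g a * g b) \<and> (\<exists>a. g a = 1)"

definition translate ::
    "('k::field \<Rightarrow> 'x::ring \<Rightarrow> 'x) \<Rightarrow> ('k \<Rightarrow> 't::ring \<Rightarrow> 't) \<Rightarrow> ('x \<Rightarrow> 'a::ring \<Rightarrow> 't)
      \<Rightarrow> ('x \<Rightarrow> 't multiplier) \<Rightarrow> ('a \<Rightarrow> 'k) \<Rightarrow> 'x \<Rightarrow> 'x"
  where "translate sX sT t \<alpha> g y = slice sX sT t g (cov_l2 t \<alpha> (SOME c. g c = 1) y)"

lemma characterD:
  assumes "character sA g"
  shows "lin sA (*) g" "g (a * b) = g a * g b" "\<exists>a. g a = 1" "g (SOME c. g c = 1) = 1"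
  using assms by (auto simp: character_def intro: someI)

lemma (in nondegenerate_algebra) bilin_of_mult_of:
  assumes "bilin s1 s2 (mult_scale scale) (\<lambda>x y. mult_of (f x y))"
  shows "bilin s1 s2 scale f"
proof (rule bilinI)
  fix x
  note l = bilin_right[OF assms, of x]
  show "lin s2 scale (f x)"
    by (rule linI[OF lin_space(1)[OF l] vector_space_axioms]; rule mult_of_inj)
      (simp_all only: lin_simps[OF l] mult_of_linear)
next
  fix y
  note l = bilin_left[OF assms, of y]
  show "lin s1 scale (\<lambda>x. f x y)"
    by (rule linI[OF lin_space(1)[OF l] vector_space_axioms]; rule mult_of_inj)
      (simp_all only: lin_simps[OF l] mult_of_linear)
qed

context nd_tensor
begin

text \<open>
  If \<open>X \<otimes> Y\<close> is spanned by elements \<open>(x \<otimes> 1) p\<close> such that \<open>p (1 \<otimes> y)\<close> lies in \<open>X \<otimes> Y\<close>, then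
  multiplying by \<open>1 \<otimes> y\<close> and slicing shows that \<open>X\<close> is idempotent.
\<close>

lemma idempotent:
  assumes "\<And>t. mult_of t \<in> module.span (mult_scale sT) {ml x * f x' | x x'. True}"
    and f: "\<And>x y. f x * mr y \<in> range mult_of"
  shows "module.span sX {x * y | x y. True} = UNIV"
proof -
  interpret M: vector_space "mult_scale sT" by (rule T.vector_space_multiplier)
  let ?U = "X.span {x * y | x y. True}"
  obtain a b :: 'y where "a * b \<noteq> 0" using Y.nonzero Y.nondegenerate_left by blast
  then obtain g where g: "lin sY (*) g" "g (a * b) \<noteq> 0" using Y.functionals_separate by blast
  note s = rslice_simps[OF g(1)]
  have span: "\<exists>t. m * mr b = mult_of t \<and> rslice g t \<in> ?U"
    if "m \<in> M.span {ml x * f x' | x x'. True}" for m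
    using that
  proof (induction rule: M.span_induct_alt)
    case base
    show ?case by (rule exI[of _ 0]) (simp add: s X.span_zero T.mult_of_linear)
  next
    case (step c m n)
    then obtain x x' where m: "m = ml x * f x'" by blast
    obtain u where u: "f x' * mr b = mult_of u" using f by blast
    obtain t where t: "n * mr b = mult_of t" "rslice g t \<in> ?U" using step by blast
    have "(mult_scale sT c m + n) * mr b = mult_of (sT c (lact (ml x) u) + t)"
      by (simp add: m u t T.mult_scale_times distrib_right mult.assoc mult_mult_of
          T.mult_of_linear)
    moreover have "x * rslice g u \<in> ?U" by (rule X.span_base) blast
    then have "sX c (x * rslice g u) + rslice g t \<in> ?U"
      by (intro X.span_add X.span_scale t(2))
    then have "rslice g (sT c (lact (ml x) u) + t) \<in> ?U"
      by (simp only: s rslice_ml[OF g(1)])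
    ultimately show ?case by blast
  qed
  have "x \<in> ?U" for x
  proof -
    obtain t where t: "mult_of (x \<otimes> a) * mr b = mult_of t" "rslice g t \<in> ?U"
      using span[OF assms(1)] by blast
    then have "t = x \<otimes> (a * b)"
      by (simp add: mult_of_mult mten_acts multiplier_acts)
    then have "sX (g (a * b)) x \<in> ?U" using t(2) by (simp add: s)
    then have "sX (inverse (g (a * b))) (sX (g (a * b)) x) \<in> ?U" by (rule X.span_scale)
    then show ?thesis using g(2) by simp
  qed
  then show ?thesis by blast
qed

text \<open>The map \<open>\<iota> \<otimes> f\<close>.\<close>

definition rmap :: "('y \<Rightarrow> 'y) \<Rightarrow> 't \<Rightarrow> 't"
  where "rmap f = tensor_lift sT (\<otimes>) sT (\<lambda>x y. x \<otimes> f y)"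

lemma bilin_rmap: "lin sY sY f \<Longrightarrow> bilin sX sY sT (\<lambda>x y. x \<otimes> f y)"
  using bilin_comp2[OF bilin_tensor lin_id[OF X.vector_space_axioms]] .

lemmas rmap_simps = lift_simps[OF bilin_rmap, folded rmap_def]
lemmas lin_rmap = lin_lift[OF bilin_rmap, folded rmap_def]

lemma rslice_rmap:
  assumes "lin sY sY f" "lin sY (*) g"
  shows "rslice g (rmap f t) = rslice (\<lambda>y. g (f y)) t"
  by (rule additive_eq[of _ _ t])
    (simp_all add: rmap_simps[OF assms(1)] rslice_simps[OF assms(2)]
      rslice_simps[OF lin_comp[OF assms]])

lemma rslice_scaled:
  assumes "lin sY (*) g"
  shows "rslice (\<lambda>y. c * g y) t = sX c (rslice g t)"
proof -
  have "lin sY (*) (\<lambda>y. c * g y)"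
    by (rule linI[OF lin_space[OF assms]]) (simp_all add: lin_simps[OF assms] algebra_simps)
  note s = rslice_simps[OF this]
  show ?thesis
    by (rule additive_eq[of _ _ t]) (simp_all add: s rslice_simps[OF assms] X.scale_right_distrib)
qed

text \<open>
  For a character \<open>g\<close> the slice of \<open>(1 \<otimes> c) p (1 \<otimes> b)\<close> can be computed from either side, which
  separates the covering element from \<open>(\<iota> \<otimes> g)(p)\<close>.
\<close>

lemma character_slice:
  assumes g: "character sY g"
    and l: "\<And>c. mr c * p \<in> range mult_of" and r: "p * mr b \<in> range mult_of"
  shows "rslice g (elem (p * mr b)) = sX (g b) (rslice g (elem (mr (SOME c. g c = 1) * p)))"
proof -
  let ?c = "SOME c. g c = 1"
  note g_lin = characterD(1)[OF g] and g_mult = characterD(2)[OF g] and g_c = characterD(4)[OF g]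
  have "lact (mr ?c) (elem (p * mr b)) = ract (elem (mr ?c * p)) (mr b)"
    by (rule T.mult_of_inj)
      (simp add: T.mult_of_elem l r mult.assoc flip: mult_of_mult mult_mult_of)
  then have "rslice g (lact (mr ?c) (elem (p * mr b))) = rslice g (ract (elem (mr ?c * p)) (mr b))"
    by simp
  moreover have "(\<lambda>b'. g (b' * b)) = (\<lambda>b'. g b * g b')" "(\<lambda>b'. g (?c * b')) = g"
    by (simp_all add: g_mult g_c mult.commute)
  ultimately show ?thesis
    by (simp only: rslice_mr[OF g_lin] rslice_scaled[OF g_lin])
qed

end

context regular_multiplier_hopf_algebra
begin

sublocale AA: nd_tensor sA sA sAA tAA ..
sublocale AA_A: nd_tensor sAA sA sAAA tAA_A ..
sublocale A_AA: nd_tensor sA sAA sAAA tA_AA ..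

abbreviation "T1 \<equiv> cov_r2 (\<otimes>) \<Delta>"
abbreviation "T2 \<equiv> cov_l1 (\<otimes>) \<Delta>"
abbreviation "T3 \<equiv> cov_r1 (\<otimes>) \<Delta>"
abbreviation "T4 \<equiv> cov_l2 (\<otimes>) \<Delta>"
lemma lin_Delta: "lin sA (mult_scale sAA) \<Delta>" and Delta_mult: "\<Delta> (a * b) = \<Delta> a * \<Delta> b"
  using comult_hom by (simp_all add: algebra_hom_def)

lemma bilin_T_mult:
  "bilin sA sA (mult_scale sAA) (\<lambda>a b. \<Delta> a * AA.mr b)"
  "bilin sA sA (mult_scale sAA) (\<lambda>a b. AA.ml a * \<Delta> b)"
  "bilin sA sA (mult_scale sAA) (\<lambda>a b. \<Delta> a * AA.ml b)"
  "bilin sA sA (mult_scale sAA) (\<lambda>a b. AA.mr a * \<Delta> b)"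
  by (rule bilin_comp2[OF AA.T.bilin_times lin_Delta AA.lin_mr]
      bilin_comp2[OF AA.T.bilin_times AA.lin_ml lin_Delta]
      bilin_comp2[OF AA.T.bilin_times lin_Delta AA.lin_ml]
      bilin_comp2[OF AA.T.bilin_times AA.lin_mr lin_Delta])+

lemma mult_of_T:
  "mult_of (T1 a b) = \<Delta> a * AA.mr b" "mult_of (T2 a b) = AA.ml a * \<Delta> b"
  "mult_of (T3 a b) = \<Delta> a * AA.ml b" "mult_of (T4 a b) = AA.mr a * \<Delta> b"
proof -
  have "\<Delta> a * AA.mr b \<in> range mult_of"
    using bij_betw_apply[OF comult_bij1, of "a \<otimes> b"] AA.lift_tensor[OF bilin_T_mult(1), of a b]
    by simp
  moreover have "AA.ml a * \<Delta> b \<in> range mult_of"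
    using bij_betw_apply[OF comult_bij2, of "a \<otimes> b"] AA.lift_tensor[OF bilin_T_mult(2), of a b]
    by simp
  moreover have "\<Delta> a * AA.ml b \<in> range mult_of"
    using bij_betw_apply[OF comult_bij3, of "a \<otimes> b"] AA.lift_tensor[OF bilin_T_mult(3), of a b]
    by simp
  moreover have "AA.mr a * \<Delta> b \<in> range mult_of"
    using bij_betw_apply[OF comult_bij4, of "a \<otimes> b"] AA.lift_tensor[OF bilin_T_mult(4), of a b]
    by simp
  ultimately show
    "mult_of (T1 a b) = \<Delta> a * AA.mr b" "mult_of (T2 a b) = AA.ml a * \<Delta> b"
    "mult_of (T3 a b) = \<Delta> a * AA.ml b" "mult_of (T4 a b) = AA.mr a * \<Delta> b"
    by (simp_all only: cov_r2_def cov_l1_def cov_r1_def cov_l2_def AA.T.mult_of_elem)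
qed

lemma bilin_T1: "bilin sA sA sAA T1" and bilin_T4: "bilin sA sA sAA T4"
  by (rule AA.T.bilin_of_mult_of, unfold mult_of_T, rule bilin_T_mult)+

end

text \<open>What Galois objects have in common with \<open>A\<close>, on which \<open>A\<close> coacts by \<open>\<Delta>\<close>.\<close>

locale coaction_setup =
  reduced_right_coaction sA sAA tAA sAAA tAA_A tA_AA \<Delta> sX sXA tXA sXAA tXA_A tX_AA \<alpha> +
  XX: tensor_algebra sX sX sXX tXX
  for sA :: "'k::field \<Rightarrow> 'a::ring \<Rightarrow> 'a"
    and sAA :: "'k \<Rightarrow> 'aa::ring \<Rightarrow> 'aa"
    and tAA :: "'a \<Rightarrow> 'a \<Rightarrow> 'aa"
    and sAAA :: "'k \<Rightarrow> 'aaa::ring \<Rightarrow> 'aaa"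
    and tAA_A :: "'aa \<Rightarrow> 'a \<Rightarrow> 'aaa"
    and tA_AA :: "'a \<Rightarrow> 'aa \<Rightarrow> 'aaa"
    and \<Delta> :: "'a \<Rightarrow> 'aa multiplier"
    and sX :: "'k \<Rightarrow> 'x::ring \<Rightarrow> 'x"
    and sXA :: "'k \<Rightarrow> 'xa::ring \<Rightarrow> 'xa"
    and tXA :: "'x \<Rightarrow> 'a \<Rightarrow> 'xa" (infixl "\<otimes>" 75)
    and sXAA :: "'k \<Rightarrow> 'xaa::ring \<Rightarrow> 'xaa"
    and tXA_A :: "'xa \<Rightarrow> 'a \<Rightarrow> 'xaa" (infixl "\<otimes>\<^sub>r" 75)
    and tX_AA :: "'x \<Rightarrow> 'aa \<Rightarrow> 'xaa" (infixl "\<otimes>\<^sub>l" 75)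
    and \<alpha> :: "'x \<Rightarrow> 'xa multiplier"
    and sXX :: "'k \<Rightarrow> 'xx::ring \<Rightarrow> 'xx"
    and tXX :: "'x \<Rightarrow> 'x \<Rightarrow> 'xx" +
  fixes \<epsilon> :: "'a \<Rightarrow> 'k" and S :: "'a \<Rightarrow> 'a"
  assumes galois_bij: "bij_betw (galois_V sXA (\<otimes>) sXX tXX \<alpha>) UNIV (range mult_of)"
    and counit: "is_counit sA sAA tAA \<Delta> \<epsilon>"
    and antipode: "is_antipode sA sAA tAA \<Delta> \<epsilon> S"
begin

sublocale XA: nd_tensor sX sA sXA tXA ..
sublocale XX: nd_tensor sX sX sXX tXX ..
sublocale XA_A: nd_tensor sXA sA sXAA tXA_A ..
sublocale X_AA: nd_tensor sX sAA sXAA tX_AA ..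

abbreviation "V \<equiv> cov_l1 (\<otimes>) \<alpha>"
abbreviation "W \<equiv> cov_r1 (\<otimes>) \<alpha>"
abbreviation "P \<equiv> cov_r2 (\<otimes>) \<alpha>"
abbreviation "Q \<equiv> cov_l2 (\<otimes>) \<alpha>"
abbreviation "R \<equiv> translate sX sXA (\<otimes>) \<alpha>"
abbreviation "RA \<equiv> translate sA sAA tAA \<Delta>"

lemma lin_coact: "lin sX (mult_scale sXA) \<alpha>" and coact_mult: "\<alpha> (x * y) = \<alpha> x * \<alpha> y"
  using coact_hom by (simp_all add: algebra_hom_def)

lemma mult_of_cov:
  "mult_of (V x y) = XA.ml x * \<alpha> y" "mult_of (P y b) = \<alpha> y * XA.mr b"
  "mult_of (Q b y) = XA.mr b * \<alpha> y"
  unfolding cov_r2_def cov_l1_def cov_l2_def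
  by (intro XA.T.mult_of_elem coact_covered_right coact_covered_left coact_reduced)+

lemma bilin_V: "bilin sX sX sXA V" and bilin_P: "bilin sX sA sXA P" and bilin_Q: "bilin sA sX sXA Q"
  by (rule XA.T.bilin_of_mult_of, unfold mult_of_cov,
      rule bilin_comp2[OF XA.T.bilin_times XA.lin_ml lin_coact]
        bilin_comp2[OF XA.T.bilin_times lin_coact XA.lin_mr]
        bilin_comp2[OF XA.T.bilin_times XA.lin_mr lin_coact])+

lemmas V_right = lin_simps[OF bilin_right[OF bilin_V]]

text \<open>
  Identities between covered elements of \<open>X \<otimes> A\<close> become associativity and multiplicativity of \<open>\<alpha>\<close>
  once they are transported to the ring \<open>M(X \<otimes> A)\<close>.
\<close>

lemmas to_ring = mult_mult_of[symmetric] mult_of_mult[symmetric] mult_of_cov mult_of_T mult.assoc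
  coact_mult Delta_mult

lemma V_mr: "ract (V x y) (XA.mr b) = lact (XA.ml x) (P y b)"
  by (rule XA.T.mult_of_inj) (simp add: to_ring)

lemma mr_V: "lact (XA.mr b) (V x y) = lact (XA.ml x) (Q b y)"
  by (rule XA.T.mult_of_inj) (simp add: to_ring flip: mult.assoc XA.mr_ml)

lemma V_coact: "ract (V x y) (\<alpha> z) = V x (y * z)"
  by (rule XA.T.mult_of_inj) (simp add: to_ring)

lemma P_mr: "ract (P y a) (XA.mr b) = P y (a * b)"
  by (rule XA.T.mult_of_inj) (simp add: to_ring XA.mr_times)

lemma coact_P: "lact (\<alpha> x) (P y b) = P (x * y) b"
  by (rule XA.T.mult_of_inj) (simp add: to_ring)

lemma tensor_coact: "ract (x \<otimes> a) (\<alpha> y) = lact (XA.mr a) (V x y)"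
  by (rule XA.T.mult_of_inj)
    (simp add: to_ring flip: mult.assoc XA.mr_ml, simp add: XA.ml_mr flip: to_ring(2))

lemma T1_ml: "lact (AA.ml c) (T1 a b) = ract (T2 c a) (AA.mr b)"
  by (rule AA.T.mult_of_inj) (simp add: to_ring)

definition "V_lift = tensor_lift sXX tXX sXA V"

lemmas V_lift_simps = XX.lift_simps[OF bilin_V, folded V_lift_def]
lemmas lin_V_lift = XX.lin_lift[OF bilin_V, folded V_lift_def]

lemma mult_of_V_lift: "mult_of (V_lift z) = galois_V sXA (\<otimes>) sXX tXX \<alpha> z"
proof -
  have "galois_V sXA (\<otimes>) sXX tXX \<alpha> = (\<lambda>z. mult_of (V_lift z))"
    unfolding galois_V_def
    by (rule XX.lift_unique[OF lin_comp[OF lin_V_lift XA.T.lin_mult_of]])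
      (simp add: V_lift_simps mult_of_cov)
  then show ?thesis by simp
qed

lemma V_lift_inj: "V_lift z = V_lift z' \<Longrightarrow> z = z'"
  using injD[OF bij_betw_imp_inj_on[OF galois_bij], of z z'] by (simp flip: mult_of_V_lift)

lemma V_lift_surj: "\<exists>z. V_lift z = t"
proof -
  have "mult_of t \<in> range (galois_V sXA (\<otimes>) sXX tXX \<alpha>)"
    using bij_betw_imp_surj_on[OF galois_bij] by simp
  then obtain z where "mult_of t = mult_of (V_lift z)" by (auto simp: mult_of_V_lift)
  then show ?thesis by auto
qed

lemma V_induct [case_names V add]:
  assumes "\<And>x y. Pr (V x y)" "\<And>s t. Pr s \<Longrightarrow> Pr t \<Longrightarrow> Pr (s + t)"
  shows "Pr t"
proof -
  have "Pr (V_lift z)" for z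
    by (induction z rule: XX.tensor_induct) (simp_all add: V_lift_simps assms)
  then show ?thesis using V_lift_surj by metis
qed

lemma X_idempotent: "module.span sX {x * y | x y. True} = UNIV"
proof (rule XA.idempotent[of \<alpha>])
  fix t
  have "mult_of t \<in> range (galois_V sXA (\<otimes>) sXX tXX \<alpha>)"
    using bij_betw_imp_surj_on[OF galois_bij] by simp
  then show "mult_of t \<in> module.span (mult_scale sXA) {XA.ml x * \<alpha> x' | x x'. True}"
    using XX.lift_in_span[OF bilin_comp2[OF XA.T.bilin_times XA.lin_ml lin_coact]]
    by (auto simp: galois_V_def)
qed (simp flip: mult_of_cov)

section \<open>Coassociativity\<close>

text \<open>
  \<open>\<iota> \<otimes> \<Delta>\<close> and \<open>\<alpha> \<otimes> \<iota>\<close> on \<open>X \<otimes> A\<close>, and the multiplier \<open>(\<iota> \<otimes> \<Delta>)\<alpha>(y)\<close> of \<open>X \<otimes> A \<otimes> A\<close>.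
\<close>

definition "id_Delta =
  tensor_lift sXA (\<otimes>) (mult_scale sXAA) (\<lambda>y b. X_AA.mten (mult_of y) (\<Delta> b))"

definition "coact_id =
  tensor_lift sXA (\<otimes>) (mult_scale sXAA) (\<lambda>y b. XA_A.mten (\<alpha> y) (mult_of b))"

definition "coact2 y = mult_extend id_Delta (\<alpha> y)"

lemmas id_Delta_simps = XA.lift_simps[OF bilin_comp2[OF X_AA.bilin_mten X.lin_mult_of lin_Delta],
    folded id_Delta_def]
lemmas coact_id_simps = XA.lift_simps[OF bilin_comp2[OF XA_A.bilin_mten lin_coact A.lin_mult_of],
    folded coact_id_def]

lemma id_Delta_mult: "id_Delta (s * t) = id_Delta s * id_Delta t"
proof -
  have "id_Delta ((x \<otimes> a) * t) = id_Delta (x \<otimes> a) * id_Delta t" for x a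
    by (rule XA.additive_eq[of _ _ t])
      (simp_all add: id_Delta_simps distrib_left XA.tensor_mult X_AA.mten_times Delta_mult
        mult_of_times)
  then show ?thesis
    by (intro XA.additive_eq[of "\<lambda>s. id_Delta (s * t)" "\<lambda>s. id_Delta s * id_Delta t" s])
      (simp_all add: id_Delta_simps distrib_right)
qed

lemma id_Delta_nondegenerate:
  "module.span sXAA {lact (id_Delta z) t | z t. True} = UNIV"
  "module.span sXAA {ract t (id_Delta z) | z t. True} = UNIV"
proof -
  have "(x * y) \<otimes>\<^sub>l lact (\<Delta> a) w \<in> {lact (id_Delta z) t | z t. True}" for x y and a :: 'a and w
    by (rule CollectI, rule exI[of _ "x \<otimes> a"], rule exI[of _ "y \<otimes>\<^sub>l w"])
      (simp add: id_Delta_simps X_AA.mten_acts)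
  then show "module.span sXAA {lact (id_Delta z) t | z t. True} = UNIV"
    by (intro X_AA.span_tensor[OF X_idempotent comult_nondegenerate_left]) auto
  have "(x * y) \<otimes>\<^sub>l ract w (\<Delta> a) \<in> {ract t (id_Delta z) | z t. True}" for x y and a :: 'a and w
    by (rule CollectI, rule exI[of _ "y \<otimes> a"], rule exI[of _ "x \<otimes>\<^sub>l w"])
      (simp add: id_Delta_simps X_AA.mten_acts)
  then show "module.span sXAA {ract t (id_Delta z) | z t. True} = UNIV"
    by (intro X_AA.span_tensor[OF X_idempotent comult_nondegenerate_right]) auto
qed

lemma coact2_id_Delta: "coact2 y * id_Delta z = id_Delta (lact (\<alpha> y) z)"
  unfolding coact2_def
  by (rule XA_A.T.mult_extend_nondegenerate[OF id_Delta_mult id_Delta_nondegenerate])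

lemma coact_id_P: "coact_id (P y b) = coact2 y * XA_A.mr b"
  using coact_coassoc[of y b] unfolding coact_id_def coact2_def id_Delta_def cov_r2_def .

text \<open>The outer legs of \<open>X \<otimes> A \<otimes> A\<close> do not depend on the bracketing.\<close>

lemma X_AA_ml: "X_AA.ml x = XA_A.mten (XA.ml x) 1"
proof (rule XA_A.multiplier_eq_tensor)
  fix z b
  show "lact (X_AA.ml x) (z \<otimes>\<^sub>r b) = lact (XA_A.mten (XA.ml x) 1) (z \<otimes>\<^sub>r b)"
    by (rule XA.additive_eq[of _ _ z])
      (simp_all add: XA_A.tensor_left lact_add, simp add: XA_A.mten_acts XA.mten_acts multiplier_acts,
        simp add: tensor_assoc_X X_AA.mten_acts multiplier_acts)
qed

lemma XA_A_mr: "XA_A.mr b = X_AA.mten 1 (AA.mr b)"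
proof (rule XA_A.multiplier_eq_tensor)
  fix z c
  show "lact (XA_A.mr b) (z \<otimes>\<^sub>r c) = lact (X_AA.mten 1 (AA.mr b)) (z \<otimes>\<^sub>r c)"
    by (rule XA.additive_eq[of _ _ z])
      (simp_all add: XA_A.tensor_left lact_add, simp add: XA_A.mten_acts multiplier_acts,
        simp add: tensor_assoc_X X_AA.mten_acts AA.mten_acts multiplier_acts)
qed

text \<open>
  Covering on the left replaces the extension of \<open>\<iota> \<otimes> \<Delta>\<close> to multipliers by its values on \<open>X \<otimes> A\<close>.
\<close>

lemma ml_coact2: "X_AA.ml x * coact2 y = id_Delta (V x y)"
proof (rule XA_A.T.nondegenerate_cancel_right[OF id_Delta_nondegenerate(1)])
  fix z
  have "id_Delta (lact (XA.ml x) t) = X_AA.ml x * id_Delta t" for t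
    by (rule XA.additive_eq[of _ _ t])
      (simp_all add: id_Delta_simps lact_add distrib_left XA.mten_acts X_AA.mten_times
        multiplier_acts mult_of_times)
  then have "X_AA.ml x * coact2 y * id_Delta z = id_Delta (lact (XA.ml x) (lact (\<alpha> y) z))"
    by (simp add: mult.assoc coact2_id_Delta)
  also have "lact (XA.ml x) (lact (\<alpha> y) z) = V x y * z"
    using arg_cong[OF mult_of_cov(1)[of x y], of "\<lambda>m. lact m z"] by (simp add: multiplier_acts)
  finally show "X_AA.ml x * coact2 y * id_Delta z = id_Delta (V x y) * id_Delta z"
    by (simp add: id_Delta_mult)
qed

text \<open>
  The left covered version of coassociativity follows from the right covered one by covering on
  both sides.
\<close>

lemma coact_id_Q: "coact_id (Q b y) = XA_A.mr b * coact2 y"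
proof (rule XA_A.mr_cancel_right)
  fix c
  have r: "coact_id (ract t (XA.mr c)) = coact_id t * XA_A.mr c" for t
    by (rule XA.additive_eq[of _ _ t])
      (simp_all add: coact_id_simps ract_add distrib_right XA.mten_acts XA_A.mten_times
        multiplier_acts mult_of_times)
  have l: "coact_id (lact (XA.mr b) t) = XA_A.mr b * coact_id t" for t
    by (rule XA.additive_eq[of _ _ t])
      (simp_all add: coact_id_simps lact_add distrib_left XA.mten_acts XA_A.mten_times
        multiplier_acts mult_of_times)
  have "ract (Q b y) (XA.mr c) = lact (XA.mr b) (P y c)"
    by (rule XA.T.mult_of_inj) (simp add: to_ring)
  then show "coact_id (Q b y) * XA_A.mr c = XA_A.mr b * coact2 y * XA_A.mr c"
    by (simp flip: r add: l coact_id_P mult.assoc)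
qed

text \<open>
  Coassociativity with all legs covered:
  \<open>x y\<^sub>0 \<otimes> y\<^sub>1 \<otimes> y\<^sub>2 b\<close> and \<open>x y\<^sub>0 \<otimes> y\<^sub>1 \<otimes> b y\<^sub>2\<close>, computed by \<open>\<alpha>\<close> from the covered \<open>y\<^sub>0 \<otimes> y\<^sub>1\<close>
  and by \<open>\<Delta>\<close> from the other one.
\<close>

lemma bilin_V_tensor: "bilin sX sA sXAA (\<lambda>y b. V x y \<otimes>\<^sub>r b)"
  by (rule bilin_comp2[OF XA_A.bilin_tensor bilin_right[OF bilin_V] lin_id[OF A.vector_space_axioms]])

lemma bilin_tensor_T1: "bilin sX sA sXAA (\<lambda>q a. q \<otimes>\<^sub>l T1 a b)"
  by (rule bilin_comp2[OF X_AA.bilin_tensor lin_id[OF X.vector_space_axioms] bilin_left[OF bilin_T1]])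

lemma bilin_tensor_T4: "bilin sX sA sXAA (\<lambda>q a. q \<otimes>\<^sub>l T4 b a)"
  by (rule bilin_comp2[OF X_AA.bilin_tensor lin_id[OF X.vector_space_axioms] bilin_right[OF bilin_T4]])

lemma ml_coact_id:
  "X_AA.ml x * coact_id z = mult_of (tensor_lift sXA (\<otimes>) sXAA (\<lambda>y b. V x y \<otimes>\<^sub>r b) z)"
  by (rule XA.additive_eq[of _ _ z])
    (simp_all add: coact_id_simps distrib_left XA.lift_simps[OF bilin_V_tensor]
      XA_A.T.mult_of_linear X_AA_ml XA_A.mten_times flip: XA_A.mten_mult_of mult_of_cov)

lemma coassoc_P:
  "tensor_lift sXA (\<otimes>) sXAA (\<lambda>y b. V x y \<otimes>\<^sub>r b) (P y b) =
   tensor_lift sXA (\<otimes>) sXAA (\<lambda>q a. q \<otimes>\<^sub>l T1 a b) (V x y)" (is "?l = ?r (V x y)")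
proof -
  have "id_Delta z * XA_A.mr b = mult_of (?r z)" for z
    by (rule XA.additive_eq[of _ _ z])
      (simp_all add: id_Delta_simps distrib_right XA.lift_simps[OF bilin_tensor_T1]
        XA_A.T.mult_of_linear XA_A_mr X_AA.mten_times flip: X_AA.mten_mult_of mult_of_T)
  note T = this
  have "mult_of ?l = X_AA.ml x * coact2 y * XA_A.mr b"
    by (simp only: ml_coact_id[symmetric] coact_id_P mult.assoc)
  also have "\<dots> = mult_of (?r (V x y))" by (simp only: ml_coact2 T)
  finally show ?thesis by simp
qed

lemma coassoc_Q:
  "tensor_lift sXA (\<otimes>) sXAA (\<lambda>y b. V x y \<otimes>\<^sub>r b) (Q b y) =
   tensor_lift sXA (\<otimes>) sXAA (\<lambda>q a. q \<otimes>\<^sub>l T4 b a) (V x y)" (is "?l = ?r (V x y)")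
proof -
  have "XA_A.mr b * id_Delta z = mult_of (?r z)" for z
    by (rule XA.additive_eq[of _ _ z])
      (simp_all add: id_Delta_simps distrib_left XA.lift_simps[OF bilin_tensor_T4]
        XA_A.T.mult_of_linear XA_A_mr X_AA.mten_times flip: X_AA.mten_mult_of mult_of_T)
  note T = this
  have "X_AA.ml x * (XA_A.mr b * coact2 y) = XA_A.mr b * (X_AA.ml x * coact2 y)"
    by (simp add: X_AA_ml XA_A.mten_times flip: mult.assoc)
  then have "mult_of ?l = XA_A.mr b * (X_AA.ml x * coact2 y)"
    by (simp only: ml_coact_id[symmetric] coact_id_Q)
  also have "\<dots> = mult_of (?r (V x y))" by (simp only: ml_coact2 T)
  finally show ?thesis by simp
qed

end


lemma (in nd_tensor) ml_lact_cancel: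
  assumes "\<And>x. lact (ml x) s = lact (ml x) t"
  shows "s = t"
  by (rule T.mult_of_inj, rule ml_cancel) (simp add: mult_mult_of assms)

lemma (in nd_tensor) rmap_functional:
  assumes f: "lin sY (*) f"
  shows "rmap (\<lambda>a. sY (f a) b) z = rslice f z \<otimes> b"
proof -
  have "lin sY sY (\<lambda>a. sY (f a) b)"
    by (intro linI Y.vector_space_axioms) (simp_all add: lin_simps[OF f] Y.scale_left_distrib)
  note l = rmap_simps[OF this]
  show ?thesis
    by (rule additive_eq[of _ _ z])
      (simp_all add: l rslice_simps[OF f] tensor_left tensor_right)
qed

context coaction_setup
begin

section \<open>Characters, counit and antipode\<close>

text \<open>
  A bilinear map applied to the last two legs of \<open>X \<otimes> A \<otimes> A\<close>. Contracting the two forms of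
  coassociativity is how all further identities between iterated coproducts are obtained.
\<close>

definition contract :: "('a \<Rightarrow> 'a \<Rightarrow> 'a) \<Rightarrow> 'xaa \<Rightarrow> 'xa"
  where "contract m = tensor_lift sXAA (\<otimes>\<^sub>l) sXA (\<lambda>x w. x \<otimes> tensor_lift sAA tAA sA m w)"

context
  fixes m :: "'a \<Rightarrow> 'a \<Rightarrow> 'a"
  assumes m: "bilin sA sA sA m"
begin

lemma bilin_contract: "bilin sX sAA sXA (\<lambda>x w. x \<otimes> tensor_lift sAA tAA sA m w)"
  by (rule bilin_comp2[OF XA.bilin_tensor lin_id[OF X.vector_space_axioms] AA.lin_lift[OF m]])

lemmas contract_simps = X_AA.lift_simps[OF bilin_contract, folded contract_def]
lemmas lin_contract = X_AA.lin_lift[OF bilin_contract, folded contract_def]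

lemma contract_right: "contract m (z \<otimes>\<^sub>r b) = XA.rmap (\<lambda>a. m a b) z"
  by (rule XA.additive_eq[of _ _ z])
    (simp_all add: XA_A.tensor_left contract_simps XA.rmap_simps[OF bilin_left[OF m]]
      tensor_assoc_X AA.lift_simps[OF m])

lemma contract_coassoc_P:
  "tensor_lift sXA (\<otimes>) sXA (\<lambda>y b. XA.rmap (\<lambda>a. m a b) (V x y)) (P y b) =
   XA.rmap (\<lambda>a. tensor_lift sAA tAA sA m (T1 a b)) (V x y)"
  using arg_cong[OF coassoc_P[of x y b], of "contract m"]
  by (simp add: XA.lift_comp[OF bilin_V_tensor lin_contract]
      XA.lift_comp[OF bilin_tensor_T1 lin_contract] contract_right contract_simps XA.rmap_def)

lemma contract_coassoc_Q:
  "tensor_lift sXA (\<otimes>) sXA (\<lambda>y b. XA.rmap (\<lambda>a. m a b) (V x y)) (Q b y) =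
   XA.rmap (\<lambda>a. tensor_lift sAA tAA sA m (T4 b a)) (V x y)"
  using arg_cong[OF coassoc_Q[of x b y], of "contract m"]
  by (simp add: XA.lift_comp[OF bilin_V_tensor lin_contract]
      XA.lift_comp[OF bilin_tensor_T4 lin_contract] contract_right contract_simps XA.rmap_def)

end

text \<open>Contracting the last leg by a functional \<open>\<omega>\<close>: both sides are \<open>x y\<^sub>0 \<otimes> y\<^sub>1 \<omega>(y\<^sub>2 b)\<close>.\<close>

lemma V_rslice:
  assumes w: "lin sA (*) \<omega>"
  shows "V x (XA.rslice \<omega> (P y b)) = XA.rmap (\<lambda>a. AA.rslice \<omega> (T1 a b)) (V x y)"
proof -
  have b: "bilin sA sA sA (\<lambda>a b. sA (\<omega> b) a)" by (rule AA.bilin_slice[OF w])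
  have "XA.rmap (\<lambda>a. sA (\<omega> c) a) z = sXA (\<omega> c) z" for c z
    by (rule XA.additive_eq[of _ _ z])
      (simp_all add: XA.rmap_simps[OF bilin_left[OF b]] XA.T.scale_right_distrib XA.tensor_right)
  then show ?thesis
    using contract_coassoc_P[OF b, of x y b] unfolding slice_def
    by (simp add: XA.lift_comp[OF XA.bilin_slice[OF w] bilin_right[OF bilin_V]] V_right)
qed

lemma character_P:
  assumes g: "character sA g"
  shows "XA.rslice g (P y b) = sX (g b) (R g y)"
  unfolding cov_r2_def translate_def cov_l2_def
  by (rule XA.character_slice[OF g coact_covered_left coact_covered_right])

lemma character_T1:
  assumes g: "character sA g"
  shows "AA.rslice g (T1 a b) = sA (g b) (RA g a)"
  unfolding cov_r2_def translate_def cov_l2_def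
  by (rule AA.character_slice[OF g]) (simp_all flip: mult_of_T)

lemma character_mr:
  assumes g: "character sA g" and "g b = 1"
  shows "XA.rslice g (ract t (XA.mr b)) = XA.rslice g t"
    "AA.rslice g (ract s (AA.mr b)) = AA.rslice g s"
    "XA.rslice g (lact (XA.mr b) t) = XA.rslice g t"
  by (simp_all add: XA.rslice_mr AA.rslice_mr characterD(1,2)[OF g] assms(2))

lemma character_V:
  assumes g: "character sA g"
  shows "XA.rslice g (V x y) = x * R g y"
proof -
  obtain b where b: "g b = 1" using characterD(3)[OF g] by blast
  then have "XA.rslice g (V x y) = XA.rslice g (lact (XA.ml x) (P y b))"
    by (simp add: character_mr[OF g] flip: V_mr)
  then show ?thesis by (simp add: XA.rslice_ml characterD(1)[OF g] character_P[OF g] b)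
qed

lemma character_T2:
  assumes g: "character sA g"
  shows "AA.rslice g (T2 c a) = c * RA g a"
proof -
  obtain b where b: "g b = 1" using characterD(3)[OF g] by blast
  then have "AA.rslice g (T2 c a) = AA.rslice g (lact (AA.ml c) (T1 a b))"
    by (simp add: character_mr[OF g] T1_ml)
  then show ?thesis by (simp add: AA.rslice_ml characterD(1)[OF g] character_T1[OF g] b)
qed

lemma lin_RA:
  assumes g: "character sA g"
  shows "lin sA sA (RA g)"
  unfolding translate_def
  by (rule lin_comp[OF bilin_right[OF bilin_T4] AA.lin_rslice[OF characterD(1)[OF g]]])

lemma lin_R:
  assumes g: "character sA g"
  shows "lin sX sX (R g)"
  unfolding translate_def
  by (rule lin_comp[OF bilin_right[OF bilin_Q] XA.lin_rslice[OF characterD(1)[OF g]]])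

lemma V_translate:
  assumes g: "character sA g"
  shows "V x (R g y) = XA.rmap (RA g) (V x y)"
proof -
  obtain b where b: "g b = 1" using characterD(3)[OF g] by blast
  show ?thesis
    using V_rslice[OF characterD(1)[OF g], of x y b]
    by (simp add: character_P[OF g] character_T1[OF g] b)
qed

text \<open>
  Apply \<open>f\<close> to the right leg of \<open>(x \<otimes> 1)\<alpha>(R g y)\<close>. The functional \<open>f \<circ> RA g\<close> is the convolution product
  \<open>a \<mapsto> f(a\<^sub>1) g(a\<^sub>2)\<close>.
\<close>

lemma translate_translate:
  assumes f: "character sA f" and g: "character sA g" and fg: "character sA (\<lambda>a. f (RA g a))"
  shows "R f (R g y) = R (\<lambda>a. f (RA g a)) y"
proof (rule X.eq_right)
  fix x
  have "x * R f (R g y) = XA.rslice f (XA.rmap (RA g) (V x y))"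
    by (simp add: V_translate[OF g] flip: character_V[OF f])
  also have "\<dots> = x * R (\<lambda>a. f (RA g a)) y"
    by (simp add: XA.rslice_rmap[OF lin_RA[OF g] characterD(1)[OF f]] character_V[OF fg])
  finally show "x * R f (R g y) = x * R (\<lambda>a. f (RA g a)) y" .
qed

lemma translate_mult:
  assumes g: "character sA g"
  shows "R g (y * z) = R g y * R g z"
proof (rule X.eq_right)
  fix x
  note s = XA.rslice_simps[OF characterD(1)[OF g]]
  have "XA.rslice g (ract t (\<alpha> z)) = XA.rslice g t * R g z" for t
  proof (rule XA.additive_eq[of _ _ t])
    fix p a
    obtain b where b: "g b = 1" using characterD(3)[OF g] by blast
    have "XA.rslice g (lact (XA.mr a) (V p z)) = XA.rslice (\<lambda>c. g a * g c) (V p z)"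
      by (simp add: XA.rslice_mr[OF characterD(1)[OF g]] characterD(2)[OF g])
    then show "XA.rslice g (ract (p \<otimes> a) (\<alpha> z)) = XA.rslice g (p \<otimes> a) * R g z"
      by (simp add: tensor_coact XA.rslice_scaled[OF characterD(1)[OF g]] character_V[OF g] s
          X.scale_mult_left)
  qed (simp_all add: ract_add s distrib_right)
  from this[of "V x y"] show "x * R g (y * z) = x * (R g y * R g z)"
    by (simp add: character_V[OF g] V_coact mult.assoc)
qed

lemma counit_character: "character sA \<epsilon>"
  and counit_T1: "tensor_lift sAA tAA sA (\<lambda>p q. sA (\<epsilon> p) q) (T1 a b) = a * b"
  and counit_T2: "AA.rslice \<epsilon> (T2 a b) = a * b"
proof -
  have c: "lin sA (*) \<epsilon>" "\<epsilon> (a * b) = \<epsilon> a * \<epsilon> b"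
    "tensor_lift sAA tAA sA (\<lambda>p q. sA (\<epsilon> p) q) (T1 a b) = a * b"
    "AA.rslice \<epsilon> (T2 a b) = a * b" for a b
    using counit by (auto simp: is_counit_def algebra_hom_def cov_r2_def cov_l1_def slice_def)
  show "tensor_lift sAA tAA sA (\<lambda>p q. sA (\<epsilon> p) q) (T1 a b) = a * b"
    "AA.rslice \<epsilon> (T2 a b) = a * b" by (fact c)+
  have "\<exists>a. \<epsilon> a = 1"
  proof (rule ccontr)
    assume no: "\<nexists>a. \<epsilon> a = 1"
    have "\<epsilon> a = 0" for a
    proof (rule ccontr)
      assume "\<epsilon> a \<noteq> 0"
      then have "\<epsilon> (sA (inverse (\<epsilon> a)) a) = 1" by (simp add: lin_simps[OF c(1)])
      then show False using no by blast
    qed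
    then have "\<epsilon> = (\<lambda>a. 0 * \<epsilon> a)" by auto
    then have "AA.rslice \<epsilon> (T2 a b) = sA 0 (AA.rslice \<epsilon> (T2 a b))" for a b
      by (subst AA.rslice_scaled[OF c(1), symmetric]) simp
    then have "a * b = 0" for a b :: 'a by (simp add: c(4))
    then show False using A.nonzero A.nondegenerate_left by blast
  qed
  then show "character sA \<epsilon>" using c(1,2) by (simp add: character_def)
qed

lemma RA_counit: "RA \<epsilon> a = a"
  by (rule A.eq_right) (simp add: counit_T2 flip: character_T2[OF counit_character])

text \<open>
  Injectivity of \<open>\<alpha>\<close> gives the counit property of the coaction: \<open>(x \<otimes> 1)\<alpha>(R \<epsilon> y) = (x \<otimes> 1)\<alpha>(y)\<close> by
  coassociativity and the counit property of \<open>\<Delta>\<close>.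
\<close>

lemma R_counit: "R \<epsilon> y = y"
proof (rule injD[OF coact_inj], rule XA.ml_cancel)
  fix x
  have "RA \<epsilon> = (\<lambda>a. a)" by (simp add: fun_eq_iff RA_counit)
  then have "XA.rmap (RA \<epsilon>) z = z" for z
    by (intro XA.additive_eq[of "XA.rmap (RA \<epsilon>)" "\<lambda>z. z" z])
      (simp_all add: XA.rmap_simps[OF lin_id[OF A.vector_space_axioms]])
  then show "XA.ml x * \<alpha> (R \<epsilon> y) = XA.ml x * \<alpha> y"
    by (simp flip: mult_of_cov add: V_translate[OF counit_character])
qed

lemma counit_V: "XA.rslice \<epsilon> (V x y) = x * y"
  by (simp add: character_V[OF counit_character] R_counit)

lemma lin_S: "lin sA sA S" and bij_S: "bij S" and S_mult: "S (a * b) = S b * S a"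
  and antipode_T1: "tensor_lift sAA tAA sA (\<lambda>p q. S p * q) (T1 a b) = sA (\<epsilon> a) b"
  and antipode_T2: "tensor_lift sAA tAA sA (\<lambda>p q. p * S q) (T2 a b) = sA (\<epsilon> b) a"
  using antipode by (simp_all add: is_antipode_def cov_r2_def cov_l1_def)

lemma bilin_Sl: "bilin sA sA sA (\<lambda>p q. S p * q)"
  by (rule bilin_comp2[OF A.bilin_mult lin_S lin_id[OF A.vector_space_axioms]])

lemma bilin_Sr: "bilin sA sA sA (\<lambda>p q. p * S q)"
  by (rule bilin_comp2[OF A.bilin_mult lin_id[OF A.vector_space_axioms] lin_S])

lemma antipode_T4: "tensor_lift sAA tAA sA (\<lambda>p q. p * S q) (T4 b a) = sA (\<epsilon> a) (S b)"
proof (rule A.eq_right)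
  fix c
  let ?m = "tensor_lift sAA tAA sA (\<lambda>p q. p * S q)"
  note m = AA.lift_simps[OF bilin_Sr]
  have 1: "c * ?m t = ?m (lact (AA.ml c) t)" "?m (lact (AA.mr b) t) = ?m t * S b" for t
    by (rule AA.additive_eq[of _ _ t]; simp add: m lact_add algebra_simps AA.mten_acts
        multiplier_acts S_mult)+
  have "lact (AA.ml c) (T4 b a) = lact (AA.mr b) (T2 c a)"
    by (rule AA.T.mult_of_inj) (simp add: to_ring flip: mult.assoc AA.mr_ml)
  then show "c * ?m (T4 b a) = c * sA (\<epsilon> a) (S b)"
    by (simp add: 1 antipode_T2 A.scale_mult_left A.scale_mult_right)
qed

lemma antipode_T3: "tensor_lift sAA tAA sA (\<lambda>p q. S p * q) (T3 a c) = sA (\<epsilon> a) (S c)"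
proof (rule A.eq_left)
  fix b
  let ?m = "tensor_lift sAA tAA sA (\<lambda>p q. S p * q)"
  note m = AA.lift_simps[OF bilin_Sl]
  have 1: "?m t * b = ?m (ract t (AA.mr b))" "?m (ract t (AA.ml c)) = S c * ?m t" for t
    by (rule AA.additive_eq[of _ _ t]; simp add: m ract_add algebra_simps AA.mten_acts
        multiplier_acts S_mult)+
  have "ract (T3 a c) (AA.mr b) = ract (T1 a b) (AA.ml c)"
    by (rule AA.T.mult_of_inj) (simp add: to_ring AA.mr_ml)
  then show "?m (T3 a c) * b = sA (\<epsilon> a) (S c) * b"
    by (simp add: 1 antipode_T1 A.scale_mult_left A.scale_mult_right)
qed

text \<open>In Sweedler notation, \<open>x y\<^sub>0 \<otimes> S(y\<^sub>1) y\<^sub>2 b = x y \<otimes> b\<close>.\<close>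

lemma antipode_P:
  "tensor_lift sXA (\<otimes>) sXA (\<lambda>y b. ract (XA.rmap S (V x y)) (XA.mr b)) (P y b) = (x * y) \<otimes> b"
proof -
  have "XA.rmap (\<lambda>a. S a * c) z = ract (XA.rmap S z) (XA.mr c)" for c z
    by (rule XA.additive_eq[of _ _ z]) (simp_all add: XA.rmap_simps[OF bilin_left[OF bilin_Sl]]
        XA.rmap_simps[OF lin_S] ract_add XA.mten_acts multiplier_acts)
  moreover have "XA.rmap (\<lambda>a. sA (\<epsilon> a) b) z = XA.rslice \<epsilon> z \<otimes> b" for z
    by (rule XA.rmap_functional[OF characterD(1)[OF counit_character]])
  ultimately show ?thesis
    using contract_coassoc_P[OF bilin_Sl, of x y b] by (simp add: antipode_T1 counit_V)
qed

lemma bilin_P_S: "bilin sX sA sXA (\<lambda>q b. P q (S b))"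
  by (rule bilin_comp2[OF bilin_P lin_id[OF X.vector_space_axioms] lin_S])

definition "G = tensor_lift sXA (\<otimes>) sXA (\<lambda>q b. P q (S b))"

lemmas G_simps = XA.lift_simps[OF bilin_P_S, folded G_def]
lemmas lin_G = XA.lin_lift[OF bilin_P_S, folded G_def]

text \<open>
  \<open>y\<^sub>0 \<otimes> y\<^sub>1 S(b y\<^sub>2) = y \<otimes> S(b)\<close>. The element \<open>b\<close> stands to the left of \<open>y\<^sub>2\<close> so that \<open>S(y\<^sub>2)\<close> meets
  \<open>y\<^sub>1\<close>; this is why the second form of coassociativity is needed.
\<close>

lemma G_Q: "G (Q b y) = y \<otimes> S b"
proof (rule XA.ml_lact_cancel)
  fix x
  have "XA.rmap (\<lambda>a. a * S c) (V x z) = lact (XA.ml x) (P z (S c))" for c z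
  proof -
    have "XA.rmap (\<lambda>a. a * S c) z = ract z (XA.mr (S c))" for z
      by (rule XA.additive_eq[of _ _ z]) (simp_all add: XA.rmap_simps[OF bilin_left[OF bilin_Sr]]
          ract_add XA.mten_acts multiplier_acts)
    then show ?thesis by (simp add: V_mr)
  qed
  moreover have "XA.rmap (\<lambda>a. sA (\<epsilon> a) (S b)) z = XA.rslice \<epsilon> z \<otimes> S b" for z
    by (rule XA.rmap_functional[OF characterD(1)[OF counit_character]])
  ultimately show "lact (XA.ml x) (G (Q b y)) = lact (XA.ml x) (y \<otimes> S b)"
    using contract_coassoc_Q[OF bilin_Sr, of x b y]
    by (simp add: antipode_T4 counit_V G_def XA.lift_comp[OF bilin_P_S XA.T.lin_lact]
        XA.mten_acts multiplier_acts)
qed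

text \<open>
  \<open>W = G V\<close>, that is \<open>x\<^sub>0 y \<otimes> x\<^sub>1 = (x y\<^sub>0)\<^sub>0 \<otimes> (x y\<^sub>0)\<^sub>1 S(y\<^sub>1)\<close>. In particular \<open>\<alpha>(x)(y \<otimes> 1)\<close> lies in
  \<open>X \<otimes> A\<close>.
\<close>

lemma coact_ml: "\<alpha> x * XA.ml y = mult_of (G (V x y))"
proof (rule XA.mr_cancel_right)
  fix c
  obtain b where c: "c = S b" using bij_S by (metis bij_pointE)
  have 1: "ract (G z) (XA.mr (S b)) = G (lact (XA.mr b) z)" for z
    by (rule XA.additive_eq[of _ _ z])
      (simp_all add: G_simps lact_add ract_add XA.mten_acts multiplier_acts P_mr S_mult)
  have 2: "G (lact (XA.ml x) z) = lact (\<alpha> x) (G z)" for z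
    by (rule XA.additive_eq[of _ _ z])
      (simp_all add: G_simps lact_add XA.mten_acts multiplier_acts coact_P)
  have "ract (G (V x y)) (XA.mr c) = lact (\<alpha> x) (y \<otimes> c)"
    by (simp add: c 1 mr_V 2 G_Q)
  then show "\<alpha> x * XA.ml y * XA.mr c = mult_of (G (V x y)) * XA.mr c"
    by (simp add: mult_of_mult mult.assoc XA.ml_mr mult_mult_of)
qed

lemma W_eq_G_V: "W x y = G (V x y)"
  by (simp add: cov_r1_def coact_ml)

lemma mult_of_W: "mult_of (W x y) = \<alpha> x * XA.ml y"
  by (simp add: W_eq_G_V coact_ml)

lemma bilin_W: "bilin sX sX sXA W"
  unfolding W_eq_G_V by (rule bilin_comp[OF bilin_V lin_G])

lemma ml_W: "lact (XA.ml p) (W x y) = ract (V p x) (XA.ml y)"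
  by (rule XA.T.mult_of_inj) (simp add: to_ring mult_of_W)

lemma character_W:
  assumes g: "character sA g"
  shows "XA.rslice g (W x y) = R g x * y"
proof (rule X.eq_right)
  fix p
  have "XA.rslice g (lact (XA.ml p) (W x y)) = XA.rslice g (V p x) * y"
    by (simp add: ml_W XA.rslice_ml characterD(1)[OF g])
  then show "p * XA.rslice g (W x y) = p * (R g x * y)"
    by (simp add: XA.rslice_ml characterD(1)[OF g] character_V[OF g] mult.assoc)
qed

lemma character_S:
  assumes g: "character sA g"
  shows "character sA (\<lambda>a. g (S a))"
proof -
  obtain b where "g b = 1" using characterD(3)[OF g] by blast
  moreover obtain a where "b = S a" using bij_S by (metis bij_pointE)
  ultimately show ?thesis
    using lin_comp[OF lin_S characterD(1)[OF g]]
    by (auto simp: character_def S_mult characterD(2)[OF g] mult.commute)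
qed

text \<open>
  \<open>g(a\<^sub>1) g(S(a\<^sub>2)) = g(a\<^sub>1 S(a\<^sub>2)) = \<epsilon>(a)\<close>: as \<open>g\<close> is multiplicative, \<open>g \<circ> S\<close> is its convolution inverse.
\<close>

lemma character_RA_S:
  assumes g: "character sA g"
  shows "g (RA (\<lambda>a. g (S a)) a) = \<epsilon> a"
proof -
  obtain c where c: "g c = 1" using characterD(3)[OF g] by blast
  note gS = character_S[OF g] and gl = lin_simps[OF characterD(1)[OF g]]
  let ?m = "tensor_lift sAA tAA sA (\<lambda>p q. p * S q)"
  have "g (?m t) = g (AA.rslice (\<lambda>a. g (S a)) t)" for t
    by (rule AA.additive_eq[of _ _ t]) (simp_all add: AA.lift_simps[OF bilin_Sr] gl
        characterD(2)[OF g] AA.rslice_simps[OF characterD(1)[OF gS]] mult.commute)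
  from this[of "T2 c a"] show ?thesis
    by (simp add: antipode_T2 character_T2[OF gS] characterD(2)[OF g] c gl)
qed

lemma translate_inverse:
  assumes g: "character sA g"
  shows "R g (R (\<lambda>a. g (S a)) y) = y"
  using translate_translate[OF g character_S[OF g]] counit_character
  by (simp add: character_RA_S[OF g] R_counit)

end


section \<open>The coproduct as a coaction\<close>

text \<open>
  The coproduct is a coaction of \<open>A\<close> on itself, with \<open>V\<close> the bijection \<open>a \<otimes> b \<mapsto> (a \<otimes> 1)\<Delta>(b)\<close>, so
  that everything above applies to \<open>A\<close> in place of \<open>X\<close>.
\<close>

locale hopf_setup = regular_multiplier_hopf_algebra sA sAA tAA sAAA tAA_A tA_AA \<Delta>
  for sA :: "'k::field \<Rightarrow> 'a::ring \<Rightarrow> 'a"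
    and sAA :: "'k \<Rightarrow> 'aa::ring \<Rightarrow> 'aa"
    and tAA :: "'a \<Rightarrow> 'a \<Rightarrow> 'aa" (infixl "\<otimes>" 75)
    and sAAA :: "'k \<Rightarrow> 'aaa::ring \<Rightarrow> 'aaa"
    and tAA_A :: "'aa \<Rightarrow> 'a \<Rightarrow> 'aaa" (infixl "\<otimes>\<^sub>r" 75)
    and tA_AA :: "'a \<Rightarrow> 'aa \<Rightarrow> 'aaa" (infixl "\<otimes>\<^sub>l" 75)
    and \<Delta> :: "'a \<Rightarrow> 'aa multiplier" +
  fixes \<epsilon> :: "'a \<Rightarrow> 'k" and S :: "'a \<Rightarrow> 'a"
  assumes hopf_counit: "is_counit sA sAA (\<otimes>) \<Delta> \<epsilon>"
    and hopf_antipode: "is_antipode sA sAA (\<otimes>) \<Delta> \<epsilon> S"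
begin

lemma comult_inj: "inj \<Delta>"
proof (rule injI, rule A.eq_right)
  fix a a' c assume "\<Delta> a = \<Delta> a'"
  then have "T2 c a = T2 c a'" by (simp add: cov_l1_def)
  moreover have "tensor_lift sAA (\<otimes>) sA (\<lambda>p q. sA (\<epsilon> q) p) (T2 c b) = c * b" for b
    using hopf_counit by (simp add: is_counit_def cov_l1_def)
  ultimately show "c * a = c * a'" by metis
qed

lemma A_idempotent: "module.span sA {a * b | a b. True} = UNIV"
proof (rule AA.idempotent[of \<Delta>])
  fix t
  have "mult_of t \<in> range (tensor_lift sAA (\<otimes>) (mult_scale sAA) (\<lambda>a b. AA.ml a * \<Delta> b))"
    using bij_betw_imp_surj_on[OF comult_bij2] by simp
  then show "mult_of t \<in> module.span (mult_scale sAA) {AA.ml a * \<Delta> b | a b. True}"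
    using AA.lift_in_span[OF bilin_T_mult(2)] by auto
qed (simp flip: mult_of_T)

definition "Delta_id =
  tensor_lift sAA (\<otimes>) (mult_scale sAAA) (\<lambda>b c. AA_A.mten (\<Delta> b) (mult_of c))"

lemmas Delta_id_simps = AA.lift_simps[OF bilin_comp2[OF AA_A.bilin_mten lin_Delta A.lin_mult_of],
    folded Delta_id_def]

lemma Delta_id_mult: "Delta_id (s * t) = Delta_id s * Delta_id t"
proof -
  have "Delta_id ((x \<otimes> a) * t) = Delta_id (x \<otimes> a) * Delta_id t" for x a
    by (rule AA.additive_eq[of _ _ t])
      (simp_all add: Delta_id_simps distrib_left AA.tensor_mult AA_A.mten_times Delta_mult
        mult_of_times)
  then show ?thesis
    by (intro AA.additive_eq[of "\<lambda>s. Delta_id (s * t)" "\<lambda>s. Delta_id s * Delta_id t" s])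
      (simp_all add: Delta_id_simps distrib_right)
qed

lemma Delta_id_nondegenerate:
  "module.span sAAA {lact (Delta_id z) t | z t. True} = UNIV"
  "module.span sAAA {ract t (Delta_id z) | z t. True} = UNIV"
proof -
  have "lact (\<Delta> a) w \<otimes>\<^sub>r (x * y) \<in> {lact (Delta_id z) t | z t. True}" for x y a :: 'a and w
    by (rule CollectI, rule exI[of _ "a \<otimes> x"], rule exI[of _ "w \<otimes>\<^sub>r y"])
      (simp add: Delta_id_simps AA_A.mten_acts)
  then show "module.span sAAA {lact (Delta_id z) t | z t. True} = UNIV"
    by (intro AA_A.span_tensor[OF comult_nondegenerate_left A_idempotent]) auto
  have "ract w (\<Delta> a) \<otimes>\<^sub>r (x * y) \<in> {ract t (Delta_id z) | z t. True}" for x y a :: 'a and w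
    by (rule CollectI, rule exI[of _ "a \<otimes> y"], rule exI[of _ "w \<otimes>\<^sub>r x"])
      (simp add: Delta_id_simps AA_A.mten_acts)
  then show "module.span sAAA {ract t (Delta_id z) | z t. True} = UNIV"
    by (intro AA_A.span_tensor[OF comult_nondegenerate_right A_idempotent]) auto
qed

text \<open>
  The extended map \<open>\<Delta> \<otimes> \<iota>\<close> applied to \<open>\<Delta>(a)\<close> and covered from the right: this turns coassociativity
  of \<open>\<Delta>\<close> into the form required of a coaction.
\<close>

lemma Delta_id_T1: "Delta_id (T1 a c) = mult_extend Delta_id (\<Delta> a) * AA_A.mr c"
proof (rule AA_A.T.nondegenerate_cancel_right[OF Delta_id_nondegenerate(1)])
  fix z
  have 1: "Delta_id (lact (AA.mr c) t) = AA_A.mr c * Delta_id t" for t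
    by (rule AA.additive_eq[of _ _ t])
      (simp_all add: Delta_id_simps lact_add distrib_left AA.mten_acts AA_A.mten_times
        multiplier_acts mult_of_times)
  have 2: "mult_extend Delta_id m * Delta_id t = Delta_id (lact m t)" for m t
    by (rule AA_A.T.mult_extend_nondegenerate[OF Delta_id_mult Delta_id_nondegenerate])
  have "T1 a c * z = lact (\<Delta> a) (lact (AA.mr c) z)"
    using arg_cong[OF mult_of_T(1)[of a c], of "\<lambda>m. lact m z"] by (simp add: multiplier_acts)
  then show "Delta_id (T1 a c) * Delta_id z = mult_extend Delta_id (\<Delta> a) * AA_A.mr c * Delta_id z"
    by (simp add: mult.assoc 2 flip: 1 Delta_id_mult)
qed

sublocale QA: coaction_setup sA sAA tAA sAAA tAA_A tA_AA \<Delta> sA sAA tAA sAAA tAA_A tA_AA \<Delta> sAA tAA \<epsilon> S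
proof unfold_locales
  show "(a \<otimes> b) \<otimes>\<^sub>r c = a \<otimes>\<^sub>l (b \<otimes> c)" for a b c by (rule tensor_assoc)
  show "algebra_hom sA (mult_scale sAA) \<Delta>" by (rule comult_hom)
  show "inj \<Delta>" by (rule comult_inj)
  show "\<Delta> x * AA.mr a \<in> range mult_of" "AA.mr a * \<Delta> x \<in> range mult_of"
    "AA.ml y * \<Delta> x \<in> range mult_of" for x y a
    by (simp_all flip: mult_of_T)
  show "tensor_lift sAA (\<otimes>) (mult_scale sAAA) (\<lambda>b c. AA_A.mten (\<Delta> b) (mult_of c))
      (elem (\<Delta> a * AA.mr c)) =
    mult_extend (tensor_lift sAA (\<otimes>) (mult_scale sAAA) (\<lambda>b c. A_AA.mten (mult_of b) (\<Delta> c))) (\<Delta> a)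
      * AA_A.mr c" for a c
    using Delta_id_T1[of a c] by (simp add: Delta_id_def cov_r2_def comult_coassoc)
  show "bij_betw (galois_V sAA (\<otimes>) sAA (\<otimes>) \<Delta>) UNIV (range mult_of)"
    unfolding galois_V_def by (rule comult_bij2)
qed (fact hopf_counit hopf_antipode)+

lemma counit_RA:
  assumes g: "character sA g"
  shows "\<epsilon> (QA.RA g a) = g a"
proof -
  obtain b where b: "g b = 1" using characterD(3)[OF g] by blast
  note e = characterD(1)[OF QA.counit_character]
  have "\<epsilon> (AA.rslice g (T1 a b)) = g (AA.lslice \<epsilon> (T1 a b))"
    by (rule AA.functional_rslice[OF e characterD(1)[OF g]])
  then show ?thesis
    by (simp add: AA.lslice_def QA.counit_T1 QA.character_T1[OF g] characterD(2)[OF g] b)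
qed

text \<open>The characters \<open>g\<close> and \<open>g \<circ> S\<^sup>2\<close> are both convolution inverses of \<open>g \<circ> S\<close>.\<close>

lemma character_SS:
  assumes g: "character sA g"
  shows "g (S (S a)) = g a"
proof -
  note gS = QA.character_S[OF g]
  note gSS = QA.character_S[OF gS]
  have "QA.RA g (QA.RA (\<lambda>a. g (S a)) (QA.RA (\<lambda>a. g (S (S a))) a)) = QA.RA (\<lambda>a. g (S (S a))) a"
    by (rule QA.translate_inverse[OF g])
  then have "QA.RA g a = QA.RA (\<lambda>a. g (S (S a))) a"
    by (simp add: QA.translate_inverse[OF gS])
  then show ?thesis using counit_RA[OF g] counit_RA[OF gSS] by metis
qed

end

section \<open>The integral and its modular automorphism\<close>

locale quantum_group_setup =
  algebraic_quantum_group sA sAA tAA sAAA tAA_A tA_AA \<Delta> \<phi> +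
  hopf_setup sA sAA tAA sAAA tAA_A tA_AA \<Delta> \<epsilon> S
  for sA :: "'k::field \<Rightarrow> 'a::ring \<Rightarrow> 'a"
    and sAA :: "'k \<Rightarrow> 'aa::ring \<Rightarrow> 'aa"
    and tAA :: "'a \<Rightarrow> 'a \<Rightarrow> 'aa" (infixl "\<otimes>" 75)
    and sAAA :: "'k \<Rightarrow> 'aaa::ring \<Rightarrow> 'aaa"
    and tAA_A :: "'aa \<Rightarrow> 'a \<Rightarrow> 'aaa" (infixl "\<otimes>\<^sub>r" 75)
    and tA_AA :: "'a \<Rightarrow> 'aa \<Rightarrow> 'aaa" (infixl "\<otimes>\<^sub>l" 75)
    and \<Delta> :: "'a \<Rightarrow> 'aa multiplier" and \<phi> :: "'a \<Rightarrow> 'k" and \<epsilon> :: "'a \<Rightarrow> 'k" and S :: "'a \<Rightarrow> 'a" +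
  fixes \<sigma> :: "'a \<Rightarrow> 'a"
  assumes modular: "is_modular_automorphism sA \<phi> \<sigma>"
begin

lemmas phi_lin = integral_linear
lemmas phi_simps = lin_simps[OF integral_linear]
lemmas phi_slice = AA.rslice_simps[OF integral_linear]

lemma sigma_lin: "lin sA sA \<sigma>" and sigma_mult: "\<sigma> (a * b) = \<sigma> a * \<sigma> b" and sigma_bij: "bij \<sigma>"
  and phi_sigma: "\<phi> (a * b) = \<phi> (b * \<sigma> a)"
  using modular by (simp_all add: is_modular_automorphism_def algebra_automorphism_def algebra_hom_def)

lemma phi_mult_left: "lin sA (*) (\<lambda>a. \<phi> (b * a))" and phi_mult_right: "lin sA (*) (\<lambda>a. \<phi> (a * b))"
  by (rule lin_comp[OF bilin_right[OF A.bilin_mult] integral_linear]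
      lin_comp[OF bilin_left[OF A.bilin_mult] integral_linear])+

lemma phi_T3: "AA.rslice \<phi> (T3 a b) = sA (\<phi> a) b"
  using integral_left_invariant by (simp add: cov_r1_def)

lemma phi_T2: "AA.rslice \<phi> (T2 c a) = sA (\<phi> a) c"
proof (rule A.eq_left)
  fix d
  have "lact (AA.ml c) (T3 a d) = ract (T2 c a) (AA.ml d)"
    by (rule AA.T.mult_of_inj) (simp add: mult.assoc mult_of_T flip: mult_mult_of mult_of_mult)
  then have "AA.rslice \<phi> (lact (AA.ml c) (T3 a d)) = AA.rslice \<phi> (ract (T2 c a) (AA.ml d))" by simp
  then show "AA.rslice \<phi> (T2 c a) * d = sA (\<phi> a) c * d"
    by (simp add: AA.rslice_ml[OF phi_lin] phi_T3 A.scale_mult_left A.scale_mult_right)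
qed

text \<open>
  Strong left invariance \<open>S((\<iota> \<otimes> \<phi>)(\<Delta>(a)(1 \<otimes> b))) = (\<iota> \<otimes> \<phi>)((1 \<otimes> a)\<Delta>(b))\<close>. Multiplied by \<open>c\<close> from
  the left both sides are linear in \<open>c \<otimes> a\<close>, and for \<open>(p \<otimes> 1)\<Delta>(q)\<close> in place of \<open>c \<otimes> a\<close> both are
  \<open>\<phi>(q b) p\<close>; such elements fill \<open>A \<otimes> A\<close>.
\<close>

lemma strong_invariance: "S (AA.rslice \<phi> (T1 a b)) = AA.rslice \<phi> (T4 a b)"
proof (rule A.eq_right)
  fix c
  define E where "E = (\<lambda>a. AA.rslice \<phi> (T1 a b))"
  have E: "lin sA sA E"
    unfolding E_def by (rule lin_comp[OF bilin_left[OF bilin_T1] AA.lin_rslice[OF phi_lin]])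
  let ?m = "tensor_lift sAA (\<otimes>) sA (\<lambda>p q. p * S q)"
  note m = AA.lift_simps[OF QA.bilin_Sr]
  have eE: "\<epsilon> (E q) = \<phi> (q * b)" for q
    using AA.functional_rslice[OF characterD(1)[OF QA.counit_character] phi_lin, of "T1 q b"]
    by (simp add: E_def AA.lslice_def QA.counit_T1)
  have "?m (AA.rmap E z) = AA.rslice \<phi> (ract z (\<Delta> b))" for z
  proof (induction z rule: QA.V_induct)
    case (V p q)
    have "AA.rmap E (T2 p q) = T2 p (E q)"
      unfolding E_def using QA.V_rslice[OF phi_lin, of p q b] by simp
    then show ?case by (simp add: QA.antipode_T2 eE QA.V_coact phi_T2)
  qed (simp add: AA.rmap_simps[OF E] m ract_add phi_slice)
  from this[of "c \<otimes> a"] have "c * S (E a) = AA.rslice \<phi> (ract (c \<otimes> a) (\<Delta> b))"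
    by (simp add: AA.rmap_simps[OF E] m)
  also have "ract (c \<otimes> a) (\<Delta> b) = lact (AA.ml c) (T4 a b)"
    by (rule AA.T.mult_of_inj)
      (simp add: mult_of_T mult.assoc flip: mult_mult_of mult_of_mult AA.ml_mr(1))
  finally show "c * S (AA.rslice \<phi> (T1 a b)) = c * AA.rslice \<phi> (T4 a b)"
    by (simp add: AA.rslice_ml[OF phi_lin] E_def)
qed

text \<open>
  The elements \<open>a\<close> with \<open>\<phi>(b a) = 0\<close> for all \<open>b\<close>: by strong invariance \<open>\<Delta>(a)(c \<otimes> 1)\<close> has its right
  legs in the same space, so that applying \<open>\<phi>\<close> to \<open>S(c) S(a\<^sub>1) a\<^sub>2 = \<epsilon>(a) S(c)\<close> gives \<open>\<epsilon>(a) = 0\<close>. Applied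
  to these right legs, this gives \<open>a c = 0\<close>.
\<close>

lemma integral_faithful:
  assumes N: "\<And>b. \<phi> (b * a) = 0"
  shows "a = 0"
proof -
  have slices: "\<phi> (b * AA.lslice f (T3 a c)) = 0"
    if N: "\<And>b. \<phi> (b * a) = 0" and f: "lin sA (*) f" for a b c f
  proof -
    have "AA.rslice \<phi> (T1 b a) = 0"
    proof (rule A.eq_right)
      fix c
      have "(\<lambda>q. \<phi> (q * a)) = (\<lambda>q. 0 * \<phi> q)" by (simp add: N)
      then have "AA.rslice \<phi> (ract (T2 c b) (AA.mr a)) = 0"
        by (simp add: AA.rslice_mr[OF phi_lin] AA.rslice_scaled[OF phi_lin] del: mult_zero_left)
      then show "c * AA.rslice \<phi> (T1 b a) = c * 0"
        by (simp add: AA.rslice_ml[OF phi_lin] flip: QA.T1_ml)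
    qed
    then have "AA.rslice \<phi> (T4 b a) = 0"
      using strong_invariance[of b a] by (simp add: lin_simps[OF QA.lin_S])
    moreover have "lact (AA.mr b) (T3 a c) = ract (T4 b a) (AA.ml c)"
      by (rule AA.T.mult_of_inj) (simp add: mult.assoc mult_of_T flip: mult_mult_of mult_of_mult)
    then have "AA.rslice \<phi> (lact (AA.mr b) (T3 a c)) = AA.rslice \<phi> (ract (T4 b a) (AA.ml c))" by simp
    ultimately have "AA.rslice (\<lambda>n. \<phi> (b * n)) (T3 a c) = 0"
      by (simp add: AA.rslice_ml[OF phi_lin] AA.rslice_mr[OF phi_lin])
    then show ?thesis
      using AA.functional_rslice[OF f phi_mult_left[of b], of "T3 a c"] by (simp add: lin_simps[OF f])
  qed
  have counit: "\<epsilon> a = 0" if N: "\<And>b. \<phi> (b * a) = 0" for a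
  proof -
    obtain d where "\<phi> d \<noteq> 0" using integral_nonzero by blast
    moreover obtain c where "d = S c" using QA.bij_S by (metis bij_pointE)
    ultimately have c: "\<phi> (S c) \<noteq> 0" by simp
    obtain F f where F: "\<And>b. b \<in> F \<Longrightarrow> lin sA (*) (f b)"
      "T3 a c = (\<Sum>b\<in>F. b \<otimes> AA.lslice (f b) (T3 a c))"
      using AA.tensor_slice_expansion[of "T3 a c"] by metis
    let ?m = "tensor_lift sAA (\<otimes>) sA (\<lambda>p q. S p * q)"
    have "sA (\<epsilon> a) (S c) = ?m (\<Sum>b\<in>F. b \<otimes> AA.lslice (f b) (T3 a c))"
      using QA.antipode_T3[of a c] F(2) by simp
    also have "\<phi> \<dots> = 0"
      by (simp add: AA.lift_simps[OF QA.bilin_Sl] phi_simps slices[OF N F(1)])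
    finally show ?thesis using c by (simp add: phi_simps)
  qed
  have "a * c = 0" for c
  proof (rule A.functionals_separate)
    fix f assume f: "lin sA (*) f"
    have "\<epsilon> (AA.lslice f (T3 a c)) = 0" by (rule counit) (rule slices[OF N f])
    then show "f (a * c) = 0"
      using AA.functional_rslice[OF f characterD(1)[OF QA.counit_character], of "T3 a c"]
      by (simp add: QA.character_W[OF QA.counit_character] QA.RA_counit)
  qed
  then show "a = 0" by (rule A.nondegenerate_left)
qed

lemma phi_rslice_separates:
  assumes "\<And>b. AA.rslice (\<lambda>n. \<phi> (b * n)) s = AA.rslice (\<lambda>n. \<phi> (b * n)) t"
  shows "s = t"
proof (rule AA.lslice_eqI)
  fix f assume f: "lin sA (*) f"
  have "\<phi> (b * (AA.lslice f s - AA.lslice f t)) = 0" for b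
    using AA.functional_rslice[OF f phi_mult_left[of b], of s]
      AA.functional_rslice[OF f phi_mult_left[of b], of t] assms[of b]
    by (simp add: right_diff_distrib phi_simps)
  then show "AA.lslice f s = AA.lslice f t"
    using integral_faithful[of "AA.lslice f s - AA.lslice f t"] by simp
qed

text \<open>The modular property on the second leg of \<open>\<Delta>(b)\<close>: \<open>b\<^sub>1 \<phi>(a b\<^sub>2) = b\<^sub>1 \<phi>(b\<^sub>2 \<sigma>(a))\<close>.\<close>

lemma phi_T4_sigma: "AA.rslice \<phi> (T4 a b) = AA.rslice \<phi> (T1 b (\<sigma> a))"
proof (rule A.eq_right)
  fix c
  have "lact (AA.ml c) (T4 a b) = lact (AA.mr a) (T2 c b)"
    by (rule AA.T.mult_of_inj) (simp add: mult_of_T flip: mult_mult_of mult.assoc AA.mr_ml)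
  then have "AA.rslice \<phi> (lact (AA.ml c) (T4 a b)) = AA.rslice (\<lambda>q. \<phi> (a * q)) (T2 c b)"
    by (simp add: AA.rslice_mr[OF phi_lin])
  also have "\<dots> = AA.rslice \<phi> (lact (AA.ml c) (T1 b (\<sigma> a)))"
    by (simp add: QA.T1_ml AA.rslice_mr[OF phi_lin] phi_sigma[of a])
  finally show "c * AA.rslice \<phi> (T4 a b) = c * AA.rslice \<phi> (T1 b (\<sigma> a))"
    by (simp add: AA.rslice_ml[OF phi_lin])
qed

definition "SS_sigma = tensor_lift sAA (\<otimes>) sAA (\<lambda>p q. S (S p) \<otimes> \<sigma> q)"

lemmas SS_sigma_simps = AA.lift_simps[OF bilin_comp2[OF AA.bilin_tensor
      lin_comp[OF QA.lin_S QA.lin_S] sigma_lin], folded SS_sigma_def]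

lemma rslice_SS_sigma:
  assumes g: "lin sA (*) g"
  shows "AA.rslice g (SS_sigma z) = S (S (AA.rslice (\<lambda>q. g (\<sigma> q)) z))"
  by (rule AA.additive_eq[of _ _ z])
    (simp_all add: SS_sigma_simps AA.rslice_simps[OF g] AA.rslice_simps[OF lin_comp[OF sigma_lin g]]
      lin_simps[OF QA.lin_S])

text \<open>
  \<open>\<Delta> \<sigma> = (S\<^sup>2 \<otimes> \<sigma>) \<Delta>\<close>: the slice of either side by \<open>\<phi>(b _)\<close> is \<open>S\<^sup>2(a\<^sub>1) \<phi>(a\<^sub>2 b)\<close>, by two uses of strong
  invariance for the left-hand side, and \<open>\<phi>\<close> is faithful.
\<close>

lemma Delta_sigma: "T3 (\<sigma> a) (S (S c)) = SS_sigma (T3 a c)"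
proof (rule phi_rslice_separates)
  fix b
  have "lact (AA.mr b) (T3 (\<sigma> a) (S (S c))) = ract (T4 b (\<sigma> a)) (AA.ml (S (S c)))"
    by (rule AA.T.mult_of_inj) (simp add: mult.assoc mult_of_T flip: mult_mult_of mult_of_mult)
  then have "AA.rslice \<phi> (lact (AA.mr b) (T3 (\<sigma> a) (S (S c))))
      = AA.rslice \<phi> (ract (T4 b (\<sigma> a)) (AA.ml (S (S c))))" by simp
  then have "AA.rslice (\<lambda>n. \<phi> (b * n)) (T3 (\<sigma> a) (S (S c))) = AA.rslice \<phi> (T4 b (\<sigma> a)) * S (S c)"
    by (simp add: AA.rslice_mr[OF phi_lin] AA.rslice_ml[OF phi_lin])
  also have "AA.rslice \<phi> (T4 b (\<sigma> a)) = S (AA.rslice \<phi> (T1 b (\<sigma> a)))"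
    by (rule strong_invariance[symmetric])
  also have "AA.rslice \<phi> (T1 b (\<sigma> a)) = S (AA.rslice \<phi> (T1 a b))"
    by (simp only: phi_T4_sigma[symmetric] strong_invariance)
  also have "S (S (AA.rslice \<phi> (T1 a b))) * S (S c) = S (S (AA.rslice \<phi> (ract (T1 a b) (AA.ml c))))"
    by (simp add: QA.S_mult AA.rslice_ml[OF phi_lin])
  also have "ract (T1 a b) (AA.ml c) = ract (T3 a c) (AA.mr b)"
    by (rule AA.T.mult_of_inj) (simp add: mult.assoc mult_of_T AA.mr_ml flip: mult_of_mult)
  also have "AA.rslice \<phi> (ract (T3 a c) (AA.mr b)) = AA.rslice (\<lambda>q. \<phi> (b * \<sigma> q)) (T3 a c)"
    by (simp add: AA.rslice_mr[OF phi_lin] phi_sigma[of _ b])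
  also have "S (S \<dots>) = AA.rslice (\<lambda>n. \<phi> (b * n)) (SS_sigma (T3 a c))"
    by (simp add: rslice_SS_sigma[OF phi_mult_left])
  finally show "AA.rslice (\<lambda>n. \<phi> (b * n)) (T3 (\<sigma> a) (S (S c)))
      = AA.rslice (\<lambda>n. \<phi> (b * n)) (SS_sigma (T3 a c))" .
qed

lemma character_sigma:
  assumes g: "character sA g"
  shows "character sA (\<lambda>a. g (\<sigma> a))"
proof -
  obtain b where "g b = 1" using characterD(3)[OF g] by blast
  moreover obtain a where "b = \<sigma> a" using sigma_bij by (metis bij_pointE)
  ultimately show ?thesis
    using lin_comp[OF sigma_lin characterD(1)[OF g]]
    by (auto simp: character_def sigma_mult characterD(2)[OF g])
qed

lemma RA_sigma:
  assumes g: "character sA g"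
  shows "QA.RA g (\<sigma> a) = S (S (QA.RA (\<lambda>a. g (\<sigma> a)) a))"
proof (rule A.eq_left)
  fix d
  obtain c' where "d = S c'" using QA.bij_S by (metis bij_pointE)
  moreover obtain c where "c' = S c" using QA.bij_S by (metis bij_pointE)
  ultimately have d: "d = S (S c)" by simp
  have "QA.RA g (\<sigma> a) * d = AA.rslice g (SS_sigma (T3 a c))"
    by (simp add: d flip: Delta_sigma QA.character_W[OF g])
  then show "QA.RA g (\<sigma> a) * d = S (S (QA.RA (\<lambda>a. g (\<sigma> a)) a)) * d"
    by (simp add: rslice_SS_sigma[OF characterD(1)[OF g]] QA.character_W[OF character_sigma[OF g]]
        QA.S_mult d)
qed

definition "\<chi> = \<epsilon> \<circ> inv \<sigma>"

lemma chi_sigma: "\<chi> (\<sigma> a) = \<epsilon> a"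
  using sigma_bij by (simp add: \<chi>_def bij_is_inj)

lemma chi_character: "character sA \<chi>"
proof -
  have inv_mult: "inv \<sigma> (a * b) = inv \<sigma> a * inv \<sigma> b" for a b
    using sigma_mult[of "inv \<sigma> a" "inv \<sigma> b"] sigma_bij
    by (metis bij_inv_eq_iff)
  have "lin sA (*) \<chi>"
    unfolding \<chi>_def comp_def
    by (rule lin_comp[OF lin_inv[OF sigma_lin sigma_bij] characterD(1)[OF QA.counit_character]])
  moreover obtain a where "\<epsilon> a = 1" using characterD(3)[OF QA.counit_character] by blast
  then have "\<chi> (\<sigma> a) = 1" by (simp add: chi_sigma)
  ultimately show ?thesis
    by (auto simp: character_def \<chi>_def inv_mult characterD(2)[OF QA.counit_character])
qed

text \<open>
  Translation by \<open>\<chi> = \<epsilon> \<sigma>\<inverse>\<close> is \<open>S\<^sup>2 \<sigma>\<inverse>\<close>, and it is also \<open>\<sigma>\<inverse> S\<^sup>2\<close>, because \<open>\<epsilon> \<sigma>\<close> is the convolution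
  inverse of \<open>\<chi>\<close>.
\<close>

lemma RA_chi_sigma: "QA.RA \<chi> (\<sigma> a) = S (S a)"
  using RA_sigma[OF chi_character, of a] by (simp add: chi_sigma QA.RA_counit)

lemma sigma_RA_chi: "\<sigma> (QA.RA \<chi> a) = S (S a)"
proof -
  let ?\<psi> = "\<lambda>a. \<epsilon> (\<sigma> a)"
  have \<psi>: "character sA ?\<psi>" by (rule character_sigma[OF QA.counit_character])
  have inverse: "?\<psi> (QA.RA \<chi> a) = \<epsilon> a" for a
  proof -
    obtain b where "a = \<sigma> b" using sigma_bij by (metis bij_pointE)
    then show ?thesis by (simp add: RA_chi_sigma character_SS[OF \<psi>])
  qed
  have "\<sigma> (QA.RA \<chi> a) = S (S (QA.RA ?\<psi> (QA.RA \<chi> a)))"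
    using RA_sigma[OF QA.counit_character, of "QA.RA \<chi> a"] by (simp add: QA.RA_counit)
  also have "QA.RA ?\<psi> (QA.RA \<chi> a) = a"
    using QA.translate_translate[OF \<psi> chi_character] QA.counit_character
    by (simp add: inverse QA.RA_counit)
  finally show ?thesis .
qed

end


section \<open>Galois objects\<close>

text \<open>
  An extended automorphism may be evaluated on covered multipliers, where \<open>n\<close> is the image of the
  covering multiplier \<open>k\<close>.
\<close>

lemma (in nondegenerate_algebra) mult_extend_automorphism_times:
  fixes h :: "'a \<Rightarrow> 'a"
  assumes h: "bij h" "\<And>a b. h (a * b) = h a * h b"
    and n: "\<And>s. lact n (h s) = h (lact k s)" and z: "m * k = mult_of z"
  shows "mult_extend (\<lambda>z. mult_of (h z)) m * n = mult_of (h z)"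
proof (rule multiplier_eq_lact)
  fix t
  obtain s where t: "t = h s" using h(1) by (metis bij_pointE)
  have "lact (mult_extend (\<lambda>z. mult_of (h z)) m) (h s) = h (lact m s)" for s
    using h(1) by (simp add: mult_extend_automorphism[OF h] bij_is_inj)
  moreover have "lact m (lact k s) = z * s"
    using arg_cong[OF z, of "\<lambda>m. lact m s"] by (simp add: multiplier_acts)
  ultimately show "lact (mult_extend (\<lambda>z. mult_of (h z)) m * n) t = lact (mult_of (h z)) t"
    by (simp add: multiplier_acts t n h(2))
qed

locale galois_setup =
  quantum_group_setup sA sAA tAA sAAA tAA_A tA_AA \<Delta> \<phi> \<epsilon> S \<sigma> +
  coaction_setup sA sAA tAA sAAA tAA_A tA_AA \<Delta> sX sXA tXA sXAA tXA_A tX_AA \<alpha> sXX tXX \<epsilon> S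
  for sA :: "'k::field \<Rightarrow> 'a::ring \<Rightarrow> 'a"
    and sAA :: "'k \<Rightarrow> 'aa::ring \<Rightarrow> 'aa"
    and tAA :: "'a \<Rightarrow> 'a \<Rightarrow> 'aa"
    and sAAA :: "'k \<Rightarrow> 'aaa::ring \<Rightarrow> 'aaa"
    and tAA_A :: "'aa \<Rightarrow> 'a \<Rightarrow> 'aaa"
    and tA_AA :: "'a \<Rightarrow> 'aa \<Rightarrow> 'aaa"
    and \<Delta> :: "'a \<Rightarrow> 'aa multiplier" and \<phi> :: "'a \<Rightarrow> 'k" and \<epsilon> :: "'a \<Rightarrow> 'k"
    and S :: "'a \<Rightarrow> 'a" and \<sigma> :: "'a \<Rightarrow> 'a"
    and sX :: "'k \<Rightarrow> 'x::ring \<Rightarrow> 'x"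
    and sXA :: "'k \<Rightarrow> 'xa::ring \<Rightarrow> 'xa"
    and tXA :: "'x \<Rightarrow> 'a \<Rightarrow> 'xa" (infixl "\<otimes>" 75)
    and sXAA :: "'k \<Rightarrow> 'xaa::ring \<Rightarrow> 'xaa"
    and tXA_A :: "'xa \<Rightarrow> 'a \<Rightarrow> 'xaa" (infixl "\<otimes>\<^sub>r" 75)
    and tX_AA :: "'x \<Rightarrow> 'aa \<Rightarrow> 'xaa" (infixl "\<otimes>\<^sub>l" 75)
    and \<alpha> :: "'x \<Rightarrow> 'xa multiplier"
    and sXX :: "'k \<Rightarrow> 'xx::ring \<Rightarrow> 'xx"
    and tXX :: "'x \<Rightarrow> 'x \<Rightarrow> 'xx" (infixl "\<otimes>\<^sub>X" 75) +
  fixes \<beta> :: "'a \<Rightarrow> 'xx multiplier" and \<phi>X :: "'x \<Rightarrow> 'k" and \<sigma>X :: "'x \<Rightarrow> 'x"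
  assumes beta: "is_beta sXA (\<otimes>) sXX (\<otimes>\<^sub>X) \<alpha> S \<beta>"
    and phi_X: "is_phi_X sX sXA (\<otimes>) \<alpha> \<phi> \<phi>X"
    and sigma_X: "is_sigma_X sX \<phi>X \<sigma>X"
begin

subsection \<open>The map \<open>W\<close> and the functional on \<open>X\<close>\<close>

definition "W_lift = tensor_lift sXX (\<otimes>\<^sub>X) sXA W"

lemmas W_lift_simps = XX.lift_simps[OF bilin_W, folded W_lift_def]
lemmas lin_W_lift = XX.lin_lift[OF bilin_W, folded W_lift_def]

lemma W_lift_eq: "W_lift z = G (V_lift z)"
  by (rule XX.additive_eq[of _ _ z]) (simp_all add: W_lift_simps V_lift_simps G_simps W_eq_G_V)

lemma mult_of_W_lift: "mult_of (W_lift z) = galois_W sXA (\<otimes>) sXX (\<otimes>\<^sub>X) \<alpha> z"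
proof -
  have "galois_W sXA (\<otimes>) sXX (\<otimes>\<^sub>X) \<alpha> = (\<lambda>z. mult_of (W_lift z))"
    unfolding galois_W_def
    by (rule XX.lift_unique[OF lin_comp[OF lin_W_lift XA.T.lin_mult_of]])
      (simp add: W_lift_simps mult_of_W)
  then show ?thesis by simp
qed

lemma ml_beta:
  obtains z where "XX.ml x * \<beta> a = mult_of z" "V_lift z = x \<otimes> a"
proof -
  obtain z where z: "XX.ml x * \<beta> a = mult_of z" "galois_V sXA (\<otimes>) sXX (\<otimes>\<^sub>X) \<alpha> z = mult_of (x \<otimes> a)"
    using beta unfolding is_beta_def by blast
  then have "V_lift z = x \<otimes> a" by (simp flip: mult_of_V_lift)
  with z(1) show ?thesis by (rule that)
qed

lemma beta_mr:
  obtains z where "\<beta> a * XX.mr y = mult_of z" "W_lift z = y \<otimes> S a"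
proof -
  obtain z where z: "\<beta> a * XX.mr y = mult_of z" "galois_W sXA (\<otimes>) sXX (\<otimes>\<^sub>X) \<alpha> z = mult_of (y \<otimes> S a)"
    using beta unfolding is_beta_def by blast
  then have "W_lift z = y \<otimes> S a" by (simp flip: mult_of_W_lift)
  with z(1) show ?thesis by (rule that)
qed

lemma W_induct [case_names W add]:
  assumes "\<And>x y. Pr (W x y)" "\<And>s t. Pr s \<Longrightarrow> Pr t \<Longrightarrow> Pr (s + t)"
  shows "Pr t"
proof (induction t rule: XA.tensor_induct)
  case (tensor x a)
  obtain b where "a = S b" using bij_S by (metis bij_pointE)
  then obtain z where z: "x \<otimes> a = W_lift z" using beta_mr by metis
  have "Pr (W_lift z)"
    by (induction z rule: XX.tensor_induct) (simp_all add: W_lift_simps assms)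
  then show ?case by (simp add: z)
qed (rule assms(2))

lemma mult_slice_acts:
  assumes g: "lin sA (*) g"
  shows "lact (mult_slice sX sXA (\<otimes>) g (\<alpha> x)) y = XA.rslice g (W x y)"
proof -
  define n where "n = make_multiplier (\<lambda>y. XA.rslice g (W x y)) (\<lambda>y. XA.rslice g (V y x))"
  have "p * XA.rslice g (W x y) = XA.rslice g (V p x) * y" for p y
    using arg_cong[OF ml_W[of p x y], of "XA.rslice g"] by (simp add: XA.rslice_ml[OF g])
  note pair = X.multiplier_of_pair[of "\<lambda>y. XA.rslice g (W x y)" "\<lambda>y. XA.rslice g (V y x)", OF this]
  have n: "lact n y = XA.rslice g (W x y)" "ract y n = XA.rslice g (V y x)" for y
    unfolding n_def by (fact pair)+
  have "mult_slice sX sXA (\<otimes>) g (\<alpha> x) = n"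
    unfolding mult_slice_def
  proof (rule the_equality)
    show "\<forall>y. lact n y = XA.rslice g (elem (\<alpha> x * XA.ml y)) \<and>
        ract y n = XA.rslice g (elem (XA.ml y * \<alpha> x))"
      by (simp add: n cov_r1_def cov_l1_def)
    fix m
    assume "\<forall>y. lact m y = XA.rslice g (elem (\<alpha> x * XA.ml y)) \<and>
        ract y m = XA.rslice g (elem (XA.ml y * \<alpha> x))"
    then show "m = n" by (intro X.multiplier_eq_lact) (simp add: n cov_r1_def)
  qed
  then show ?thesis by (simp add: n)
qed

lemma phiX_lin: "lin sX (*) \<phi>X"
  using phi_X by (simp add: is_phi_X_def)

lemma phi_W: "XA.rslice \<phi> (W x y) = sX (\<phi>X x) y"
  using phi_X by (simp add: is_phi_X_def flip: mult_slice_acts[OF phi_lin])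

lemma phi_V: "XA.rslice \<phi> (V y x) = sX (\<phi>X x) y"
proof (rule X.eq_left)
  fix p
  show "XA.rslice \<phi> (V y x) * p = sX (\<phi>X x) y * p"
    using arg_cong[OF ml_W[of y x p], of "XA.rslice \<phi>"]
    by (simp add: XA.rslice_ml[OF phi_lin] phi_W X.scale_mult_left X.scale_mult_right)
qed

text \<open>\<open>\<phi>\<^sub>X\<close> is faithful because \<open>\<phi>\<close> is and because the elements \<open>\<alpha>(x)(z \<otimes> 1)\<close> fill \<open>X \<otimes> A\<close>.\<close>

lemma phiX_faithful_right:
  assumes y: "\<And>x. \<phi>X (y * x) = 0"
  shows "y = 0"
proof -
  have zero: "XA.rslice \<phi> (lact (\<alpha> y) t) = 0" for t
  proof (induction t rule: W_induct)
    case (W x z)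
    have "lact (\<alpha> y) (W x z) = W (y * x) z"
      by (rule XA.T.mult_of_inj) (simp add: mult_of_W coact_mult mult.assoc flip: mult_mult_of)
    then show ?case by (simp add: phi_W y)
  qed (simp add: lact_add XA.rslice_simps[OF phi_lin])
  have "lact (\<alpha> y) t = 0" for t
  proof (rule XA.lslice_separates)
    fix f assume f: "lin sX (*) f"
    let ?n = "XA.lslice f (lact (\<alpha> y) t)"
    have "\<phi> (b * \<sigma> ?n) = 0" for b
    proof -
      have "XA.rslice (\<lambda>n. \<phi> (n * b)) (lact (\<alpha> y) t) = 0"
        using zero[of "ract t (XA.mr b)"]
        by (simp add: XA.rslice_mr[OF phi_lin] flip: XA.T.ract_lact)
      then show ?thesis
        using XA.functional_rslice[OF f phi_mult_right[of b], of "lact (\<alpha> y) t"]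
        by (simp add: phi_sigma[of _ b] lin_simps[OF f])
    qed
    then have "\<sigma> ?n = \<sigma> 0"
      by (simp add: integral_faithful lin_simps[OF sigma_lin])
    then show "?n = 0" using sigma_bij by (simp add: bij_is_inj inj_eq)
  qed
  then have "\<alpha> y = \<alpha> 0"
    by (intro XA.T.multiplier_eq_lact) (simp add: lin_simps[OF lin_coact] multiplier_acts)
  then show ?thesis by (rule injD[OF coact_inj])
qed

lemma sigmaX_lin: "lin sX sX \<sigma>X" and sigmaX_mult: "\<sigma>X (x * y) = \<sigma>X x * \<sigma>X y"
  and sigmaX_bij: "bij \<sigma>X" and phiX_sigmaX: "\<phi>X (y * \<sigma>X x) = \<phi>X (x * y)"
  using sigma_X by (simp_all add: is_sigma_X_def algebra_automorphism_def algebra_hom_def)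

lemma phiX_faithful_left:
  assumes "\<And>v. \<phi>X (v * p) = 0"
  shows "p = 0"
proof (rule phiX_faithful_right)
  fix x
  obtain v where "x = \<sigma>X v" using sigmaX_bij by (metis bij_pointE)
  then show "\<phi>X (p * x) = 0" by (simp add: phiX_sigmaX assms)
qed

lemma phiX_mult_left: "lin sX (*) (\<lambda>p. \<phi>X (v * p))"
  by (rule lin_comp[OF bilin_right[OF X.bilin_mult] phiX_lin])

lemma phiX_lslice_separates:
  assumes "\<And>v. XX.lslice (\<lambda>p. \<phi>X (v * p)) s = XX.lslice (\<lambda>p. \<phi>X (v * p)) t"
  shows "s = t"
proof -
  have "s - t = 0"
  proof (rule XX.rslice_separates, rule phiX_faithful_left)
    fix g v assume g: "lin sX (*) g"
    show "\<phi>X (v * XX.rslice g (s - t)) = 0"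
      using XX.functional_rslice[OF phiX_mult_left g, of v "s - t"] assms[of v]
      by (simp add: XX.lslice_simps[OF phiX_mult_left] lin_simps[OF g])
  qed
  then show ?thesis by simp
qed

subsection \<open>The automorphism \<open>\<theta>\<close>\<close>

definition "\<theta> x = \<sigma>X (R \<chi> x)"

lemma theta_X: "theta_X sX sXA (\<otimes>) \<alpha> \<epsilon> \<sigma> \<sigma>X = \<theta>"
proof
  fix x
  have "mult_slice sX sXA (\<otimes>) \<chi> (\<alpha> x) = mult_of (R \<chi> x)"
    by (rule X.multiplier_eq_lact)
      (simp add: mult_slice_acts characterD(1)[OF chi_character] character_W[OF chi_character])
  then show "theta_X sX sXA (\<otimes>) \<alpha> \<epsilon> \<sigma> \<sigma>X x = \<theta> x"
    by (simp add: theta_X_def \<theta>_def \<chi>_def)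
qed

lemma theta_lin: "lin sX sX \<theta>"
  unfolding \<theta>_def by (rule lin_comp[OF lin_R[OF chi_character] sigmaX_lin])

lemma theta_mult: "\<theta> (x * y) = \<theta> x * \<theta> y"
  by (simp add: \<theta>_def translate_mult[OF chi_character] sigmaX_mult)

text \<open>Translation by \<open>\<chi>\<close> is invertible because \<open>\<chi> \<circ> S\<close> is a two-sided convolution inverse of \<open>\<chi>\<close>.\<close>

lemma theta_bij: "bij \<theta>"
proof -
  note chiS = character_S[OF chi_character]
  have "R \<chi> (R (\<lambda>a. \<chi> (S a)) y) = y" "R (\<lambda>a. \<chi> (S a)) (R \<chi> y) = y" for y
    using translate_inverse[OF chi_character] translate_inverse[OF chiS]
    by (simp_all add: character_SS[OF chi_character])
  then have "bij (R \<chi>)" by (intro o_bij[of "R (\<lambda>a. \<chi> (S a))"]) auto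
  then show ?thesis
    unfolding \<theta>_def using bij_comp[OF _ sigmaX_bij] by (simp add: comp_def)
qed

lemma theta_surj: obtains x where "y = \<theta> x"
  using theta_bij by (metis bij_pointE)

subsection \<open>The key identity\<close>

text \<open>
  The aim is \<open>r\<^sub>0 w\<^sub>0 \<phi>(\<kappa>(r\<^sub>1) w\<^sub>1 S(a)) = \<phi>\<^sub>X(\<tau>(y) w) x\<close>, summed over \<open>r \<otimes> a = \<alpha>(x)(y \<otimes> 1)\<close>, where
  \<open>\<tau> = R \<chi>\<close> and \<open>\<alpha>(\<tau>(r)) = r\<^sub>0 \<otimes> \<kappa>(r\<^sub>1)\<close> with \<open>\<kappa> = RA \<chi>\<close>. Since \<open>\<sigma> \<kappa> = S\<^sup>2\<close>, moving \<open>\<kappa>(r\<^sub>1)\<close> around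
  \<open>\<phi>\<close> leaves \<open>\<phi>(w\<^sub>1 S(S(r\<^sub>1) a))\<close>; with \<open>W = G V\<close> the antipode then cancels \<open>S(r\<^sub>1)\<close> against \<open>a\<close>.
\<close>

context
  fixes w :: 'x
begin

definition "K a = XA.rslice \<phi> (P w a)"

lemma lin_K: "lin sA sX K"
  unfolding K_def by (rule lin_comp[OF bilin_right[OF bilin_P] XA.lin_rslice[OF phi_lin]])

definition "KS = tensor_lift sXA (\<otimes>) sX (\<lambda>p a. p * K (S a))"

lemma bilin_KS: "bilin sX sA sX (\<lambda>p a. p * K (S a))"
  by (rule bilin_comp2[OF X.bilin_mult lin_id[OF X.vector_space_axioms] lin_comp[OF lin_S lin_K]])

lemmas KS_simps = XA.lift_simps[OF bilin_KS, folded KS_def]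
lemmas lin_KS = XA.lin_lift[OF bilin_KS, folded KS_def]

text \<open>
  The modular property at work: \<open>p w\<^sub>0 \<phi>(\<kappa>(c) w\<^sub>1 b) = p w\<^sub>0 \<phi>(w\<^sub>1 b S\<^sup>2(c))\<close>, without \<open>b\<close> and with
  \<open>b = S(a)\<close>; in the second case \<open>S(a) S\<^sup>2(c) = S(S(c) a)\<close>.
\<close>

lemma rslice_translate:
  "XA.rslice \<phi> (ract (XA.rmap (RA \<chi>) z) (\<alpha> w)) = KS (XA.rmap S z)"
  "XA.rslice \<phi> (ract (ract (XA.rmap (RA \<chi>) z) (\<alpha> w)) (XA.mr (S a))) =
    KS (ract (XA.rmap S z) (XA.mr a))"
proof -
  note r = XA.rmap_simps[OF lin_RA[OF chi_character]] and s = XA.rmap_simps[OF lin_S]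
  have sigma: "XA.rslice \<phi> (lact (XA.mr (RA \<chi> c)) t) = XA.rslice \<phi> (ract t (XA.mr (S (S c))))" for c t
    by (simp add: XA.rslice_mr[OF phi_lin] phi_sigma[of "RA \<chi> c"] sigma_RA_chi)
  show "XA.rslice \<phi> (ract (XA.rmap (RA \<chi>) z) (\<alpha> w)) = KS (XA.rmap S z)"
    by (rule XA.additive_eq[of _ _ z])
      (simp_all add: r s ract_add XA.rslice_simps[OF phi_lin] KS_simps tensor_coact sigma V_mr
        XA.rslice_ml[OF phi_lin] K_def)
  show "XA.rslice \<phi> (ract (ract (XA.rmap (RA \<chi>) z) (\<alpha> w)) (XA.mr (S a))) =
      KS (ract (XA.rmap S z) (XA.mr a))"
    by (rule XA.additive_eq[of _ _ z])
      (simp_all add: r s ract_add XA.rslice_simps[OF phi_lin] KS_simps tensor_coact XA.T.ract_lact sigma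
        V_mr lin_simps[OF XA.T.lin_ract] XA.mten_acts multiplier_acts
        XA.rslice_ml[OF phi_lin] XA.rslice_mr P_mr S_mult K_def)
qed

end

lemma phiX_translate: "sX (\<phi>X (R \<chi> y * w)) x = KS w (XA.rmap S (V x y))"
proof -
  have "V x (R \<chi> y * w) = ract (XA.rmap (RA \<chi>) (V x y)) (\<alpha> w)"
    by (simp add: V_coact flip: V_translate[OF chi_character])
  then show ?thesis by (simp add: rslice_translate flip: phi_V)
qed

lemma K_translate: "x * K (R \<chi> r * w) (S a) = KS w (ract (XA.rmap S (V x r)) (XA.mr a))"
  by (simp add: K_def V_mr V_coact XA.rslice_ml[OF phi_lin]
      flip: rslice_translate V_translate[OF chi_character])

definition "KR w = tensor_lift sXA (\<otimes>) sX (\<lambda>r a. K (R \<chi> r * w) (S a))"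

lemma bilin_K: "bilin sX sA sX K"
  unfolding K_def by (rule bilin_comp[OF bilin_P XA.lin_rslice[OF phi_lin]])

lemma bilin_KR: "bilin sX sA sX (\<lambda>r a. K (R \<chi> r * w) (S a))"
  by (rule bilin_comp2[OF bilin_K lin_comp[OF lin_R[OF chi_character]
        bilin_left[OF X.bilin_mult]] lin_S])

lemmas KR_simps = XA.lift_simps[OF bilin_KR, folded KR_def]

text \<open>Here \<open>S(q\<^sub>1) q\<^sub>2\<close> cancels.\<close>

lemma KR_P: "KR w (P q b) = KS w (q \<otimes> b)"
proof (rule X.eq_right)
  fix x
  have b: "bilin sX sA sXA (\<lambda>y b. ract (XA.rmap S (V x y)) (XA.mr b))"
    by (rule bilin_comp2[OF XA.T.bilin_ract
          lin_comp[OF bilin_right[OF bilin_V] XA.lin_rmap[OF lin_S]] XA.lin_mr])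
  have "x * KR w z = tensor_lift sXA (\<otimes>) sX (\<lambda>r a. x * K (R \<chi> r * w) (S a)) z" for z
    unfolding KR_def by (rule XA.lift_comp[OF bilin_KR bilin_right[OF X.bilin_mult]])
  also have "\<dots> z = KS w (tensor_lift sXA (\<otimes>) sXA (\<lambda>y b. ract (XA.rmap S (V x y)) (XA.mr b)) z)" for z
    by (simp add: K_translate XA.lift_comp[OF b lin_KS])
  finally show "x * KR w (P q b) = x * KS w (q \<otimes> b)"
    by (simp add: antipode_P KS_simps mult.assoc)
qed

lemma KR_W: "KR w (W x y) = sX (\<phi>X (R \<chi> y * w)) x"
proof -
  have "KR w (G z) = KS w (XA.rmap S z)" for z
    by (rule XA.additive_eq[of _ _ z])
      (simp_all add: G_simps KR_simps XA.rmap_simps[OF lin_S] KS_simps KR_P)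
  then show ?thesis by (simp add: W_eq_G_V phiX_translate)
qed

subsection \<open>The map \<open>\<beta>\<close>\<close>

definition "V_inv = inv V_lift"

lemma V_lift_bij: "bij V_lift"
  using V_lift_inj V_lift_surj by (metis bijI injI surjI)

lemma lin_V_inv: "lin sXA sXX V_inv"
  unfolding V_inv_def by (rule lin_inv[OF lin_V_lift V_lift_bij])

lemma V_inv: "V_inv t = z \<longleftrightarrow> V_lift z = t"
  unfolding V_inv_def using V_lift_bij by (metis bij_inv_eq_iff)

lemma ml_beta_V_inv: "XX.ml x * \<beta> a = mult_of (V_inv (x \<otimes> a))"
  using ml_beta[of x a] by (metis V_inv)

lemma lin_beta: "lin sA (mult_scale sXX) \<beta>"
proof (rule linI[OF A.vector_space_axioms XX.T.vector_space_multiplier]; rule XX.ml_cancel)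
  fix a b c x
  show "XX.ml x * \<beta> (a + b) = XX.ml x * (\<beta> a + \<beta> b)"
    by (simp add: distrib_left ml_beta_V_inv XA.tensor_right lin_simps[OF lin_V_inv]
        XX.T.mult_of_linear)
  show "XX.ml x * \<beta> (sA c a) = XX.ml x * mult_scale sXX c (\<beta> a)"
    by (simp add: XX.T.times_mult_scale ml_beta_V_inv XA.tensor_right lin_simps[OF lin_V_inv]
        XX.T.mult_of_linear)
qed

lemma ml_V_inv: "lact (XX.ml v) (V_inv (x \<otimes> a)) = V_inv ((v * x) \<otimes> a)"
  by (rule XX.T.mult_of_inj)
    (simp flip: mult_mult_of ml_beta_V_inv XX.ml_times mult.assoc)

text \<open>\<open>\<phi>\<^sub>X(w a\<^sup>1 \<sigma>\<^sub>X(p)) a\<^sup>2 = p\<^sub>0 w\<^sub>0 \<phi>(p\<^sub>1 w\<^sub>1 S(a))\<close>, since \<open>\<phi>\<^sub>X \<otimes> \<iota> = (\<iota> \<otimes> \<phi>) W\<close> and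
  \<open>W V\<inverse>\<close> is \<open>x \<otimes> a \<mapsto> \<alpha>(x)(1 \<otimes> S(a))\<close>.\<close>

lemma phiX_beta: "XX.lslice \<phi>X (ract (V_inv (w \<otimes> a)) (XX.ml (\<sigma>X p))) = K (p * w) (S a)"
proof -
  note l = XX.lslice_simps[OF phiX_lin]
  have 1: "XX.lslice \<phi>X (ract z (XX.ml (\<sigma>X p))) = XX.lslice \<phi>X (lact (XX.ml p) z)" for z
    by (rule XX.additive_eq[of _ _ z])
      (simp_all add: ract_add lact_add l XX.mten_acts multiplier_acts phiX_sigmaX)
  have 2: "XX.lslice \<phi>X z = XA.rslice \<phi> (W_lift z)" for z
    by (rule XX.additive_eq[of _ _ z])
      (simp_all add: l W_lift_simps XA.rslice_simps[OF phi_lin] phi_W)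
  have "V_lift (V_inv t) = t" for t using V_inv by blast
  then show ?thesis
    by (simp only: 1) (simp add: 2 ml_V_inv W_lift_eq G_simps K_def)
qed

definition "theta_id = tensor_lift sXA (\<otimes>) sXA (\<lambda>p a. \<theta> p \<otimes> a)"

lemma bilin_theta_id: "bilin sX sA sXA (\<lambda>p a. \<theta> p \<otimes> a)"
  by (rule bilin_comp2[OF XA.bilin_tensor theta_lin lin_id[OF A.vector_space_axioms]])

lemmas theta_id_simps = XA.lift_simps[OF bilin_theta_id, folded theta_id_def]

definition "beta_ml = tensor_lift sXA (\<otimes>) (mult_scale sXX) (\<lambda>p a. \<beta> a * XX.ml p)"

lemma bilin_beta_ml: "bilin sX sA (mult_scale sXX) (\<lambda>p a. \<beta> a * XX.ml p)"
  by (rule bilin_comp2[OF bilin_swap[OF XX.T.bilin_times] XX.lin_ml lin_beta])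

lemmas beta_ml_simps = XA.lift_simps[OF bilin_beta_ml, folded beta_ml_def]

text \<open>
  This is \<open>x\<^sub>1\<^sup>1 \<theta>(x\<^sub>0) \<theta>(y) \<otimes> x\<^sub>1\<^sup>2 = \<theta>(y) \<otimes> x\<close>, where \<open>\<beta>(a) = a\<^sup>1 \<otimes> a\<^sup>2\<close>. After multiplication by \<open>w \<otimes> 1\<close>
  from the left both sides lie in \<open>X \<otimes> X\<close>, and their slices by \<open>\<phi>\<^sub>X(v _)\<close> are the two sides of the
  key identity for \<open>v w\<close>.
\<close>

lemma beta_ml_theta: "beta_ml (theta_id (W x y)) = mult_of (\<theta> y \<otimes>\<^sub>X x)"
proof (rule XX.ml_cancel)
  fix w
  define M where "M w = tensor_lift sXA (\<otimes>) sXX (\<lambda>r a. ract (V_inv (w \<otimes> a)) (XX.ml (\<theta> r)))" for w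
  have "bilin sX sA sXX (\<lambda>r a. ract (V_inv (w \<otimes> a)) (XX.ml (\<theta> r)))" for w
    by (rule bilin_comp2[OF bilin_swap[OF XX.T.bilin_ract] lin_comp[OF theta_lin XX.lin_ml]
          lin_comp[OF bilin_right[OF XA.bilin_tensor] lin_V_inv]])
  note M = XA.lift_simps[OF this, folded M_def]
  have ml_M: "lact (XX.ml v) (M w t) = M (v * w) t" for v w t
    by (rule XA.additive_eq[of _ _ t])
      (simp_all add: M lact_add ml_V_inv flip: XX.T.ract_lact)
  have phi_M: "XX.lslice \<phi>X (M w t) = KR w t" for w t
    by (rule XA.additive_eq[of _ _ t])
      (simp_all add: M KR_simps XX.lslice_simps[OF phiX_lin] phiX_beta \<theta>_def)
  have "M w (W x y) = (w * \<theta> y) \<otimes>\<^sub>X x"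
  proof (rule phiX_lslice_separates)
    fix v
    have "XX.lslice (\<lambda>p. \<phi>X (v * p)) z = XX.lslice \<phi>X (lact (XX.ml v) z)" for z
      by (rule XX.additive_eq[of _ _ z])
        (simp_all add: XX.lslice_simps[OF phiX_lin] XX.lslice_simps[OF phiX_mult_left] lact_add
          XX.mten_acts multiplier_acts)
    then show "XX.lslice (\<lambda>p. \<phi>X (v * p)) (M w (W x y)) =
        XX.lslice (\<lambda>p. \<phi>X (v * p)) ((w * \<theta> y) \<otimes>\<^sub>X x)"
      by (simp add: ml_M phi_M KR_W XX.mten_acts multiplier_acts XX.lslice_simps[OF phiX_lin]
          \<theta>_def phiX_sigmaX flip: mult.assoc)
  qed
  moreover have "XX.ml w * beta_ml (theta_id t) = mult_of (M w t)" for t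
    by (rule XA.additive_eq[of _ _ t])
      (simp_all add: theta_id_simps beta_ml_simps M distrib_left XX.T.mult_of_linear ml_beta_V_inv
        mult_of_mult flip: mult.assoc)
  ultimately show "XX.ml w * beta_ml (theta_id (W x y)) = XX.ml w * mult_of (\<theta> y \<otimes>\<^sub>X x)"
    by (simp add: mult_mult_of XX.mten_acts multiplier_acts)
qed

definition "flip = tensor_lift sXX (\<otimes>\<^sub>X) sXX (\<lambda>p q. \<theta> q \<otimes>\<^sub>X p)"

lemma bilin_flip: "bilin sX sX sXX (\<lambda>p q. \<theta> q \<otimes>\<^sub>X p)"
  by (rule bilin_swap, rule bilin_comp2[OF XX.bilin_tensor theta_lin lin_id[OF X.vector_space_axioms]])

lemmas flip_simps = XX.lift_simps[OF bilin_flip, folded flip_def]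

lemma flip_mult: "flip (s * t) = flip s * flip t"
proof -
  have "flip ((x \<otimes>\<^sub>X y) * t) = flip (x \<otimes>\<^sub>X y) * flip t" for x y
    by (rule XX.additive_eq[of _ _ t])
      (simp_all add: flip_simps distrib_left XX.tensor_mult theta_mult)
  then show ?thesis
    by (intro XX.additive_eq[of "\<lambda>s. flip (s * t)" "\<lambda>s. flip s * flip t" s])
      (simp_all add: flip_simps distrib_right)
qed

lemma inv_theta: "inv \<theta> (\<theta> x) = x" "\<theta> (inv \<theta> x) = x"
  using theta_bij by (simp_all add: bij_is_inj bij_is_surj surj_f_inv_f)

lemma flip_bij: "bij flip"
proof -
  have "bilin sX sX sXX (\<lambda>p q. q \<otimes>\<^sub>X inv \<theta> p)"
    by (rule bilin_swap, rule bilin_comp2[OF XX.bilin_tensor lin_id[OF X.vector_space_axioms]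
          lin_inv[OF theta_lin theta_bij]])
  note g = XX.lift_simps[OF this]
  let ?g = "tensor_lift sXX (\<otimes>\<^sub>X) sXX (\<lambda>p q. q \<otimes>\<^sub>X inv \<theta> p)"
  have "?g (flip z) = z" for z
    by (rule XX.additive_eq[of "\<lambda>z. ?g (flip z)" "\<lambda>z. z"]) (simp_all add: g flip_simps inv_theta)
  moreover have "flip (?g z) = z" for z
    by (rule XX.additive_eq[of "\<lambda>z. flip (?g z)" "\<lambda>z. z"]) (simp_all add: g flip_simps inv_theta)
  ultimately show ?thesis by (intro o_bij[of ?g]) auto
qed

lemma theta_id_mult: "theta_id (s * t) = theta_id s * theta_id t"
proof -
  have "theta_id ((x \<otimes> y) * t) = theta_id (x \<otimes> y) * theta_id t" for x y
    by (rule XA.additive_eq[of _ _ t])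
      (simp_all add: theta_id_simps distrib_left XA.tensor_mult theta_mult)
  then show ?thesis
    by (intro XA.additive_eq[of "\<lambda>s. theta_id (s * t)" "\<lambda>s. theta_id s * theta_id t" s])
      (simp_all add: theta_id_simps distrib_right)
qed

lemma theta_id_bij: "bij theta_id"
proof -
  have "bilin sX sA sXA (\<lambda>p q. inv \<theta> p \<otimes> q)"
    by (rule bilin_comp2[OF XA.bilin_tensor lin_inv[OF theta_lin theta_bij]
          lin_id[OF A.vector_space_axioms]])
  note g = XA.lift_simps[OF this]
  let ?g = "tensor_lift sXA (\<otimes>) sXA (\<lambda>p q. inv \<theta> p \<otimes> q)"
  have "?g (theta_id z) = z" for z
    by (rule XA.additive_eq[of "\<lambda>z. ?g (theta_id z)" "\<lambda>z. z"])
      (simp_all add: g theta_id_simps inv_theta)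
  moreover have "theta_id (?g z) = z" for z
    by (rule XA.additive_eq[of "\<lambda>z. theta_id (?g z)" "\<lambda>z. z"])
      (simp_all add: g theta_id_simps inv_theta)
  ultimately show ?thesis by (intro o_bij[of ?g]) auto
qed

lemma flip_mr: "lact (XX.ml (\<theta> y)) (flip s) = flip (lact (XX.mr y) s)"
  by (rule XX.additive_eq[of _ _ s])
    (simp_all add: flip_simps lact_add XX.mten_acts multiplier_acts theta_mult)

text \<open>
  By the previous identity \<open>p \<otimes> a \<mapsto> \<beta>(a)(p \<otimes> 1)\<close> is, up to \<open>\<theta>\<close> and the flip, inverse to \<open>W\<close>, and the
  elements \<open>\<beta>(b)(1 \<otimes> y)\<close> are the preimages of \<open>y \<otimes> S(b)\<close> under \<open>W\<close>. So \<open>\<beta>(S(b))\<close> covered from one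
  side is the image of \<open>\<beta>(b)\<close> covered from the other.
\<close>

lemma beta_S_ml:
  assumes "W_lift z = y \<otimes> S b"
  shows "\<beta> (S b) * XX.ml (\<theta> y) = mult_of (flip z)"
proof -
  have "beta_ml (theta_id (W_lift z)) = mult_of (flip z)" for z
    by (rule XX.additive_eq[of _ _ z])
      (simp_all add: W_lift_simps theta_id_simps beta_ml_simps flip_simps XX.T.mult_of_linear
        beta_ml_theta)
  from this[of z] show ?thesis by (simp add: assms theta_id_simps beta_ml_simps)
qed

lemma beta_S: "\<beta> (S b) = mult_extend (\<lambda>z. mult_of (flip z)) (\<beta> b)"
proof (rule XX.ml_cancel_right)
  fix y
  obtain y' where y: "y = \<theta> y'" by (rule theta_surj)
  obtain z where z: "\<beta> b * XX.mr y' = mult_of z" "W_lift z = y' \<otimes> S b" by (rule beta_mr)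
  have "mult_extend (\<lambda>z. mult_of (flip z)) (\<beta> b) * XX.ml (\<theta> y') = mult_of (flip z)"
    by (rule XX.T.mult_extend_automorphism_times[OF flip_bij flip_mult flip_mr z(1)])
  then show "\<beta> (S b) * XX.ml y = mult_extend (\<lambda>z. mult_of (flip z)) (\<beta> b) * XX.ml y"
    by (simp add: y beta_S_ml[OF z(2)])
qed

lemma beta_coact:
  "\<exists>u. mult_of u = mult_extend (\<lambda>z. mult_of (theta_id z)) (\<alpha> x) * XA.ml y \<and>
    beta_ml u = mult_of (y \<otimes>\<^sub>X x)"
proof -
  obtain y' where y: "y = \<theta> y'" by (rule theta_surj)
  have ml: "lact (XA.ml (\<theta> y')) (theta_id s) = theta_id (lact (XA.ml y') s)" for s
    by (rule XA.additive_eq[of _ _ s])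
      (simp_all add: theta_id_simps lact_add XA.mten_acts multiplier_acts theta_mult)
  have "mult_extend (\<lambda>z. mult_of (theta_id z)) (\<alpha> x) * XA.ml (\<theta> y') = mult_of (theta_id (W x y'))"
    by (rule XA.T.mult_extend_automorphism_times[OF theta_id_bij theta_id_mult ml])
      (simp add: mult_of_W)
  then show ?thesis using beta_ml_theta[of x y'] by (metis y)
qed

text \<open>
  With \<open>a = S(b)\<close> and \<open>u\<close> the image of \<open>z = \<beta>(b)(1 \<otimes> y')\<close>, the product \<open>\<theta>(q) p\<close> over \<open>u\<close> is \<open>\<theta>\<close> of the
  product over \<open>z\<close>, which is the counit applied to the second leg of \<open>W(z) = y' \<otimes> S(b)\<close>.
\<close>

lemma beta_counit:
  "\<exists>u. mult_of u = \<beta> a * XX.ml y \<and>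
    tensor_lift sXX (\<otimes>\<^sub>X) sX (\<lambda>p q. \<theta> q * p) u = sX (\<epsilon> a) y"
proof -
  obtain y' where y: "y = \<theta> y'" by (rule theta_surj)
  obtain b where a: "a = S b" using bij_S by (metis bij_pointE)
  obtain z where z: "W_lift z = y' \<otimes> S b" using beta_mr by metis
  have "bilin sX sX sX (\<lambda>p q. \<theta> q * p)"
    by (rule bilin_swap, rule bilin_comp2[OF X.bilin_mult theta_lin lin_id[OF X.vector_space_axioms]])
  note m = XX.lift_simps[OF this]
  note e = characterD(1)[OF counit_character]
  have "tensor_lift sXX (\<otimes>\<^sub>X) sX (\<lambda>p q. \<theta> q * p) (flip t) = \<theta> (XA.rslice \<epsilon> (W_lift t))" for t
    by (rule XX.additive_eq[of _ _ t])
      (simp_all add: m flip_simps W_lift_simps XA.rslice_simps[OF e] lin_simps[OF theta_lin]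
        character_W[OF counit_character] R_counit theta_mult)
  from this[of z] have "tensor_lift sXX (\<otimes>\<^sub>X) sX (\<lambda>p q. \<theta> q * p) (flip z) = sX (\<epsilon> a) y"
    by (simp add: z XA.rslice_simps[OF e] lin_simps[OF theta_lin] a y)
  moreover have "mult_of (flip z) = \<beta> a * XX.ml y"
    by (simp add: beta_S_ml[OF z] a y)
  ultimately show ?thesis by blast
qed

lemma beta_SS:
  "\<beta> (S (S a)) = mult_extend (\<lambda>z. mult_of (tensor_lift sXX (\<otimes>\<^sub>X) sXX (\<lambda>p q. \<theta> p \<otimes>\<^sub>X \<theta> q) z)) (\<beta> a)"
proof -
  note t = XX.lift_simps[OF bilin_comp2[OF XX.bilin_tensor theta_lin theta_lin]]
  have "tensor_lift sXX (\<otimes>\<^sub>X) sXX (\<lambda>p q. \<theta> p \<otimes>\<^sub>X \<theta> q) z = flip (flip z)" for z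
    by (rule XX.additive_eq[of _ _ z]) (simp_all add: t flip_simps)
  moreover have "\<beta> (S (S a)) = mult_extend (\<lambda>z. mult_of (flip (flip z))) (\<beta> a)"
  proof (rule XX.T.multiplier_eq_lact)
    fix x
    have ff: "bij (\<lambda>z. flip (flip z))" using bij_comp[OF flip_bij flip_bij] by (simp add: comp_def)
    obtain t where "x = flip t" using flip_bij by (metis bij_pointE)
    moreover obtain s where "t = flip s" using flip_bij by (metis bij_pointE)
    ultimately have x: "x = flip (flip s)" by simp
    have flip: "lact (mult_extend (\<lambda>z. mult_of (flip z)) m) (flip s) = flip (lact m s)" for m s
      using flip_bij by (simp add: XX.T.mult_extend_automorphism[OF flip_bij flip_mult] bij_is_inj)
    have flip2: "lact (mult_extend (\<lambda>z. mult_of (flip (flip z))) m) (flip (flip s)) = flip (flip (lact m s))" for m s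
      using inv_f_f[OF bij_is_inj[OF ff], of s]
      by (simp add: XX.T.mult_extend_automorphism[OF ff] flip_mult)
    show "lact (\<beta> (S (S a))) x = lact (mult_extend (\<lambda>z. mult_of (flip (flip z))) (\<beta> a)) x"
      by (simp add: beta_S x flip flip2)
  qed
  ultimately show ?thesis by simp
qed

end

section \<open>The four identities\<close>

theorem proposition2p18:
  fixes sA :: "'k::field \<Rightarrow> 'a::ring \<Rightarrow> 'a"
    and sAA :: "'k \<Rightarrow> 'aa::ring \<Rightarrow> 'aa" and tAA :: "'a \<Rightarrow> 'a \<Rightarrow> 'aa"
    and sAAA :: "'k \<Rightarrow> 'aaa::ring \<Rightarrow> 'aaa"
    and tAA_A :: "'aa \<Rightarrow> 'a \<Rightarrow> 'aaa" and tA_AA :: "'a \<Rightarrow> 'aa \<Rightarrow> 'aaa"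
    and \<Delta> :: "'a \<Rightarrow> 'aa multiplier" and \<phi> \<epsilon> :: "'a \<Rightarrow> 'k" and S \<sigma> :: "'a \<Rightarrow> 'a"
    and sX :: "'k \<Rightarrow> 'x::ring \<Rightarrow> 'x"
    and sXA :: "'k \<Rightarrow> 'xa::ring \<Rightarrow> 'xa" and tXA :: "'x \<Rightarrow> 'a \<Rightarrow> 'xa"
    and sXAA :: "'k \<Rightarrow> 'xaa::ring \<Rightarrow> 'xaa"
    and tXA_A :: "'xa \<Rightarrow> 'a \<Rightarrow> 'xaa" and tX_AA :: "'x \<Rightarrow> 'aa \<Rightarrow> 'xaa"
    and sXX :: "'k \<Rightarrow> 'xx::ring \<Rightarrow> 'xx" and tXX :: "'x \<Rightarrow> 'x \<Rightarrow> 'xx" (infixl "\<otimes>" 75)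
    and \<alpha> :: "'x \<Rightarrow> 'xa multiplier" and \<beta> :: "'a \<Rightarrow> 'xx multiplier"
    and \<phi>X :: "'x \<Rightarrow> 'k" and \<sigma>X \<theta> :: "'x \<Rightarrow> 'x"
  assumes "algebraic_quantum_group sA sAA tAA sAAA tAA_A tA_AA \<Delta> \<phi>"
    and "is_counit sA sAA tAA \<Delta> \<epsilon>"
    and "is_antipode sA sAA tAA \<Delta> \<epsilon> S"
    and "is_modular_automorphism sA \<phi> \<sigma>"
    and "galois_object sA sAA tAA sAAA tAA_A tA_AA \<Delta> sX sXA tXA sXAA tXA_A tX_AA \<alpha> sXX tXX"
    and "is_beta sXA tXA sXX tXX \<alpha> S \<beta>"
    and "is_phi_X sX sXA tXA \<alpha> \<phi> \<phi>X"
    and "is_sigma_X sX \<phi>X \<sigma>X"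
    and "\<theta> = theta_X sX sXA tXA \<alpha> \<epsilon> \<sigma> \<sigma>X"
  shows
    "(\<forall>a. \<beta> (S a) =
        mult_extend (\<lambda>z. mult_of (tensor_lift sXX (\<otimes>) sXX (\<lambda>p q. \<theta> q \<otimes> p) z)) (\<beta> a)) \<and>
     (\<forall>x y. \<exists>u. mult_of u =
        mult_extend (\<lambda>z. mult_of (tensor_lift sXA tXA sXA (\<lambda>p a. tXA (\<theta> p) a) z)) (\<alpha> x)
          * mult_tensor tXA (mult_of y) 1 \<and>
        tensor_lift sXA tXA (mult_scale sXX)
          (\<lambda>p a. \<beta> a * mult_tensor (\<otimes>) (mult_of p) 1) u = mult_of (y \<otimes> x)) \<and>
     (\<forall>a y. \<exists>u. mult_of u = \<beta> a * mult_tensor (\<otimes>) (mult_of y) 1 \<and>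
        tensor_lift sXX (\<otimes>) sX (\<lambda>p q. \<theta> q * p) u = sX (\<epsilon> a) y) \<and>
     (\<forall>a. \<beta> (S (S a)) =
        mult_extend (\<lambda>z. mult_of (tensor_lift sXX (\<otimes>) sXX (\<lambda>p q. \<theta> p \<otimes> \<theta> q) z)) (\<beta> a))"
proof -
  interpret M: algebraic_quantum_group sA sAA tAA sAAA tAA_A tA_AA \<Delta> \<phi> by fact
  interpret O: galois_object sA sAA tAA sAAA tAA_A tA_AA \<Delta> sX sXA tXA sXAA tXA_A tX_AA \<alpha> sXX tXX
    by fact
  interpret I: galois_setup sA sAA tAA sAAA tAA_A tA_AA \<Delta> \<phi> \<epsilon> S \<sigma>
    sX sXA tXA sXAA tXA_A tX_AA \<alpha> sXX tXX \<beta> \<phi>X \<sigma>X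
    by unfold_locales (fact assms O.galois_bij)+
  have \<theta>: "\<theta> = I.\<theta>" using assms(9) by (simp add: I.theta_X)
  show ?thesis
    unfolding \<theta>
    using I.beta_S I.beta_coact I.beta_counit I.beta_SS
    unfolding I.flip_def I.theta_id_def I.beta_ml_def by blast
qed

end
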